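(* Let $T$ be an invertible $2d\times 2d$ matrix satisfying $$T^{-1}=\begin{pmatrix}A&B\\C&D\end{pmatrix}$$ with $A,B,C,D$ matrices of size $d\times d$, and let $\mu,\nu\in\mathcal{S}'(\mathbb{R}^d)$. (i) Suppose that $\det A\neq0$ and $\det B\neq0$. If both $\Pi_1\operatorname{supp}W_T(\mu,\nu)$ and $\Pi_2\operatorname{supp}W_T(\mu,\nu)$ are uniformly discrete sets, then $\operatorname{supp}\mu$, $\operatorname{supp}\nu$, $\operatorname{supp}\widehat{\mu}$ and $\operatorname{supp}\widehat{\nu}$ are uniformly discrete sets. (ii) Suppose that $\det A\neq0$ or $\det B\neq0$. If both $\Pi_1\operatorname{supp}W_T(\mu)$ and $\Pi_2\operatorname{supp}W_T(\mu)$ are uniformly discrete sets, then $\operatorname{supp}\mu$ and $\operatorname{supp}\widehat{\mu}$ are uniformly discrete sets.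
   Context: A set $E\subset\mathbb{R}^d$ is uniformly discrete if there is $\delta>0$ such that $|r-s|\ge\delta$ for all $r,s\in E$ with $r\ne s$. For $E\subset\mathbb{R}^{2d}=\mathbb{R}^d_x\times\mathbb{R}^d_\omega$, $\Pi_1(E)=\{x:\exists\,\omega,\ (x,\omega)\in E\}$ and $\Pi_2(E)=\{\omega:\exists\,x,\ (x,\omega)\in E\}$. The Fourier transform is $\widehat f(\omega)=\int_{\mathbb{R}^d}f(t)e^{-2\pi i\omega t}\,dt$, extended to $\mathcal{S}'(\mathbb{R}^d)$. For an invertible linear map $T:\mathbb{R}^{2d}\to\mathbb{R}^{2d}$ the same letter denotes the matrix of the map and the change of coordinate operator $TF=F\circ T$, extended to $\mathcal{S}'(\mathbb{R}^{2d})$ in the natural way (pull-back). $\mathcal{F}_2$ is the partial Fourier transform $\mathcal{F}_2F(x,\omega)=\int_{\mathbb{R}^d}F(x,t)e^{-2\pi i\omega t}\,dt$, extended to $\mathcal{S}'(\mathbb{R}^{2d})$. The matrix-Wigner transform of $\mu,\nu\in\mathcal{S}'(\mathbb{R}^d)$ is $W_T(\mu,\nu)=\mathcal{F}_2\left(T(\mu\otimes\overline{\nu})\right)\in\mathcal{S}'(\mathbb{R}^{2d})$, where $\overline{\nu}$ is the complex conjugate distribution; $W_T(\mu):=W_T(\mu,\mu)$.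
   Formalization: In part (i) both μ and ν are assumed to be nonzero; without this the claim fails, e.g. for ν = 0 and μ = 1, where W_T(μ,ν) = 0 has empty support but supp μ is all of R^d. *)

theory Defs
  imports "HOL-Analysis.Analysis"
begin

section \<open>Schwartz functions and tempered distributions\<close>

primrec iter_deriv :: "'a::euclidean_space list \<Rightarrow> ('a \<Rightarrow> complex) \<Rightarrow> 'a \<Rightarrow> complex" where
  "iter_deriv [] f = f"
| "iter_deriv (v # vs) f = (\<lambda>x. frechet_derivative (iter_deriv vs f) (at x) v)"

text \<open>
  Multi-indices are replaced by lists of basis vectors. Differentiability of all iterated
  partial derivatives makes them all continuous, so \<open>f\<close> is infinitely differentiable.
\<close>

definition schwartz :: "('a::euclidean_space \<Rightarrow> complex) \<Rightarrow> bool" where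
  "schwartz f \<longleftrightarrow>
     (\<forall>vs. set vs \<subseteq> Basis \<longrightarrow>
        (\<forall>x. iter_deriv vs f differentiable (at x)) \<and>
        (\<forall>k. bounded (range (\<lambda>x. (1 + norm x) ^ k * norm (iter_deriv vs f x)))))"

definition schwartz_seminorm :: "nat \<Rightarrow> 'a::euclidean_space list \<Rightarrow> ('a \<Rightarrow> complex) \<Rightarrow> real" where
  "schwartz_seminorm k vs f = (SUP x. (1 + norm x) ^ k * norm (iter_deriv vs f x))"

type_synonym 'a functional = "('a \<Rightarrow> complex) \<Rightarrow> complex"

text \<open>
  Only the values of a functional on Schwartz functions are meaningful; nothing below depends on
  the other values. The last conjunct is continuity for the topology defined by the seminorms.
\<close>

definition tempered_distribution :: "'a::euclidean_space functional \<Rightarrow> bool" where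
  "tempered_distribution u \<longleftrightarrow>
     (\<forall>f g. schwartz f \<longrightarrow> schwartz g \<longrightarrow> u (\<lambda>x. f x + g x) = u f + u g) \<and>
     (\<forall>c f. schwartz f \<longrightarrow> u (\<lambda>x. c * f x) = c * u f) \<and>
     (\<exists>C N. \<forall>f. schwartz f \<longrightarrow>
        norm (u f) \<le> C * (\<Sum>vs | set vs \<subseteq> Basis \<and> length vs \<le> N. schwartz_seminorm N vs f))"

definition nonzero_distribution :: "'a::euclidean_space functional \<Rightarrow> bool" where
  "nonzero_distribution u \<longleftrightarrow> (\<exists>f. schwartz f \<and> u f \<noteq> 0)"

text \<open>
  The support is the complement of the largest open set on which the distribution vanishes;
  a compactly supported Schwartz function is the same thing as a compactly supported
  smooth function.
\<close>

definition vanishes_on :: "'a::euclidean_space functional \<Rightarrow> 'a set \<Rightarrow> bool" where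
  "vanishes_on u U \<longleftrightarrow>
     (\<forall>f. schwartz f \<and> compact (closure {x. f x \<noteq> 0}) \<and> closure {x. f x \<noteq> 0} \<subseteq> U \<longrightarrow> u f = 0)"

definition dist_support :: "'a::euclidean_space functional \<Rightarrow> 'a set" where
  "dist_support u = - \<Union>{U. open U \<and> vanishes_on u U}"


section \<open>Operations on distributions\<close>

text \<open>
  All operations are transposes with respect to the bilinear pairing of functions
  \<open>(f, g) \<mapsto> \<integral> f g\<close>, so that they extend the corresponding operations on functions.
\<close>

definition fourier_fun :: "('a::euclidean_space \<Rightarrow> complex) \<Rightarrow> 'a \<Rightarrow> complex" where
  "fourier_fun f w = (\<integral>t. f t * exp (- (2 * of_real pi * \<i> * of_real (w \<bullet> t))) \<partial>lborel)"

definition fourier :: "'a::euclidean_space functional \<Rightarrow> 'a functional" where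
  "fourier u = (\<lambda>f. u (fourier_fun f))"

definition fourier2_fun ::
  "('a::euclidean_space \<times> 'a \<Rightarrow> complex) \<Rightarrow> 'a \<times> 'a \<Rightarrow> complex" where
  "fourier2_fun F = (\<lambda>(x, w). fourier_fun (\<lambda>t. F (x, t)) w)"

definition fourier2 :: "('a::euclidean_space \<times> 'a) functional \<Rightarrow> ('a \<times> 'a) functional" where
  "fourier2 u = (\<lambda>F. u (fourier2_fun F))"

definition cnj_dist :: "'a::euclidean_space functional \<Rightarrow> 'a functional" where
  "cnj_dist u = (\<lambda>f. cnj (u (\<lambda>x. cnj (f x))))"

definition tensor_dist ::
  "'a::euclidean_space functional \<Rightarrow> 'b::euclidean_space functional \<Rightarrow> ('a \<times> 'b) functional" where
  "tensor_dist u v = (\<lambda>F. u (\<lambda>x. v (\<lambda>t. F (x, t))))"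


section \<open>Matrices acting on phase space\<close>

text \<open>
  A \<open>2d \<times> 2d\<close> matrix is indexed by the sum type \<open>'n + 'n\<close>, the left summand
  carrying the first \<open>d\<close> coordinates; the phase space is the product of two copies of
  \<open>real ^ 'n\<close>.
\<close>

definition block_matrix ::
  "'a ^ 'n ^ 'n \<Rightarrow> 'a ^ 'n ^ 'n \<Rightarrow> 'a ^ 'n ^ 'n \<Rightarrow> 'a ^ 'n ^ 'n \<Rightarrow> 'a ^ ('n + 'n) ^ ('n + 'n)" where
  "block_matrix A B C D =
     (\<chi> i j. case (i, j) of
        (Inl k, Inl l) \<Rightarrow> A $ k $ l
      | (Inl k, Inr l) \<Rightarrow> B $ k $ l
      | (Inr k, Inl l) \<Rightarrow> C $ k $ l
      | (Inr k, Inr l) \<Rightarrow> D $ k $ l)"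

definition join_vec :: "('a ^ 'n) \<times> ('a ^ 'n) \<Rightarrow> 'a ^ ('n + 'n)" where
  "join_vec z = (\<chi> i. case i of Inl k \<Rightarrow> fst z $ k | Inr k \<Rightarrow> snd z $ k)"

definition split_vec :: "'a ^ ('n + 'n) \<Rightarrow> ('a ^ 'n) \<times> ('a ^ 'n)" where
  "split_vec v = ((\<chi> k. v $ Inl k), (\<chi> k. v $ Inr k))"

definition phase_map ::
  "real ^ ('n + 'n) ^ ('n::finite + 'n) \<Rightarrow> (real ^ 'n) \<times> (real ^ 'n) \<Rightarrow> (real ^ 'n) \<times> (real ^ 'n)" where
  "phase_map M z = split_vec (M *v join_vec z)"

text \<open>
  For a function \<open>F\<close>, substituting \<open>z = T\<^sup>-\<^sup>1 w\<close> gives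
  \<open>\<integral> F (T z) \<Phi> z dz = \<bar>det T\<bar>\<^sup>-\<^sup>1 \<integral> F w \<Phi> (T\<^sup>-\<^sup>1 w) dw\<close>; hence the pull-back \<open>F \<circ> T\<close> of a distribution.
\<close>

definition pullback ::
  "real ^ ('n + 'n) ^ ('n::finite + 'n) \<Rightarrow> ((real ^ 'n) \<times> (real ^ 'n)) functional
     \<Rightarrow> ((real ^ 'n) \<times> (real ^ 'n)) functional" where
  "pullback T u = (\<lambda>F. u (F \<circ> phase_map (matrix_inv T)) / of_real \<bar>det T\<bar>)"

definition matrix_wigner ::
  "real ^ ('n + 'n) ^ ('n::finite + 'n) \<Rightarrow> (real ^ 'n) functional \<Rightarrow> (real ^ 'n) functional
     \<Rightarrow> ((real ^ 'n) \<times> (real ^ 'n)) functional" where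
  "matrix_wigner T \<mu> \<nu> = fourier2 (pullback T (tensor_dist \<mu> (cnj_dist \<nu>)))"

end

theory Submission
  imports Defs
begin

text \<open>
  Write \<open>S = T (\<mu> \<otimes> cnj \<nu>)\<close>, so that \<open>W = F\<^sub>2 S\<close>. As \<open>F\<^sub>2\<close> acts on the second variable only, the
  projection of \<open>supp S = T\<^sup>-\<^sup>1 (supp \<mu> \<times> supp \<nu>)\<close> to the first factor lies in the closed set
  \<open>\<Pi>\<^sub>1 supp W\<close>: \<open>A s + B t \<in> \<Pi>\<^sub>1 supp W\<close> for \<open>s \<in> supp \<mu>\<close>, \<open>t \<in> supp \<nu>\<close>. Fixing one of the points, an
  injective affine map sends the other support into a uniformly discrete set. Dually, \<open>F\<^sub>1 W\<close> is
  the full Fourier transform of \<open>S\<close>, which gives \<open>(T\<^sup>t (s, - t))\<^sub>2 \<in> \<Pi>\<^sub>2 supp W\<close> for \<open>s\<close>, \<open>t\<close> in the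
  supports of the Fourier transforms of \<open>\<mu>\<close>, \<open>\<nu>\<close>.

  On the analytic side, continuity on the Schwartz space is always expressed through bounded sets:
  an indexed family of functions is a bounded set of Schwartz functions iff all its iterated
  derivatives decrease rapidly, uniformly in the index, and every operator involved maps such
  families to such families.
\<close>

section \<open>Smooth families of functions\<close>

text \<open>Both membership claims are proved by contradiction with a single test function. If the
  point lay outside \<open>\<Pi>\<^sub>1 supp W\<close>, choose \<open>f\<close>, \<open>g\<close>
  supported near \<open>s\<close>, \<open>t\<close> with \<open>\<mu> f\<close> and
  \<open>\<nu> g\<close> nonzero and solve
  \<open>F\<^sub>2 F = c (f \<otimes> cnj g) \<circ> T\<close> for \<open>F\<close>: then
  \<open>W F\<close> is nonzero, yet \<open>F\<close> lives over a small ball above which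
  \<open>W\<close> has no support. Such an \<open>F\<close> is a partial Fourier transform, not
  compactly supported, whereas supports are defined by compactly supported test functions. Extending
  the vanishing to closed supports is where the continuity of \<open>W\<close> is spent, and this
  continuity is what forces the work on families: Fourier transforms and partial application of a
  functional must map bounded families to bounded families. Solving for \<open>F\<close> takes
  inversion and linear substitutions only up to nonzero constants, since nonvanishing is all that is
  at stake; hence no Gaussian and no determinant formula for integrals. Uniform discreteness is used
  twice: as closedness of the projections, and as the property carried back through injective affine
  maps.\<close>

definition dir_deriv :: "'a::real_normed_vector \<Rightarrow> ('a \<Rightarrow> 'b::real_normed_vector) \<Rightarrow> 'a \<Rightarrow> 'b" where
  "dir_deriv v f x = frechet_derivative f (at x) v"

lemma dir_deriv_eqI: "(f has_derivative f') (at x) \<Longrightarrow> dir_deriv v f x = f' v"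
  by (metis dir_deriv_def frechet_derivative_at)

lemma has_derivative_dir_deriv:
  "f differentiable at x \<Longrightarrow> (f has_derivative (\<lambda>v. dir_deriv v f x)) (at x)"
  using frechet_derivative_works by (auto simp: dir_deriv_def)

lemma linear_dir_deriv: "f differentiable at x \<Longrightarrow> linear (\<lambda>v. dir_deriv v f x)"
  using has_derivative_dir_deriv has_derivative_linear by blast

lemma dir_deriv_expand:
  fixes f :: "'a::euclidean_space \<Rightarrow> 'b::real_normed_vector"
  assumes "f differentiable at x"
  shows "dir_deriv h f x = (\<Sum>b\<in>Basis. (h \<bullet> b) *\<^sub>R dir_deriv b f x)"
proof -
  interpret linear "\<lambda>v. dir_deriv v f x" using linear_dir_deriv[OF assms] .
  have "dir_deriv h f x = dir_deriv (\<Sum>b\<in>Basis. (h \<bullet> b) *\<^sub>R b) f x"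
    by (simp add: euclidean_representation)
  then show ?thesis by (simp add: sum scale)
qed

text \<open>\<open>P\<close> judges the whole family, so bounds uniform in the index can be required
  of every derivative; \<open>rapid\<close>, \<open>slow\<close> and the trivial predicate are the
  instances. The finite order exists for inductions where coinduction is awkward, as for
  products.\<close>

primrec smooth_upto ::
  "(('i \<Rightarrow> 'a::euclidean_space \<Rightarrow> 'b::real_normed_vector) \<Rightarrow> bool) \<Rightarrow> nat \<Rightarrow> ('i \<Rightarrow> 'a \<Rightarrow> 'b) \<Rightarrow> bool"
where
  "smooth_upto P 0 F \<longleftrightarrow> (\<forall>i x. F i differentiable (at x)) \<and> P F"
| "smooth_upto P (Suc n) F \<longleftrightarrow> (\<forall>i x. F i differentiable (at x)) \<and> P F \<and>
     (\<forall>b\<in>Basis. smooth_upto P n (\<lambda>i. dir_deriv b (F i)))"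

definition smooth_family ::
  "(('i \<Rightarrow> 'a::euclidean_space \<Rightarrow> 'b::real_normed_vector) \<Rightarrow> bool) \<Rightarrow> ('i \<Rightarrow> 'a \<Rightarrow> 'b) \<Rightarrow> bool" where
  "smooth_family P F \<longleftrightarrow> (\<forall>n. smooth_upto P n F)"

lemma smooth_upto_mono: "smooth_upto P n F \<Longrightarrow> m \<le> n \<Longrightarrow> smooth_upto P m F"
proof (induction n arbitrary: m F)
  case (Suc n)
  then show ?case by (cases m) auto
qed simp

lemma smooth_familyD:
  assumes "smooth_family P F"
  shows "F i differentiable (at x)" "P F" "b \<in> Basis \<Longrightarrow> smooth_family P (\<lambda>i. dir_deriv b (F i))"
proof -
  have "smooth_upto P 0 F"
    using assms unfolding smooth_family_def by blast
  then show "F i differentiable (at x)" "P F" by simp_all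
  assume "b \<in> Basis"
  moreover have "smooth_upto P (Suc n) F" for n
    using assms unfolding smooth_family_def by blast
  ultimately show "smooth_family P (\<lambda>i. dir_deriv b (F i))"
    unfolding smooth_family_def by simp
qed

text \<open>Any class \<open>Q\<close> stable under basis derivatives will do. Usually
  \<open>Q\<close> is the set of all images under an operator, so that a formula for one derivative
  settles all orders.\<close>

lemma smooth_family_coinduct:
  assumes "Q F"
    and "\<And>F i x. Q F \<Longrightarrow> F i differentiable (at x)"
    and "\<And>F. Q F \<Longrightarrow> P F"
    and "\<And>F b. Q F \<Longrightarrow> b \<in> Basis \<Longrightarrow> Q (\<lambda>i. dir_deriv b (F i))"
  shows "smooth_family P F"
proof -
  have "smooth_upto P n F" if "Q F" for n F
    using that by (induction n arbitrary: F) (auto simp: assms(2-4))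
  then show ?thesis using assms(1) by (auto simp: smooth_family_def)
qed

lemma smooth_family_mono:
  assumes "smooth_family P F" "\<And>F. P F \<Longrightarrow> Q F"
  shows "smooth_family Q F"
  by (rule smooth_family_coinduct[where Q = "smooth_family P"]) (use assms in \<open>auto dest: smooth_familyD\<close>)

lemma smooth_family_reindex:
  fixes F :: "'i \<Rightarrow> 'a::euclidean_space \<Rightarrow> 'b::real_normed_vector" and g :: "'j \<Rightarrow> 'i"
  assumes "smooth_family P F" "\<And>F. P F \<Longrightarrow> Q (\<lambda>j. F (g j))"
  shows "smooth_family Q (\<lambda>j. F (g j))"
  by (rule smooth_family_coinduct[where Q = "\<lambda>G. \<exists>F. smooth_family P F \<and> G = (\<lambda>j. F (g j))"])
    (use assms in \<open>auto dest: smooth_familyD\<close>)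

lemma dir_deriv_add:
  assumes "\<And>x. f differentiable (at x)" "\<And>x. g differentiable (at x)"
  shows "dir_deriv b (\<lambda>x. f x + g x) = (\<lambda>x. dir_deriv b f x + dir_deriv b g x)"
  by (intro ext dir_deriv_eqI derivative_intros has_derivative_dir_deriv assms)

lemma smooth_upto_add:
  assumes "smooth_upto P n F" "smooth_upto P n G"
    and "\<And>F G. P F \<Longrightarrow> P G \<Longrightarrow> P (\<lambda>i x. F i x + G i x)"
  shows "smooth_upto P n (\<lambda>i x. F i x + G i x)"
  using assms(1,2)
proof (induction n arbitrary: F G)
  case 0
  then show ?case using assms(3) by (auto intro!: differentiable_add)
next
  case (Suc n)
  have "dir_deriv b (\<lambda>x. F i x + G i x) = (\<lambda>x. dir_deriv b (F i) x + dir_deriv b (G i) x)" for b i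
    using Suc.prems by (intro dir_deriv_add) auto
  then show ?case using Suc assms(3) by (auto intro!: differentiable_add)
qed

lemma smooth_family_add:
  assumes "smooth_family P F" "smooth_family P G"
    and "\<And>F G. P F \<Longrightarrow> P G \<Longrightarrow> P (\<lambda>i x. F i x + G i x)"
  shows "smooth_family P (\<lambda>i x. F i x + G i x)"
  using assms smooth_upto_add unfolding smooth_family_def by blast

lemma dir_deriv_mult:
  fixes f g :: "'a::real_normed_vector \<Rightarrow> 'b::real_normed_algebra"
  assumes "\<And>x. f differentiable (at x)" "\<And>x. g differentiable (at x)"
  shows "dir_deriv b (\<lambda>x. f x * g x) = (\<lambda>x. f x * dir_deriv b g x + dir_deriv b f x * g x)"
  by (intro ext dir_deriv_eqI derivative_intros has_derivative_dir_deriv assms)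

text \<open>By the Leibniz rule the derivative is a sum of two products, hence outside the class of
  products; an induction on the order, with \<open>R\<close> closed under sums, replaces
  coinduction.\<close>

lemma smooth_upto_mult:
  fixes F G :: "'i \<Rightarrow> 'a::euclidean_space \<Rightarrow> 'b::real_normed_algebra"
  assumes "smooth_upto P n F" "smooth_upto Q n G"
    and "\<And>F G. R F \<Longrightarrow> R G \<Longrightarrow> R (\<lambda>i x. F i x + G i x)"
    and "\<And>F G. P F \<Longrightarrow> Q G \<Longrightarrow> R (\<lambda>i x. F i x * G i x)"
  shows "smooth_upto R n (\<lambda>i x. F i x * G i x)"
  using assms(1,2)
proof (induction n arbitrary: F G)
  case 0
  then show ?case using assms(4) by (auto intro!: differentiable_mult)
next
  case (Suc n)
  have eq: "dir_deriv b (\<lambda>x. F i x * G i x) = (\<lambda>x. F i x * dir_deriv b (G i) x + dir_deriv b (F i) x * G i x)"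
    for b i
    using Suc.prems by (intro dir_deriv_mult) auto
  have "smooth_upto P n F" "smooth_upto Q n G"
    using Suc.prems smooth_upto_mono le_SucI[OF order_refl] by blast+
  then have "smooth_upto R n (\<lambda>i x. F i x * dir_deriv b (G i) x + dir_deriv b (F i) x * G i x)"
    if "b \<in> Basis" for b
    by (intro smooth_upto_add assms(3) Suc.IH) (use Suc.prems that in auto)
  with Suc.prems assms(4) show ?case
    by (auto simp: eq intro!: differentiable_mult)
qed

lemma smooth_family_mult:
  fixes F G :: "'i \<Rightarrow> 'a::euclidean_space \<Rightarrow> 'b::real_normed_algebra"
  assumes "smooth_family P F" "smooth_family Q G"
    and "\<And>F G. R F \<Longrightarrow> R G \<Longrightarrow> R (\<lambda>i x. F i x + G i x)"
    and "\<And>F G. P F \<Longrightarrow> Q G \<Longrightarrow> R (\<lambda>i x. F i x * G i x)"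
  shows "smooth_family R (\<lambda>i x. F i x * G i x)"
  using assms smooth_upto_mult unfolding smooth_family_def by blast

lemma smooth_upto_const:
  assumes "\<And>c. P (\<lambda>i x. c i)"
  shows "smooth_upto P n (\<lambda>i x. c i)"
  by (induction n arbitrary: c) (auto simp: assms dir_deriv_def[abs_def])

lemma smooth_upto_sum:
  assumes "finite A" "\<And>a. a \<in> A \<Longrightarrow> smooth_upto P n (F a)"
    and "\<And>F G. P F \<Longrightarrow> P G \<Longrightarrow> P (\<lambda>i x. F i x + G i x)" "P (\<lambda>i x. 0)"
  shows "smooth_upto P n (\<lambda>i x. \<Sum>a\<in>A. F a i x)"
  using assms(1,2)
proof (induction A)
  case empty
  have "smooth_upto P n (\<lambda>i x. 0)"
    using assms(4) by (induction n) (auto simp: dir_deriv_def[abs_def])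
  then show ?case by simp
next
  case (insert a A)
  then show ?case using assms(3) by (simp add: smooth_upto_add)
qed

lemma smooth_upto_scaleR:
  assumes "smooth_upto P n F" "\<And>F. P F \<Longrightarrow> P (\<lambda>i x. c *\<^sub>R F i x)"
  shows "smooth_upto P n (\<lambda>i x. c *\<^sub>R F i x)"
  using assms(1)
proof (induction n arbitrary: F)
  case 0
  then show ?case using assms(2) by (auto intro!: differentiable_scaleR)
next
  case (Suc n)
  have "dir_deriv b (\<lambda>x. c *\<^sub>R F i x) = (\<lambda>x. c *\<^sub>R dir_deriv b (F i) x)" for b i
    using Suc.prems by (intro ext dir_deriv_eqI derivative_intros has_derivative_dir_deriv) auto
  with Suc assms(2) show ?case by (auto intro!: differentiable_scaleR)
qed

lemma dir_deriv_compose: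
  assumes "g differentiable (at x)" "f differentiable (at (g x))"
  shows "dir_deriv b (\<lambda>x. f (g x)) x = dir_deriv (dir_deriv b g x) f (g x)"
  using diff_chain_at[OF has_derivative_dir_deriv[OF assms(1)] has_derivative_dir_deriv[OF assms(2)]]
  by (simp add: o_def dir_deriv_eqI)

lemma differentiable_compose_at:
  "g differentiable (at x) \<Longrightarrow> f differentiable (at (g x)) \<Longrightarrow> (\<lambda>x. f (g x)) differentiable (at x)"
  using differentiable_chain_at by (fastforce simp: o_def)

text \<open>The chain rule expresses a derivative as a finite linear combination of functions
  \<open>dir_deriv c (F i) \<circ> L\<close>, so \<open>Q\<close> has to be stable under linear
  combinations.\<close>

lemma smooth_upto_compose_linear:
  fixes F :: "'i \<Rightarrow> 'b::euclidean_space \<Rightarrow> 'c::real_normed_vector" and L :: "'a::euclidean_space \<Rightarrow> 'b"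
  assumes "smooth_upto P n F" "bounded_linear L"
    and "\<And>F G. Q F \<Longrightarrow> Q G \<Longrightarrow> Q (\<lambda>i x. F i x + G i x)"
    and "\<And>F c. Q F \<Longrightarrow> Q (\<lambda>i x. c *\<^sub>R F i x)" "Q (\<lambda>i x. 0)"
    and "\<And>F. P F \<Longrightarrow> Q (\<lambda>i x. F i (L x))"
  shows "smooth_upto Q n (\<lambda>i x. F i (L x))"
  using assms(1)
proof (induction n arbitrary: F)
  case 0
  then have "(\<lambda>x. F i (L x)) differentiable (at x)" for i x
    using bounded_linear_imp_differentiable[OF assms(2)]
    by - (rule differentiable_compose_at[where g = L], auto)
  then show ?case using 0 assms(6) by simp
next
  case (Suc n)
  have L: "L differentiable (at x)" for x
    using bounded_linear_imp_differentiable[OF assms(2)] .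
  have dL: "dir_deriv b L x = L b" for b x
    by (rule dir_deriv_eqI[OF bounded_linear_imp_has_derivative[OF assms(2)]])
  have eq: "dir_deriv b (\<lambda>x. F i (L x)) = (\<lambda>x. \<Sum>c\<in>Basis. (L b \<bullet> c) *\<^sub>R dir_deriv c (F i) (L x))" for b i
  proof
    fix x
    have "F i differentiable (at (L x))" using Suc.prems by simp
    then show "dir_deriv b (\<lambda>x. F i (L x)) x = (\<Sum>c\<in>Basis. (L b \<bullet> c) *\<^sub>R dir_deriv c (F i) (L x))"
      using L by (simp add: dir_deriv_compose dL flip: dir_deriv_expand)
  qed
  have "smooth_upto Q n (\<lambda>i. dir_deriv b (\<lambda>x. F i (L x)))" for b
    unfolding eq
    by (intro smooth_upto_sum smooth_upto_scaleR assms(3-5) Suc.IH) (use Suc.prems in auto)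
  moreover have "(\<lambda>x. F i (L x)) differentiable (at x)" for i x
    using Suc.prems L by - (rule differentiable_compose_at[where g = L], auto)
  ultimately show ?case using Suc.prems assms(6) by simp
qed

lemma smooth_family_compose_linear:
  fixes F :: "'i \<Rightarrow> 'b::euclidean_space \<Rightarrow> 'c::real_normed_vector" and L :: "'a::euclidean_space \<Rightarrow> 'b"
  assumes "smooth_family P F" "bounded_linear L"
    and "\<And>F G. Q F \<Longrightarrow> Q G \<Longrightarrow> Q (\<lambda>i x. F i x + G i x)"
    and "\<And>F c. Q F \<Longrightarrow> Q (\<lambda>i x. c *\<^sub>R F i x)" "Q (\<lambda>i x. 0)"
    and "\<And>F. P F \<Longrightarrow> Q (\<lambda>i x. F i (L x))"
  shows "smooth_family Q (\<lambda>i x. F i (L x))"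
  using assms smooth_upto_compose_linear unfolding smooth_family_def by blast

lemma smooth_upto_iter_deriv:
  fixes F :: "'i \<Rightarrow> 'a::euclidean_space \<Rightarrow> complex"
  shows "smooth_upto P n F \<longleftrightarrow> (\<forall>vs. set vs \<subseteq> Basis \<and> length vs \<le> n \<longrightarrow>
     (\<forall>i x. iter_deriv vs (F i) differentiable (at x)) \<and> P (\<lambda>i. iter_deriv vs (F i)))"
proof (induction n arbitrary: F)
  case (Suc n)
  \<comment> \<open>The head of the list is the outermost derivative, whereas
    \<open>smooth_upto\<close> strips the innermost one, so lists are taken apart at their
    end.\<close>
  have snoc: "iter_deriv (vs @ [b]) f = iter_deriv vs (dir_deriv b f)" for vs b and f :: "'a \<Rightarrow> complex"
    by (induction vs) (auto simp: dir_deriv_def[abs_def])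
  show ?case (is "?L = (\<forall>vs. ?R vs)")
  proof
    assume L: ?L
    show "\<forall>vs. ?R vs"
    proof
      fix vs
      show "?R vs"
      proof (cases vs rule: rev_cases)
        case (snoc ws b)
        then show ?thesis using L Suc.IH by (auto simp: \<open>\<And>vs b f. iter_deriv (vs @ [b]) f = _ vs b f\<close>)
      qed (use L in auto)
    qed
  next
    assume R: "\<forall>vs. ?R vs"
    have "smooth_upto P n (\<lambda>i. dir_deriv b (F i))" if "b \<in> Basis" for b
      unfolding Suc.IH
    proof (intro allI impI)
      fix vs :: "'a list" assume "set vs \<subseteq> Basis \<and> length vs \<le> n"
      then show "(\<forall>i x. iter_deriv vs (dir_deriv b (F i)) differentiable at x) \<and>
          P (\<lambda>i. iter_deriv vs (dir_deriv b (F i)))"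
        using R[rule_format, of "vs @ [b]"] that by (simp add: snoc)
    qed
    with R[rule_format, of "[]"] show ?L by simp
  qed
qed auto

section \<open>Rapid decay and polynomial growth, uniform in the index\<close>

definition rapid :: "('i \<Rightarrow> 'a::real_normed_vector \<Rightarrow> 'b::real_normed_vector) \<Rightarrow> bool" where
  "rapid F \<longleftrightarrow> (\<forall>k. \<exists>C. \<forall>i x. (1 + norm x) ^ k * norm (F i x) \<le> C)"

text \<open>Smooth families with this bound are the multipliers of Schwartz families. The exponent
  may change from one derivative to the next, but not with the index.\<close>

definition slow :: "('i \<Rightarrow> 'a::real_normed_vector \<Rightarrow> 'b::real_normed_vector) \<Rightarrow> bool" where
  "slow F \<longleftrightarrow> (\<exists>k C. \<forall>i x. norm (F i x) \<le> C * (1 + norm x) ^ k)"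

abbreviation "schwartz_family \<equiv> smooth_family rapid"
abbreviation "slow_family \<equiv> smooth_family slow"

text \<open>Constant families carry every result on families over to single functions; any index
  type serves.\<close>

lemma schwartz_family_single:
  fixes f :: "'a::euclidean_space \<Rightarrow> complex"
  shows "schwartz_family (\<lambda>_::'i. f) \<longleftrightarrow> schwartz f"
proof -
  have "rapid (\<lambda>_::'i. g) \<longleftrightarrow> (\<forall>k. bounded (range (\<lambda>x. (1 + norm x) ^ k * norm (g x))))"
    for g :: "'a \<Rightarrow> complex"
    unfolding rapid_def bounded_iff by (auto simp: abs_mult)
  then show ?thesis
    unfolding smooth_family_def smooth_upto_iter_deriv schwartz_def by blast
qed

lemma rapid_add: "rapid F \<Longrightarrow> rapid G \<Longrightarrow> rapid (\<lambda>i x. F i x + G i x)"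
  unfolding rapid_def
proof
  fix k assume "\<forall>k. \<exists>C. \<forall>i x. (1 + norm x) ^ k * norm (F i x) \<le> C"
    "\<forall>k. \<exists>C. \<forall>i x. (1 + norm x) ^ k * norm (G i x) \<le> C"
  then obtain C D where "\<And>i x. (1 + norm x) ^ k * norm (F i x) \<le> C"
    "\<And>i x. (1 + norm x) ^ k * norm (G i x) \<le> D" by meson
  then have "(1 + norm x) ^ k * norm (F i x + G i x) \<le> C + D" for i x
    by (smt (verit) distrib_left mult_left_mono norm_ge_zero norm_triangle_ineq zero_le_power)
  then show "\<exists>C. \<forall>i x. (1 + norm x) ^ k * norm (F i x + G i x) \<le> C" by blast
qed

lemma rapid_slow_mult:
  fixes F G :: "'i \<Rightarrow> 'a::real_normed_vector \<Rightarrow> 'b::real_normed_algebra"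
  assumes "slow F" "rapid G"
  shows "rapid (\<lambda>i x. F i x * G i x)"
  unfolding rapid_def
proof
  fix k
  obtain m C where C: "\<And>i x. norm (F i x) \<le> C * (1 + norm x) ^ m"
    using assms unfolding slow_def by blast
  obtain D where D: "\<And>i x. (1 + norm x) ^ (k + m) * norm (G i x) \<le> D"
    using assms unfolding rapid_def by blast
  have "(1 + norm x) ^ k * norm (F i x * G i x) \<le> C * D" for i x
  proof -
    have "0 \<le> C" using order_trans[OF norm_ge_zero C[of i 0]] by simp
    have "(1 + norm x) ^ k * norm (F i x * G i x) \<le> (1 + norm x) ^ k * ((C * (1 + norm x) ^ m) * norm (G i x))"
      by (intro mult_left_mono order_trans[OF norm_mult_ineq] mult_right_mono C) auto
    also have "\<dots> = C * ((1 + norm x) ^ (k + m) * norm (G i x))" by (simp add: power_add)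
    also have "\<dots> \<le> C * D" using \<open>0 \<le> C\<close> by (intro mult_left_mono D)
    finally show ?thesis .
  qed
  then show "\<exists>C. \<forall>i x. (1 + norm x) ^ k * norm (F i x * G i x) \<le> C" by blast
qed

lemma slow_add: 
  assumes "slow F" "slow G"
  shows "slow (\<lambda>i x. F i x + G i x)"
proof -
  obtain k l C D where F: "\<And>i x. norm (F i x) \<le> C * (1 + norm x) ^ k"
    and G: "\<And>i x. norm (G i x) \<le> D * (1 + norm x) ^ l"
    using assms unfolding slow_def by metis
  have "norm (F i x + G i x) \<le> (C + D) * (1 + norm x) ^ (k + l)" for i x
  proof -
    have "0 \<le> C" using order_trans[OF norm_ge_zero F[of i 0]] by simp
    have "0 \<le> D" using order_trans[OF norm_ge_zero G[of i 0]] by simp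
    have "norm (F i x) \<le> C * (1 + norm x) ^ (k + l)"
      using \<open>0 \<le> C\<close> by (intro order_trans[OF F] mult_left_mono power_increasing) auto
    moreover have "norm (G i x) \<le> D * (1 + norm x) ^ (k + l)"
      using \<open>0 \<le> D\<close> by (intro order_trans[OF G] mult_left_mono power_increasing) auto
    ultimately show ?thesis
      by (smt (verit) distrib_right norm_triangle_ineq)
  qed
  then show ?thesis unfolding slow_def by blast
qed

lemma rapid_scaleR:
  fixes F :: "'i \<Rightarrow> 'a::real_normed_vector \<Rightarrow> 'b::real_normed_vector"
  assumes "rapid F" shows "rapid (\<lambda>i x. c *\<^sub>R F i x)"
  unfolding rapid_def
proof
  fix k
  obtain C where "\<And>i x. (1 + norm x) ^ k * norm (F i x) \<le> C"
    using assms unfolding rapid_def by meson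
  then have "(1 + norm x) ^ k * norm (c *\<^sub>R F i x) \<le> \<bar>c\<bar> * C" for i x
    using mult_left_mono[of "(1 + norm x) ^ k * norm (F i x)" C "\<bar>c\<bar>"] by (simp add: mult_ac)
  then show "\<exists>C. \<forall>i x. (1 + norm x) ^ k * norm (c *\<^sub>R F i x) \<le> C" by blast
qed

lemma rapid_0 [simp]: "rapid (\<lambda>i x. 0)"
  unfolding rapid_def by auto

lemma rapid_reindex: "rapid F \<Longrightarrow> rapid (\<lambda>j. F (g j))"
  unfolding rapid_def by meson

lemma schwartz_family_reindex: "schwartz_family F \<Longrightarrow> schwartz_family (\<lambda>j. F (g j))"
  by (rule smooth_family_reindex[where P = rapid]) (auto intro: rapid_reindex)

lemma schwartz_familyD: "schwartz_family F \<Longrightarrow> schwartz (F i)"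
  using schwartz_family_reindex[of F "\<lambda>_::unit. i"] schwartz_family_single by blast

lemma schwartz_family_add:
  "schwartz_family F \<Longrightarrow> schwartz_family G \<Longrightarrow> schwartz_family (\<lambda>i x. F i x + G i x)"
  by (rule smooth_family_add) (auto intro: rapid_add)

lemma schwartz_family_slow_mult:
  fixes F G :: "'i \<Rightarrow> 'a::euclidean_space \<Rightarrow> 'b::real_normed_algebra"
  shows "slow_family F \<Longrightarrow> schwartz_family G \<Longrightarrow> schwartz_family (\<lambda>i x. F i x * G i x)"
  by (rule smooth_family_mult[where P = slow and Q = rapid]) (auto intro: rapid_add rapid_slow_mult)

lemma slow_bounded: "(\<And>i x. norm (F i x) \<le> C) \<Longrightarrow> slow F"
  unfolding slow_def by (metis mult.right_neutral power_0)

lemma slow_family_const: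
  fixes c :: "'i \<Rightarrow> 'b::real_normed_vector"
  assumes "\<And>i. norm (c i) \<le> C"
  shows "slow_family (\<lambda>i (x::'a::euclidean_space). c i)"
proof (rule smooth_family_coinduct[where Q = "\<lambda>F. \<exists>c C. (\<forall>i. norm (c i) \<le> C) \<and> F = (\<lambda>i x. c i)"])
  show "\<exists>c' C. (\<forall>i. norm (c' i) \<le> C) \<and> (\<lambda>i x. c i) = (\<lambda>i x. c' i)" using assms by metis
next
  fix F :: "'i \<Rightarrow> 'a \<Rightarrow> 'b" and b :: 'a
  assume "\<exists>c C. (\<forall>i. norm (c i) \<le> C) \<and> F = (\<lambda>i x. c i)"
  then show "\<exists>c C. (\<forall>i. norm (c i) \<le> C) \<and> (\<lambda>i. dir_deriv b (F i)) = (\<lambda>i x. c i)"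
    by (intro exI[of _ "\<lambda>i. 0"] exI[of _ 0]) (auto simp: dir_deriv_def[abs_def])
qed (auto intro: slow_bounded)

lemma rapid_imp_slow:
  assumes "rapid F" shows "slow F"
proof -
  obtain C where "\<forall>i x. (1 + norm x) ^ 0 * norm (F i x) \<le> C" using assms unfolding rapid_def by blast
  then show ?thesis by (intro slow_bounded) auto
qed

lemma schwartz_family_imp_slow_family: "schwartz_family F \<Longrightarrow> slow_family F"
  using rapid_imp_slow smooth_family_mono by blast

lemma slow_family_linear:
  assumes "bounded_linear l"
  shows "slow_family (\<lambda>_. l)"
proof (rule smooth_family_coinduct[where Q = "\<lambda>F. F = (\<lambda>_. l) \<or> (\<exists>c. F = (\<lambda>_ _. c))"])
  fix F :: "'c \<Rightarrow> 'a \<Rightarrow> 'b"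
  assume F: "F = (\<lambda>_. l) \<or> (\<exists>c. F = (\<lambda>_ _. c))"
  show "F i differentiable (at x)" for i x
    using F bounded_linear_imp_differentiable[OF assms] by auto
  obtain C where C: "norm (l x) \<le> C * norm x" for x
    using bounded_linear.bounded[OF assms] by (metis mult.commute)
  have "norm (l x) \<le> \<bar>C\<bar> * (1 + norm x) ^ 1" for x
    using C[of x] abs_ge_self[of C] mult_right_mono[of C "\<bar>C\<bar>" "norm x"] by (simp add: distrib_left)
  then have "slow (\<lambda>_::'c. l)" unfolding slow_def by blast
  then show "slow F" using F by (auto intro: slow_bounded)
  show "(\<lambda>i. dir_deriv b (F i)) = (\<lambda>_. l) \<or> (\<exists>c. (\<lambda>i. dir_deriv b (F i)) = (\<lambda>_ _. c))" for b
    using F dir_deriv_eqI[OF bounded_linear_imp_has_derivative[OF assms], of b]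
    by (auto simp: dir_deriv_def[abs_def])
qed auto

lemma schwartz_family_cmult:
  fixes F :: "'i \<Rightarrow> 'a::euclidean_space \<Rightarrow> 'b::real_normed_algebra"
  shows "schwartz_family F \<Longrightarrow> (\<And>i. norm (c i) \<le> C) \<Longrightarrow> schwartz_family (\<lambda>i x. c i * F i x)"
  by (rule schwartz_family_slow_mult[OF slow_family_const])

text \<open>Injectivity gives \<open>B * norm x \<le> norm (L x)\<close>, so decay in
  \<open>L x\<close> is decay in \<open>x\<close>; along a kernel there would be none.\<close>

lemma schwartz_family_compose_linear:
  fixes F :: "'i \<Rightarrow> 'b::euclidean_space \<Rightarrow> 'c::real_normed_vector" and L :: "'a::euclidean_space \<Rightarrow> 'b"
  assumes "schwartz_family F" "linear L" "inj L"
  shows "schwartz_family (\<lambda>i x. F i (L x))"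
  using assms(1) linear_conv_bounded_linear[THEN iffD1, OF assms(2)]
proof (rule smooth_family_compose_linear)
  fix F :: "'i \<Rightarrow> 'b \<Rightarrow> 'c" assume F: "rapid F"
  obtain B where B: "B > 0" "\<And>x. B * norm x \<le> norm (L x)"
    using linear_inj_bounded_below_pos[OF assms(2,3)] by metis
  \<comment> \<open>The value 1 takes care of the summand 1 in the weight, \<open>1 / B\<close> of
    \<open>norm x\<close>.\<close>
  define A where "A = max 1 (1 / B)"
  have A: "A > 0" "1 + norm x \<le> A * (1 + norm (L x))" for x
  proof -
    show "A > 0" by (auto simp: A_def)
    have "norm x \<le> (1 / B) * norm (L x)" using B by (simp add: field_simps)
    also have "\<dots> \<le> A * norm (L x)" by (intro mult_right_mono) (auto simp: A_def)
    finally show "1 + norm x \<le> A * (1 + norm (L x))" by (auto simp: A_def distrib_left)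
  qed
  show "rapid (\<lambda>i x. F i (L x))"
    unfolding rapid_def
  proof
    fix k
    obtain C where C: "\<And>i x. (1 + norm x) ^ k * norm (F i x) \<le> C"
      using F unfolding rapid_def by meson
    have "(1 + norm x) ^ k * norm (F i (L x)) \<le> A ^ k * C" for i x
    proof -
      have "(1 + norm x) ^ k * norm (F i (L x)) \<le> (A * (1 + norm (L x))) ^ k * norm (F i (L x))"
        by (intro mult_right_mono power_mono A) auto
      also have "\<dots> = A ^ k * ((1 + norm (L x)) ^ k * norm (F i (L x)))"
        by (simp add: power_mult_distrib)
      also have "\<dots> \<le> A ^ k * C" using A(1) by (intro mult_left_mono C) auto
      finally show ?thesis .
    qed
    then show "\<exists>C. \<forall>i x. (1 + norm x) ^ k * norm (F i (L x)) \<le> C" by blast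
  qed
qed (auto intro: rapid_add rapid_scaleR)

section \<open>Taylor remainders and slices\<close>

lemma norm_dir_deriv_le:
  fixes f :: "'a::euclidean_space \<Rightarrow> 'b::real_normed_vector" and M :: real
  assumes "f differentiable (at x)" "\<And>b. b \<in> Basis \<Longrightarrow> norm (dir_deriv b f x) \<le> M"
  shows "norm (dir_deriv h f x) \<le> DIM('a) * M * norm h"
proof -
  have "norm (dir_deriv h f x) \<le> (\<Sum>b\<in>Basis. \<bar>h \<bullet> b\<bar> * norm (dir_deriv b f x))"
    unfolding dir_deriv_expand[OF assms(1), of h] using norm_sum by (rule order_trans) simp
  also have "\<dots> \<le> (\<Sum>b\<in>(Basis :: 'a set). norm h * M)"
    by (intro sum_mono mult_mono Basis_le_norm assms) auto
  finally show ?thesis by (simp add: mult_ac)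
qed

text \<open>The mean value inequality is used twice: first for the partial derivatives along the
  segment, then for \<open>f\<close> minus its linear part. Second derivatives are bounded on the
  segment only, so that \<open>M\<close> may decay with \<open>x\<close>. The factor is crude; only
  the order \<open>(norm h)^2\<close> matters.\<close>

lemma norm_taylor2_le:
  fixes f :: "'a::euclidean_space \<Rightarrow> 'b::real_normed_vector" and M :: real
  assumes f: "\<And>x. f differentiable (at x)"
    and df: "\<And>b x. b \<in> Basis \<Longrightarrow> dir_deriv b f differentiable (at x)"
    and M: "\<And>b c t. b \<in> Basis \<Longrightarrow> c \<in> Basis \<Longrightarrow> t \<in> {0..1} \<Longrightarrow>
      norm (dir_deriv c (dir_deriv b f) (x + t *\<^sub>R h)) \<le> M"
  shows "norm (f (x + h) - f x - dir_deriv h f x) \<le> DIM('a)^2 * M * (norm h)^2"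
proof -
  define S where "S = (\<lambda>t. x + t *\<^sub>R h) ` {0..1}"
  have S: "convex S"
    unfolding S_def image_image[of "\<lambda>y. x + y" "\<lambda>t. t *\<^sub>R h", symmetric]
    by (intro convex_translation convex_scaled convex_real_interval)
  have xS: "x \<in> S" by (auto simp: S_def intro: image_eqI[of _ _ 0])
  have M0: "M \<ge> 0"
    using order_trans[OF norm_ge_zero M[of "SOME b. b \<in> Basis" "SOME b. b \<in> Basis" 0]]
    by (auto simp: SOME_Basis)
  have 1: "norm (dir_deriv b f y - dir_deriv b f x) \<le> DIM('a) * M * norm h" if "b \<in> Basis" "y \<in> S" for b y
  proof -
    have "norm (dir_deriv b f y - dir_deriv b f x) \<le> DIM('a) * M * norm (y - x)"
    proof (rule differentiable_bound[OF S _ _ that(2) xS])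
      fix z assume "z \<in> S"
      show "(dir_deriv b f has_derivative (\<lambda>v. dir_deriv v (dir_deriv b f) z)) (at z within S)"
        using has_derivative_dir_deriv[OF df[OF that(1)]] has_derivative_at_withinI by blast
      show "onorm (\<lambda>v. dir_deriv v (dir_deriv b f) z) \<le> DIM('a) * M"
      proof (rule onorm_bound)
        fix v
        obtain t where "t \<in> {0..1}" "z = x + t *\<^sub>R h" using \<open>z \<in> S\<close> by (auto simp: S_def)
        then show "norm (dir_deriv v (dir_deriv b f) z) \<le> DIM('a) * M * norm v"
          using M[OF that(1)] by - (rule norm_dir_deriv_le[OF df[OF that(1)]], auto)
      qed (use M0 in auto)
    qed
    also have "\<dots> \<le> DIM('a) * M * norm h"
      using \<open>y \<in> S\<close> M0 by (intro mult_left_mono) (auto simp: S_def intro!: mult_left_le_one_le)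
    finally show ?thesis .
  qed
  have "norm (f (x + h) - f x - dir_deriv (x + h - x) f x) \<le> norm (x + h - x) * (DIM('a) * (DIM('a) * M * norm h))"
  proof (rule differentiable_bound_linearization[where S = S and f' = "\<lambda>y v. dir_deriv v f y" and ?x0.0 = x])
    fix y assume y: "y \<in> S"
    show "(f has_derivative (\<lambda>v. dir_deriv v f y)) (at y within S)"
      using has_derivative_dir_deriv[OF f] has_derivative_at_withinI by blast
    show "onorm ((\<lambda>v. dir_deriv v f y) - (\<lambda>v. dir_deriv v f x)) \<le> DIM('a) * (DIM('a) * M * norm h)"
    proof (rule onorm_bound)
      fix v
      have "norm (((\<lambda>v. dir_deriv v f y) - (\<lambda>v. dir_deriv v f x)) v) =
          norm (\<Sum>b\<in>Basis. (v \<bullet> b) *\<^sub>R (dir_deriv b f y - dir_deriv b f x))"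
        by (simp add: dir_deriv_expand[OF f, of v] scaleR_diff_right sum_subtractf)
      also have "\<dots> \<le> (\<Sum>b\<in>(Basis :: 'a set). norm v * (DIM('a) * M * norm h))"
        by (rule order_trans[OF norm_sum])
          (auto intro!: sum_mono mult_mono[OF Basis_le_norm 1[OF _ y]] simp del: sum_constant)
      finally show "norm (((\<lambda>v. dir_deriv v f y) - (\<lambda>v. dir_deriv v f x)) v)
          \<le> DIM('a) * (DIM('a) * M * norm h) * norm v" by (simp add: mult_ac)
    qed (use M0 in auto)
  qed (auto simp: S_def intro: xS[unfolded S_def])
  then show ?thesis by (simp add: power2_eq_square mult_ac)
qed

text \<open>The basic estimate behind every differentiation under an integral or under a functional:
  the remainder is quadratic in \<open>h\<close>, with rapid decay in \<open>x\<close> and uniformly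
  in the index.\<close>

lemma schwartz_family_taylor:
  fixes F :: "'i \<Rightarrow> 'a::euclidean_space \<Rightarrow> 'b::real_normed_vector"
  assumes "schwartz_family F"
  shows "\<exists>C. \<forall>i x h. norm h \<le> 1 \<longrightarrow>
    (1 + norm x) ^ k * norm (F i (x + h) - F i x - dir_deriv h (F i) x) \<le> C * (norm h)^2"
proof -
  have "\<exists>C. \<forall>i x. (1 + norm x) ^ k * norm (dir_deriv c (dir_deriv b (F i)) x) \<le> C"
    if "b \<in> Basis" "c \<in> Basis" for b c
    using smooth_familyD(2)[OF smooth_familyD(3)[OF smooth_familyD(3)[OF assms that(1)] that(2)]]
    unfolding rapid_def by (rule spec)
  then obtain B where B: "\<And>b c i x. b \<in> Basis \<Longrightarrow> c \<in> Basis \<Longrightarrow>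
      (1 + norm x) ^ k * norm (dir_deriv c (dir_deriv b (F i)) x) \<le> B b c" by metis
  define M where "M = Max ((\<lambda>(b, c). B b c) ` (Basis \<times> Basis))"
  have M: "(1 + norm x) ^ k * norm (dir_deriv c (dir_deriv b (F i)) x) \<le> M"
    if "b \<in> Basis" "c \<in> Basis" for b c i x
  proof -
    have "B b c \<le> M" unfolding M_def by (rule Max_ge) (use that in force)+
    then show ?thesis using B[OF that] by (rule order_trans[rotated])
  qed
  have "(1 + norm x) ^ k * norm (F i (x + h) - F i x - dir_deriv h (F i) x)
      \<le> (2 ^ k * DIM('a)^2 * M) * (norm h)^2" if h: "norm h \<le> 1" for i x h
  proof -
    have "norm (F i (x + h) - F i x - dir_deriv h (F i) x)
        \<le> DIM('a)^2 * (2 ^ k * M / (1 + norm x) ^ k) * (norm h)^2"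
    proof (rule norm_taylor2_le)
      fix b c :: 'a and t :: real assume bc: "b \<in> Basis" "c \<in> Basis" and t: "t \<in> {0..1}"
      \<comment> \<open>Since \<open>norm h \<le> 1\<close>, the weight \<open>1 + norm x\<close> is
        at most twice the weight at any \<open>y\<close> on the segment; this is the origin of
        \<open>2 ^ k\<close>.\<close>
      define y where "y = x + t *\<^sub>R h"
      have "norm (t *\<^sub>R h) \<le> 1" using t h by (auto intro: mult_le_one)
      then have "norm x \<le> norm y + 1"
        using norm_triangle_ineq4[of y "t *\<^sub>R h"] by (simp add: y_def)
      then have "1 + norm x \<le> 2 * (1 + norm y)"
        using norm_ge_zero[of y] by argo
      then have "(1 + norm x) ^ k \<le> (2 * (1 + norm y)) ^ k"
        by (rule power_mono) auto
      then have "(1 + norm x) ^ k * norm (dir_deriv c (dir_deriv b (F i)) y)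
          \<le> (2 * (1 + norm y)) ^ k * norm (dir_deriv c (dir_deriv b (F i)) y)"
        by (rule mult_right_mono) auto
      also have "\<dots> \<le> 2 ^ k * M"
        unfolding power_mult_distrib mult.assoc by (intro mult_left_mono M bc) auto
      finally show "norm (dir_deriv c (dir_deriv b (F i)) (x + t *\<^sub>R h)) \<le> 2 ^ k * M / (1 + norm x) ^ k"
        unfolding y_def[symmetric]
        by (simp add: pos_le_divide_eq add_pos_nonneg mult.commute)
    qed (simp_all add: smooth_familyD(1)[OF assms] smooth_familyD(1)[OF smooth_familyD(3)[OF assms]])
    then have "(1 + norm x) ^ k * norm (F i (x + h) - F i x - dir_deriv h (F i) x)
        \<le> (1 + norm x) ^ k * (DIM('a)^2 * (2 ^ k * M / (1 + norm x) ^ k) * (norm h)^2)"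
      by (rule mult_left_mono) auto
    also have "\<dots> = (2 ^ k * DIM('a)^2 * M) * (norm h)^2"
    proof -
      have "1 + norm x \<noteq> 0" by (smt (verit) norm_ge_zero)
      then show ?thesis by simp
    qed
    finally show ?thesis .
  qed
  then show ?thesis by blast
qed

text \<open>The form in which derivatives of Fourier transforms and of functionals with a parameter
  are obtained below.\<close>

lemma has_derivative_quadraticI:
  fixes f :: "'a::euclidean_space \<Rightarrow> 'b::real_normed_vector"
  assumes "linear D" "\<And>h. norm h \<le> 1 \<Longrightarrow> norm (f (x + h) - f x - D h) \<le> C * (norm h)^2"
  shows "(f has_derivative D) (at x)"
  unfolding has_derivative_at
proof
  show "bounded_linear D" using assms(1) linear_conv_bounded_linear by blast
  have C: "((\<lambda>h. \<bar>C\<bar> * norm h) \<longlongrightarrow> 0) (at (0::'a))"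
    by (auto intro!: tendsto_eq_intros)
  show "((\<lambda>h. norm (f (x + h) - f x - D h) / norm h) \<longlongrightarrow> 0) (at 0)"
  proof (rule tendsto_sandwich[OF _ _ tendsto_const C])
    show "\<forall>\<^sub>F h in at 0. norm (f (x + h) - f x - D h) / norm h \<le> \<bar>C\<bar> * norm h"
      unfolding eventually_at
    proof (intro exI[of _ 1] conjI ballI impI)
      fix h :: 'a assume "h \<noteq> 0 \<and> dist h 0 < 1"
      then have h: "h \<noteq> 0" "norm h \<le> 1" by auto
      have "norm (f (x + h) - f x - D h) \<le> \<bar>C\<bar> * (norm h)^2"
        using assms(2)[OF h(2)] by (rule order_trans) (auto intro: mult_right_mono)
      then show "norm (f (x + h) - f x - D h) / norm h \<le> \<bar>C\<bar> * norm h"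
        using h by (simp add: divide_le_eq power2_eq_square mult.assoc)
    qed auto
  qed auto
qed

text \<open>The first variable joins the index. Joint decay pays for the weight in \<open>x\<close>,
  and the resulting uniform bound on the slices becomes rapid decay in \<open>x\<close> once a
  functional is applied to them.\<close>

lemma schwartz_family_weighted_slice:
  fixes F :: "'i \<Rightarrow> 'a::euclidean_space \<times> 'b::euclidean_space \<Rightarrow> 'c::real_normed_vector"
  assumes "schwartz_family F"
  shows "schwartz_family (\<lambda>(i, x) t. (1 + norm x) ^ m *\<^sub>R F i (x, t))"
proof (rule smooth_family_coinduct[where
      Q = "\<lambda>G. \<exists>F. schwartz_family F \<and> G = (\<lambda>(i, x) t. (1 + norm x) ^ m *\<^sub>R F i (x, t))"])
  fix G :: "'i \<times> 'a \<Rightarrow> 'b \<Rightarrow> 'c"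
  assume "\<exists>F. schwartz_family F \<and> G = (\<lambda>(i, x) t. (1 + norm x) ^ m *\<^sub>R F i (x, t))"
  then obtain F where F: "schwartz_family F" and G: "G = (\<lambda>(i, x) t. (1 + norm x) ^ m *\<^sub>R F i (x, t))"
    by blast
  have d: "(G (i, x) has_derivative (\<lambda>h. (1 + norm x) ^ m *\<^sub>R dir_deriv (0, h) (F i) (x, t))) (at t)" for i x t
  proof -
    have "((\<lambda>t. F i (x, t)) has_derivative (\<lambda>h. dir_deriv (0, h) (F i) (x, t))) (at t)"
      using has_derivative_compose[where f = "\<lambda>t. (x, t)" and g = "F i",
          OF has_derivative_Pair[OF has_derivative_const has_derivative_ident]
            has_derivative_dir_deriv[OF smooth_familyD(1)[OF F]]] .
    from has_derivative_scaleR_right[OF this] show ?thesis by (simp add: G)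
  qed
  show "G i differentiable (at t)" for i t
    using d differentiable_def by (metis surj_pair)
  show "rapid G" unfolding rapid_def
  proof
    fix k
    obtain C where C: "\<And>i x. (1 + norm x) ^ (k + m) * norm (F i x) \<le> C"
      using smooth_familyD(2)[OF F] unfolding rapid_def by meson
    have "(1 + norm t) ^ k * norm (G (i, x) t) \<le> C" for i x t
    proof -
      have "(1 + norm t) ^ k * norm (G (i, x) t) = ((1 + norm t) ^ k * (1 + norm x) ^ m) * norm (F i (x, t))"
        by (simp add: G)
      also have "\<dots> \<le> ((1 + norm (x, t)) ^ k * (1 + norm (x, t)) ^ m) * norm (F i (x, t))"
        by (intro mult_right_mono mult_mono power_mono add_left_mono norm_fst_le norm_snd_le) auto
      finally show ?thesis using C[of "(x, t)" i] by (simp add: power_add)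
    qed
    then show "\<exists>C. \<forall>i t. (1 + norm t) ^ k * norm (G i t) \<le> C" by (metis surj_pair)
  qed
  fix b :: 'b assume "b \<in> Basis"
  then have "(0, b) \<in> (Basis :: ('a \<times> 'b) set)" by (simp add: Basis_prod_def)
  then have "schwartz_family (\<lambda>i. dir_deriv (0, b) (F i))" by (rule smooth_familyD(3)[OF F])
  moreover have "(\<lambda>i. dir_deriv b (G i)) = (\<lambda>(i, x) t. (1 + norm x) ^ m *\<^sub>R dir_deriv (0, b) (F i) (x, t))"
    using d by (auto intro!: ext dir_deriv_eqI)
  ultimately show "\<exists>F. schwartz_family F \<and>
      (\<lambda>i. dir_deriv b (G i)) = (\<lambda>(i, x) t. (1 + norm x) ^ m *\<^sub>R F i (x, t))" by blast
qed (use assms in blast)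

lemma schwartz_family_slice:
  fixes F :: "'i \<Rightarrow> 'a::euclidean_space \<times> 'b::euclidean_space \<Rightarrow> 'c::real_normed_vector"
  assumes "schwartz_family F"
  shows "schwartz_family (\<lambda>(i, x) t. F i (x, t))"
  using schwartz_family_weighted_slice[OF assms, of 0] by simp

lemma schwartz_slice: "schwartz F \<Longrightarrow> schwartz (\<lambda>t. F (x, t))"
  using schwartz_familyD[OF schwartz_family_slice[OF schwartz_family_single[where ?'i = unit, THEN iffD2]], of F "((), x)"]
  by simp

section \<open>Integrals of rapidly decreasing functions\<close>

definition decay_weight :: "'a::euclidean_space \<Rightarrow> real" where
  "decay_weight x = 1 / (1 + norm x) ^ (DIM('a) + 2)"

lemma decay_weight_measurable [measurable]: "decay_weight \<in> borel_measurable borel"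
  unfolding decay_weight_def[abs_def] by measurable

text \<open>The function is dominated by a sum of multiples of indicators of balls, of which the
  term with \<open>n = \<lfloor>norm x\<rfloor>\<close> alone suffices at \<open>x\<close>. A ball
  of radius \<open>n + 1\<close> lies in a cube of volume \<open>(2 (n + 1)) ^ d\<close>, so with
  the exponent \<open>d + 2\<close> the integrals of the terms are at most
  \<open>2 ^ d / (n + 1) ^ 2\<close>.\<close>

lemma integrable_decay_weight: "integrable lborel (decay_weight :: 'a::euclidean_space \<Rightarrow> real)"
proof (rule integrableI_bounded)
  define N where "N = DIM('a)"
  let ?g = "\<lambda>n (x::'a). ennreal (1 / (1 + real n) ^ (N + 2)) * indicator (cball 0 (1 + real n)) x"
  have le: "ennreal (norm (decay_weight x)) \<le> (\<Sum>n. ?g n x)" for x :: 'a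
  proof -
    define n where "n = nat \<lfloor>norm x\<rfloor>"
    have n: "real n \<le> norm x" "norm x \<le> 1 + real n"
      unfolding n_def by (auto simp: of_nat_nat) linarith
    have "(1 + real n) ^ (N + 2) \<le> (1 + norm x) ^ (N + 2)"
      using n by (intro power_mono) auto
    then have "1 / (1 + norm x) ^ (N + 2) \<le> 1 / (1 + real n) ^ (N + 2)"
      by (intro divide_left_mono mult_pos_pos zero_less_power add_pos_nonneg) auto
    then have "ennreal (norm (decay_weight x)) \<le> ennreal (1 / (1 + real n) ^ (N + 2))"
      unfolding decay_weight_def N_def by (intro ennreal_leI) simp
    also have "\<dots> = ?g n x" using n by simp
    also have "\<dots> = (\<Sum>k\<in>{n}. ?g k x)"
      by (simp only: sum.insert finite.emptyI sum.empty empty_iff not_False_eq_True add_0_right)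
    also have "\<dots> \<le> (\<Sum>n. ?g n x)" by (intro sum_le_suminf) auto
    finally show ?thesis .
  qed
  have ball: "emeasure lborel (cball (0::'a) (1 + real n)) \<le> ennreal ((2 * (1 + real n)) ^ N)" for n
  proof -
    have "cball (0::'a) (1 + real n) \<subseteq> cbox (- (1 + real n) *\<^sub>R One) ((1 + real n) *\<^sub>R One)"
      unfolding cbox_def
    proof (intro subsetI CollectI ballI)
      fix x b :: 'a assume "x \<in> cball 0 (1 + real n)" "b \<in> Basis"
      then have "\<bar>x \<bullet> b\<bar> \<le> 1 + real n" using Basis_le_norm[of b x] by simp
      then show "(- (1 + real n) *\<^sub>R One) \<bullet> b \<le> x \<bullet> b \<and> x \<bullet> b \<le> ((1 + real n) *\<^sub>R One) \<bullet> b"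
        using \<open>b \<in> Basis\<close> by (simp add: inner_sum_left_Basis abs_le_iff del: scaleR_sum_right)
    qed
    then have "emeasure lborel (cball (0::'a) (1 + real n))
        \<le> emeasure lborel (cbox (- (1 + real n) *\<^sub>R One) ((1 + real n) *\<^sub>R (One :: 'a)))"
      by (intro emeasure_mono) auto
    also have "\<dots> = ennreal ((2 * (1 + real n)) ^ N)"
      by (subst emeasure_lborel_cbox_eq) (auto simp: inner_diff_left algebra_simps N_def)
    finally show ?thesis .
  qed
  have sm: "summable (\<lambda>n. 2 ^ N * (1 / (1 + real n) ^ 2))"
    using summable_Suc_iff[of "\<lambda>n. 1 / real n ^ 2"] inverse_power_summable[of 2, where 'a = real]
    by (intro summable_mult) (simp add: divide_inverse add.commute)
  have "(\<integral>\<^sup>+x. norm (decay_weight (x::'a)) \<partial>lborel) \<le> (\<integral>\<^sup>+x. (\<Sum>n. ?g n x) \<partial>lborel)"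
    using le by (rule nn_integral_mono)
  also have "\<dots> = (\<Sum>n. \<integral>\<^sup>+x. ?g n x \<partial>lborel)"
    by (rule nn_integral_suminf) (auto intro!: borel_measurable_times_ennreal borel_measurable_indicator)
  also have "\<dots> = (\<Sum>n. ennreal (1 / (1 + real n) ^ (N + 2)) * emeasure lborel (cball (0::'a) (1 + real n)))"
    by (subst nn_integral_cmult_indicator) auto
  also have "\<dots> \<le> (\<Sum>n. ennreal (2 ^ N * (1 / (1 + real n) ^ 2)))"
  proof (intro suminf_le allI)
    fix n
    have "ennreal (1 / (1 + real n) ^ (N + 2)) * emeasure lborel (cball (0::'a) (1 + real n))
        \<le> ennreal (1 / (1 + real n) ^ (N + 2)) * ennreal ((2 * (1 + real n)) ^ N)"
      by (intro mult_left_mono ball) auto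
    also have "\<dots> = ennreal (1 / (1 + real n) ^ (N + 2) * (2 * (1 + real n)) ^ N)"
      by (simp flip: ennreal_mult)
    also have "1 / (1 + real n) ^ (N + 2) * (2 * (1 + real n)) ^ N = 2 ^ N * (1 / (1 + real n) ^ 2)"
      unfolding power_mult_distrib power_add by simp
    finally show "ennreal (1 / (1 + real n) ^ (N + 2)) * emeasure lborel (cball (0::'a) (1 + real n))
        \<le> ennreal (2 ^ N * (1 / (1 + real n) ^ 2))" .
  qed auto
  also have "\<dots> = ennreal (\<Sum>n. 2 ^ N * (1 / (1 + real n) ^ 2))"
    by (rule suminf_ennreal2[OF _ sm]) simp
  also have "\<dots> < \<infinity>"
    unfolding infinity_ennreal_def by (rule ennreal_less_top)
  finally show "(\<integral>\<^sup>+x. norm (decay_weight (x::'a)) \<partial>lborel) < \<infinity>" .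
qed simp

lemma decay_weight_bound:
  fixes f :: "'a::euclidean_space \<Rightarrow> 'b::real_normed_vector"
  assumes "(1 + norm x) ^ (DIM('a) + 2) * norm (f x) \<le> C"
  shows "norm (f x) \<le> C * decay_weight x"
  using assms by (simp add: decay_weight_def pos_le_divide_eq add_pos_nonneg mult.commute)

lemma decay_integral:
  fixes f :: "'a::euclidean_space \<Rightarrow> 'b::{banach, second_countable_topology}"
  assumes "f \<in> borel_measurable borel" "\<And>x. norm (f x) \<le> C * decay_weight x"
  shows "integrable lborel f" "norm (\<integral>x. f x \<partial>lborel) \<le> C * (\<integral>x. decay_weight (x::'a) \<partial>lborel)"
proof -
  have i: "integrable lborel (\<lambda>x::'a. C * decay_weight x)"
    by (intro integrable_mult_right integrable_decay_weight)
  show f: "integrable lborel f"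
    by (rule Bochner_Integration.integrable_bound[OF i])
      (use assms order_trans[OF assms(2) abs_ge_self] in auto)
  have "norm (\<integral>x. f x \<partial>lborel) \<le> (\<integral>x. C * decay_weight (x::'a) \<partial>lborel)"
    by (rule Bochner_Integration.integral_norm_bound_integral[OF f i]) (rule assms(2))
  then show "norm (\<integral>x. f x \<partial>lborel) \<le> C * (\<integral>x. decay_weight (x::'a) \<partial>lborel)" by simp
qed

lemma schwartz_continuous: "schwartz_family F \<Longrightarrow> continuous_on S (F i)"
  by (meson continuous_at_imp_continuous_on differentiable_imp_continuous_within smooth_familyD(1))

lemma schwartz_measurable: "schwartz_family F \<Longrightarrow> F i \<in> borel_measurable borel"
  by (rule borel_measurable_continuous_onI[OF schwartz_continuous])

lemma schwartz_family_decay: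
  fixes F :: "'i \<Rightarrow> 'a::euclidean_space \<Rightarrow> 'b::real_normed_vector"
  assumes "schwartz_family F"
  shows "\<exists>C. \<forall>i x. norm (F i x) \<le> C * decay_weight x"
  using smooth_familyD(2)[OF assms] decay_weight_bound unfolding rapid_def by meson

lemma schwartz_family_integrable:
  fixes F :: "'i \<Rightarrow> 'a::euclidean_space \<Rightarrow> 'b::{banach, second_countable_topology}"
  assumes "schwartz_family F"
  shows "integrable lborel (F i)"
  using schwartz_family_decay[OF assms] decay_integral(1)[OF schwartz_measurable[OF assms]] by metis

section \<open>Translations and dilations of integrals; integrals of derivatives\<close>

lemma integral_lborel_translate:
  fixes f :: "'a::euclidean_space \<Rightarrow> 'b::{banach, second_countable_topology}"
  assumes "f \<in> borel_measurable borel"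
  shows "(\<integral>x. f (x + c) \<partial>lborel) = (\<integral>x. f x \<partial>lborel)"
proof -
  have "(\<integral>x. f x \<partial>lborel) = (\<integral>x. f x \<partial>(distr lborel borel ((+) c)))"
    by (simp add: lborel_distr_plus)
  also have "\<dots> = (\<integral>x. f (c + x) \<partial>lborel)"
    by (rule integral_distr) (use assms in measurable)
  finally show ?thesis by (simp add: add.commute)
qed

lemma integrable_lborel_translate:
  fixes f :: "'a::euclidean_space \<Rightarrow> 'b::{banach, second_countable_topology}"
  assumes "integrable lborel f"
  shows "integrable lborel (\<lambda>x. f (x + c))"
proof -
  have "f \<in> borel_measurable borel" using borel_measurable_integrable[OF assms] by simp
  moreover have "integrable (distr lborel borel ((+) c)) f"
    using assms by (simp add: lborel_distr_plus)
  ultimately have "integrable lborel (\<lambda>x. f (c + x))"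
    by (subst (asm) integrable_distr_eq) auto
  then show ?thesis by (simp add: add.commute)
qed

lemma integral_lborel_scale:
  fixes f :: "'a::euclidean_space \<Rightarrow> 'b::{banach, second_countable_topology}"
  assumes "f \<in> borel_measurable borel" "c \<noteq> 0"
  shows "(\<integral>x. f x \<partial>lborel) = \<bar>c\<bar> ^ DIM('a) *\<^sub>R (\<integral>x. f (c *\<^sub>R x) \<partial>lborel)"
proof -
  have "(\<integral>x. f x \<partial>lborel) = (\<integral>x. f x \<partial>(density (distr lborel borel (\<lambda>x. 0 + c *\<^sub>R x)) (\<lambda>_. \<bar>c\<bar> ^ DIM('a))))"
    using lborel_affine[OF assms(2), of "0::'a"] by simp
  also have "\<dots> = (\<integral>x. (\<bar>c\<bar> ^ DIM('a)) *\<^sub>R f (c *\<^sub>R x) \<partial>lborel)"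
    using assms(1)
    by (subst integral_density, simp_all, subst integral_distr) (auto simp: ennreal_power)
  finally show ?thesis by simp
qed

text \<open>By translation invariance the increment \<open>f (x + s b) - f x\<close> integrates to
  0, so Taylor's formula makes \<open>s\<close> times the integral of the derivative a quantity of
  order \<open>s ^ 2\<close>; divide by \<open>s\<close> and let it tend to 0. No iterated
  integration is involved.\<close>

lemma integral_dir_deriv_zero:
  fixes f :: "'a::euclidean_space \<Rightarrow> complex"
  assumes "schwartz f" and b: "b \<in> Basis"
  shows "(\<integral>x. dir_deriv b f x \<partial>lborel) = 0"
proof -
  define F where "F = (\<lambda>_::unit. f)"
  have F: "schwartz_family F" using assms(1) schwartz_family_single F_def by blast
  have dF: "schwartz_family (\<lambda>i. dir_deriv b (F i))" by (rule smooth_familyD(3)[OF F b])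
  obtain C where C: "\<And>x h. norm h \<le> 1 \<Longrightarrow>
      (1 + norm x) ^ (DIM('a) + 2) * norm (f (x + h) - f x - dir_deriv h f x) \<le> C * (norm h)^2"
    using schwartz_family_taylor[OF F] unfolding F_def by meson
  define I where "I = (\<integral>x. dir_deriv b f x \<partial>lborel)"
  define K where "K = C * (\<integral>x. decay_weight (x::'a) \<partial>lborel)"
  have f: "integrable lborel f" "f \<in> borel_measurable borel"
    using schwartz_family_integrable[OF F] schwartz_measurable[OF F] by (auto simp: F_def)
  have df: "integrable lborel (dir_deriv b f)" "dir_deriv b f \<in> borel_measurable borel"
    using schwartz_family_integrable[OF dF] schwartz_measurable[OF dF] by (auto simp: F_def)
  have "norm I \<le> K * s" if s: "0 < s" "s \<le> 1" for s :: real
  proof -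
    have lin: "dir_deriv (s *\<^sub>R b) f x = s *\<^sub>R dir_deriv b f x" for x
      using linear_dir_deriv[OF smooth_familyD(1)[OF F]] linear_scale unfolding F_def by blast
    have "norm (\<integral>x. (f (x + s *\<^sub>R b) - f x) - s *\<^sub>R dir_deriv b f x \<partial>lborel) \<le> (C * s^2) * (\<integral>x. decay_weight (x::'a) \<partial>lborel)"
    proof (rule decay_integral(2))
      show "(\<lambda>x. f (x + s *\<^sub>R b) - f x - s *\<^sub>R dir_deriv b f x) \<in> borel_measurable borel"
        using f(2) df(2) by measurable
      fix x
      show "norm (f (x + s *\<^sub>R b) - f x - s *\<^sub>R dir_deriv b f x) \<le> (C * s^2) * decay_weight x"
        using C[of "s *\<^sub>R b" x] s b by (intro decay_weight_bound) (simp add: lin)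
    qed
    also have "(\<integral>x. (f (x + s *\<^sub>R b) - f x) - s *\<^sub>R dir_deriv b f x \<partial>lborel) = - (s *\<^sub>R I)"
      using f df by (simp add: integrable_lborel_translate integral_lborel_translate I_def)
    finally have "s * norm I \<le> s * (K * s)"
      using s by (simp add: K_def power2_eq_square mult_ac)
    then show ?thesis using s by simp
  qed
  then have "\<forall>\<^sub>F s in at_right 0. norm I \<le> K * s"
    by (auto simp: eventually_at_right_field intro!: exI[of _ 1])
  moreover have "((\<lambda>s. K * s) \<longlongrightarrow> 0) (at_right 0)" by (auto intro!: tendsto_eq_intros)
  ultimately have "norm I \<le> 0"
    by (intro tendsto_le[OF _ _ tendsto_const]) (auto simp: trivial_limit_at_right_real)
  then show ?thesis by (simp add: I_def)
qed

section \<open>The partial Fourier transform on Schwartz functions\<close>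

definition character :: "'a::euclidean_space \<Rightarrow> 'a \<Rightarrow> complex" where
  "character w t = cis (- (2 * pi * (w \<bullet> t)))"

lemma character_exp: "exp (- (2 * of_real pi * \<i> * of_real (w \<bullet> t))) = character w t"
  unfolding character_def cis_conv_exp by (rule arg_cong[where f = exp]) (simp add: mult_ac)

lemma fourier_fun_character: "fourier_fun f w = (\<integral>t. f t * character w t \<partial>lborel)"
  by (simp add: fourier_fun_def character_exp)

lemma fourier2_fun_character: "fourier2_fun F (x, w) = (\<integral>t. F (x, t) * character w t \<partial>lborel)"
  by (simp add: fourier2_fun_def fourier_fun_character)

lemma norm_character [simp]: "norm (character w t) = 1"
  by (simp add: character_def)

lemma character_add: "character (w + k) t = character w t * character k t"
  by (simp add: character_def cis_mult inner_add_left algebra_simps)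

lemma character_add_right: "character w (s + t) = character w s * character w t"
  by (simp add: character_def cis_mult inner_add_right algebra_simps)

lemma character_0 [simp]: "character 0 t = 1" "character w 0 = 1"
  by (simp_all add: character_def)

lemma character_commute: "character w t = character t w"
  by (simp add: character_def inner_commute)

lemma has_derivative_cis: "(cis has_derivative (\<lambda>h. of_real h * (\<i> * cis x))) (at x)"
proof -
  have "((\<lambda>x. exp (\<i> * of_real x)) has_derivative (\<lambda>h. of_real h * (\<i> * exp (\<i> * of_real x)))) (at x)"
    using has_derivative_compose[OF
        bounded_linear_imp_has_derivative[OF bounded_linear_const_mult[OF bounded_linear_of_real]]
        DERIV_exp[unfolded has_field_derivative_def], of \<i> x UNIV]
    by (simp add: mult_ac)
  then show ?thesis by (simp add: cis_conv_exp[abs_def])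
qed

lemma norm_cis_minus_1_le: "norm (cis r - 1) \<le> \<bar>r\<bar>"
  using dist_exp_i_1[of r] abs_sin_x_le_abs_x[of "r / 2"] by (simp add: cis_conv_exp)

text \<open>Supplies the second-order term in the phase when a transform is differentiated in the
  frequency.\<close>

lemma norm_cis_taylor_le: "norm (cis r - 1 - \<i> * of_real r) \<le> r^2"
proof -
  have "norm (cis r - cis 0 - (r - 0) *\<^sub>R (\<i> * cis 0)) \<le> norm (r - 0) * \<bar>r\<bar>"
  proof (rule vector_differentiable_bound_linearization[where S = "closed_segment 0 r" and f' = "\<lambda>t. \<i> * cis t"])
    fix x assume "x \<in> closed_segment 0 r"
    show "(cis has_vector_derivative \<i> * cis x) (at x within closed_segment 0 r)"
      using has_derivative_at_withinI[OF has_derivative_cis]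
      by (simp add: has_vector_derivative_def scaleR_conv_of_real)
    have "norm (\<i> * cis x - \<i> * cis 0) = norm (cis x - 1)"
      unfolding right_diff_distrib[symmetric] norm_mult by simp
    also have "\<dots> \<le> \<bar>r\<bar>"
      using norm_cis_minus_1_le[of x] \<open>x \<in> closed_segment 0 r\<close>
      by (auto simp: closed_segment_eq_real_ivl split: if_splits)
    finally show "norm (\<i> * cis x - \<i> * cis 0) \<le> \<bar>r\<bar>" .
  qed auto
  then show ?thesis by (simp add: scaleR_conv_of_real power2_eq_square mult.commute)
qed

lemma has_derivative_character:
  "(character w has_derivative (\<lambda>h. - (2 * pi * (w \<bullet> h)) * (\<i> * character w t))) (at t)"
proof -
  have "((\<lambda>t. - (2 * pi * (w \<bullet> t))) has_derivative (\<lambda>h. - (2 * pi * (w \<bullet> h)))) (at t)"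
    by (auto intro!: derivative_eq_intros)
  from has_derivative_compose[OF this has_derivative_cis] show ?thesis
    by (simp add: character_def[abs_def])
qed

lemma slow_family_character:
  fixes w :: "'a::euclidean_space"
  shows "slow_family (\<lambda>_::'i. character w)"
proof (rule smooth_family_coinduct[where Q = "\<lambda>F. \<exists>c. F = (\<lambda>_ t. c * character w t)"])
  fix F :: "'i \<Rightarrow> 'a \<Rightarrow> complex" assume "\<exists>c. F = (\<lambda>_ t. c * character w t)"
  then obtain c where F: "F = (\<lambda>_ t. c * character w t)" by blast
  have d: "(F i has_derivative (\<lambda>h. c * (- (2 * pi * (w \<bullet> h)) * (\<i> * character w t)))) (at t)" for i t
    unfolding F by (rule has_derivative_mult_right[OF has_derivative_character])
  show "F i differentiable (at t)" for i t
    using d differentiable_def by blast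
  show "slow F" by (rule slow_bounded[of _ "norm c"]) (simp add: F norm_mult)
  fix b :: 'a
  have "(\<lambda>i. dir_deriv b (F i)) = (\<lambda>_ t. (- c * (2 * pi * (w \<bullet> b)) * \<i>) * character w t)"
    by (intro ext) (simp add: dir_deriv_eqI[OF d])
  then show "\<exists>c. (\<lambda>i. dir_deriv b (F i)) = (\<lambda>_ t. c * character w t)" by blast
qed (intro exI[of _ 1], simp)

text \<open>Integration by parts: the derivative of \<open>character w t * f t\<close> has integral
  0.\<close>

lemma fourier_fun_dir_deriv:
  fixes f :: "'a::euclidean_space \<Rightarrow> complex"
  assumes "schwartz f" "b \<in> Basis"
  shows "fourier_fun (dir_deriv b f) w = 2 * pi * \<i> * (w \<bullet> b) * fourier_fun f w"
proof -
  have F: "schwartz_family (\<lambda>_::unit. f)" using assms(1) schwartz_family_single by blast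
  have dF: "schwartz_family (\<lambda>_::unit. dir_deriv b f)" by (rule smooth_familyD(3)[OF F assms(2)])
  note g = schwartz_family_slow_mult[OF slow_family_character F, of w]
  note dg = schwartz_family_slow_mult[OF slow_family_character dF, of w]
  have i: "integrable lborel (\<lambda>t. character w t * f t)" "integrable lborel (\<lambda>t. character w t * dir_deriv b f t)"
    using schwartz_family_integrable[OF g] schwartz_family_integrable[OF dg] by auto
  have "dir_deriv b (\<lambda>t. character w t * f t) t =
      character w t * dir_deriv b f t + (- (2 * pi * (w \<bullet> b)) * \<i>) * (character w t * f t)" for t
    by (subst dir_deriv_eqI[OF has_derivative_mult[OF has_derivative_character
          has_derivative_dir_deriv[OF smooth_familyD(1)[OF F]]]]) (simp add: mult_ac)
  then have "0 = (\<integral>t. character w t * dir_deriv b f t + (- (2 * pi * (w \<bullet> b)) * \<i>) * (character w t * f t) \<partial>lborel)"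
    using integral_dir_deriv_zero[OF schwartz_familyD[OF g] assms(2)] by simp
  also have "\<dots> = fourier_fun (dir_deriv b f) w + (- (2 * pi * (w \<bullet> b)) * \<i>) * fourier_fun f w"
    using i by (simp add: fourier_fun_character mult.commute)
  finally show ?thesis by (simp add: algebra_simps)
qed

text \<open>
  The Fourier transform in the second variable turns \<open>dual_deriv h F\<close> into the derivative in
  direction \<open>h\<close>, and \<open>dual_mult h F\<close> into multiplication by \<open>z \<mapsto> z \<bullet> h\<close>.
\<close>

definition dual_deriv ::
  "'a::euclidean_space \<times> 'a \<Rightarrow> ('a \<times> 'a \<Rightarrow> complex) \<Rightarrow> 'a \<times> 'a \<Rightarrow> complex" where
  "dual_deriv h F z = dir_deriv (fst h, 0) F z - 2 * of_real pi * \<i> * of_real (snd h \<bullet> snd z) * F z"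

definition dual_mult ::
  "'a::euclidean_space \<times> 'a \<Rightarrow> ('a \<times> 'a \<Rightarrow> complex) \<Rightarrow> 'a \<times> 'a \<Rightarrow> complex" where
  "dual_mult h F z = of_real (fst z \<bullet> fst h) * F z + dir_deriv (0, snd h) F z / (2 * of_real pi * \<i>)"

lemma Basis_prod_cases:
  assumes "b \<in> (Basis :: ('a::euclidean_space \<times> 'b::euclidean_space) set)"
  obtains c where "c \<in> Basis" "b = (c, 0)" | c where "c \<in> Basis" "b = (0, c)"
  using assms unfolding Basis_prod_def by blast

lemma dir_deriv_0:
  assumes "\<And>x. f differentiable (at x)"
  shows "dir_deriv 0 f = (\<lambda>x. 0)"
  using linear_0[OF linear_dir_deriv[OF assms]] by blast

lemma slow_family_inner_mult: "slow_family (\<lambda>_ z. c * complex_of_real (l z))" if "bounded_linear l"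
proof -
  have "bounded_linear (\<lambda>z. c * complex_of_real (l z))"
    by (intro bounded_linear_const_mult bounded_linear_compose[OF bounded_linear_of_real that])
  then show ?thesis by (rule slow_family_linear)
qed

text \<open>For a basis vector only one of the two terms survives: a derivative, or a product with a
  linear function. Both preserve Schwartz families.\<close>

lemma schwartz_family_dual_deriv:
  fixes F :: "'i \<Rightarrow> 'a::euclidean_space \<times> 'a \<Rightarrow> complex"
  assumes F: "schwartz_family F" and "b \<in> Basis"
  shows "schwartz_family (\<lambda>i. dual_deriv b (F i))"
  using assms(2)
proof (cases b rule: Basis_prod_cases)
  case (1 c)
  then have "(\<lambda>i. dual_deriv b (F i)) = (\<lambda>i. dir_deriv b (F i))"
    by (auto simp: dual_deriv_def intro!: ext)
  then show ?thesis using smooth_familyD(3)[OF assms] by simp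
next
  case (2 c)
  have "(\<lambda>i. dual_deriv b (F i)) = (\<lambda>i z. (- (2 * pi * \<i>) * complex_of_real (c \<bullet> snd z)) * F i z)"
    using 2 by (auto simp: dual_deriv_def dir_deriv_0[OF smooth_familyD(1)[OF F]] intro!: ext simp flip: zero_prod_def)
  moreover have "slow_family (\<lambda>(_::'i) (z::'a \<times> 'a). (- (2 * pi * \<i>)) * complex_of_real (c \<bullet> snd z))"
    by (rule slow_family_inner_mult) (intro bounded_linear_compose[OF bounded_linear_inner_right] bounded_linear_snd)
  ultimately show ?thesis using schwartz_family_slow_mult[OF _ F] by (simp only:)
qed

lemma schwartz_family_dual_mult:
  fixes F :: "'i \<Rightarrow> 'a::euclidean_space \<times> 'a \<Rightarrow> complex"
  assumes F: "schwartz_family F" and "b \<in> Basis"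
  shows "schwartz_family (\<lambda>i. dual_mult b (F i))"
  using assms(2)
proof (cases b rule: Basis_prod_cases)
  case (1 c)
  have "(\<lambda>i. dual_mult b (F i)) = (\<lambda>i z. (1 * complex_of_real (fst z \<bullet> c)) * F i z)"
    using 1 by (auto simp: dual_mult_def dir_deriv_0[OF smooth_familyD(1)[OF F]] intro!: ext simp flip: zero_prod_def)
  moreover have "slow_family (\<lambda>(_::'i) (z::'a \<times> 'a). 1 * complex_of_real (fst z \<bullet> c))"
    by (rule slow_family_inner_mult) (intro bounded_linear_compose[OF bounded_linear_inner_left] bounded_linear_fst)
  ultimately show ?thesis using schwartz_family_slow_mult[OF _ F] by (simp only:)
next
  case (2 c)
  then have eq: "(\<lambda>i. dual_mult b (F i)) = (\<lambda>i z. (1 / (2 * pi * \<i>)) * dir_deriv b (F i) z)"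
    by (auto simp: dual_mult_def intro!: ext)
  show ?thesis unfolding eq by (rule schwartz_family_cmult[OF smooth_familyD(3)[OF assms] order_refl])
qed

lemma slice_integrable:
  fixes F :: "'i \<Rightarrow> 'a::euclidean_space \<times> 'a \<Rightarrow> complex"
  assumes "schwartz_family F"
  shows "integrable lborel (\<lambda>t. F i (x, t) * character w t)"
  using schwartz_family_integrable[OF schwartz_family_slow_mult[OF slow_family_character
      schwartz_family_slice[OF assms]], of w "(i, x)"] by (simp add: mult.commute)

lemma slice_measurable:
  fixes F :: "'i \<Rightarrow> 'a::euclidean_space \<times> 'a \<Rightarrow> complex"
  assumes "schwartz_family F"
  shows "(\<lambda>t. F i (x, t)) \<in> borel_measurable borel"
  using schwartz_measurable[OF schwartz_family_slice[OF assms], of "(i, x)"] by simp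

lemma character_measurable [measurable]: "character w \<in> borel_measurable borel"
proof -
  have "continuous_on UNIV (character w)"
    by (intro continuous_at_imp_continuous_on ballI has_derivative_continuous[OF has_derivative_character])
  then show ?thesis by (rule borel_measurable_continuous_onI)
qed

section \<open>Decay and derivatives of the partial Fourier transform\<close>

lemma fourier2_fun_sum:
  fixes F :: "'b \<Rightarrow> 'i \<Rightarrow> 'a::euclidean_space \<times> 'a \<Rightarrow> complex"
  assumes "\<And>b. b \<in> A \<Longrightarrow> schwartz_family (F b)"
  shows "fourier2_fun (\<lambda>z. \<Sum>b\<in>A. c b *\<^sub>R F b i z) z = (\<Sum>b\<in>A. c b *\<^sub>R fourier2_fun (F b i) z)"
proof (cases z)
  case (Pair x w)
  have "(\<integral>t. (\<Sum>b\<in>A. c b *\<^sub>R (F b i (x, t) * character w t)) \<partial>lborel) =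
      (\<Sum>b\<in>A. c b *\<^sub>R (\<integral>t. F b i (x, t) * character w t \<partial>lborel))"
    by (subst Bochner_Integration.integral_sum) (auto intro!: slice_integrable assms)
  then show ?thesis by (simp add: Pair fourier2_fun_character sum_distrib_right)
qed

lemma dual_deriv_expand:
  assumes "\<And>x. F differentiable (at x)"
  shows "dual_deriv h F z = (\<Sum>b\<in>Basis. (h \<bullet> b) *\<^sub>R dual_deriv b F z)"
proof -
  have "linear (\<lambda>h. dual_deriv h F z)"
    unfolding dual_deriv_def
    by (intro linear_compose_sub linear_compose[OF _ linear_dir_deriv[OF assms], unfolded o_def])
      (auto intro!: linearI simp: inner_add_left algebra_simps scaleR_conv_of_real)
  then interpret linear "\<lambda>h. dual_deriv h F z" .
  have "dual_deriv h F z = dual_deriv (\<Sum>b\<in>Basis. (h \<bullet> b) *\<^sub>R b) F z"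
    by (simp only: euclidean_representation)
  then show ?thesis by (simp only: sum scale)
qed

lemma fourier2_fun_dual_mult:
  assumes F: "schwartz F" and b: "b \<in> Basis"
  shows "fourier2_fun (dual_mult b F) z = (z \<bullet> b) * fourier2_fun F z"
proof (cases z)
  case (Pair x w)
  have F': "schwartz_family (\<lambda>_::unit. F)" using F schwartz_family_single by blast
  note d = smooth_familyD(1)[OF F']
  show ?thesis
    using b
  proof (cases b rule: Basis_prod_cases)
    case (1 c)
    then show ?thesis
      using dir_deriv_0[OF d] by (simp add: Pair fourier2_fun_character dual_mult_def mult.assoc flip: zero_prod_def)
  next
    case (2 c)
    have "dir_deriv c (\<lambda>t. F (x, t)) t = dir_deriv (0, c) F (x, t)" for t
      by (rule dir_deriv_eqI[OF has_derivative_compose[where f = "\<lambda>t. (x, t)" and g = F,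
          OF has_derivative_Pair[OF has_derivative_const has_derivative_ident]
            has_derivative_dir_deriv[OF d]]])
    then have "dual_mult b F (x, t) = dir_deriv c (\<lambda>t. F (x, t)) t / (2 * pi * \<i>)" for t
      by (simp add: dual_mult_def 2)
    then have "fourier2_fun (dual_mult b F) z = fourier_fun (dir_deriv c (\<lambda>t. F (x, t))) w / (2 * pi * \<i>)"
      by (simp add: Pair fourier2_fun_character fourier_fun_character)
    also have "\<dots> = (w \<bullet> c) * fourier_fun (\<lambda>t. F (x, t)) w"
      using fourier_fun_dir_deriv[OF schwartz_slice[OF F] 2(1)] by simp
    finally show ?thesis by (simp add: Pair 2 fourier2_fun_def)
  qed
qed

lemma fourier2_fun_bounded:
  fixes F :: "'i \<Rightarrow> 'a::euclidean_space \<times> 'a \<Rightarrow> complex"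
  assumes "schwartz_family F"
  shows "\<exists>C. \<forall>i z. norm (fourier2_fun (F i) z) \<le> C"
proof -
  obtain C where C: "\<And>j t. norm ((\<lambda>(i, x) t. F i (x, t)) j t) \<le> C * decay_weight t"
    using schwartz_family_decay[OF schwartz_family_slice[OF assms]] by blast
  have "norm (fourier2_fun (F i) (x, w)) \<le> C * (\<integral>t. decay_weight (t::'a) \<partial>lborel)" for i x w
    unfolding fourier2_fun_character
    using C[of "(i, x)"] slice_measurable[OF assms]
    by (intro decay_integral(2)) (auto simp: norm_mult intro!: borel_measurable_times)
  then show ?thesis by (metis surj_pair)
qed

text \<open>Induction on the exponent: \<open>norm z\<close> is at most the sum of the
  \<open>\<bar>z \<bullet> b\<bar>\<close>, and each factor \<open>z \<bullet> b\<close> is absorbed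
  by passing from \<open>F\<close> to \<open>dual_mult b F\<close>, again a Schwartz family.\<close>

lemma rapid_fourier2_fun:
  fixes F :: "'i \<Rightarrow> 'a::euclidean_space \<times> 'a \<Rightarrow> complex"
  assumes "schwartz_family F"
  shows "rapid (\<lambda>i. fourier2_fun (F i))"
  unfolding rapid_def
proof
  fix k
  show "\<exists>C. \<forall>i z. (1 + norm z) ^ k * norm (fourier2_fun (F i) z) \<le> C"
    using assms
  proof (induction k arbitrary: F)
    case 0
    then show ?case using fourier2_fun_bounded by simp
  next
    case (Suc k)
    obtain C where C: "\<And>i z. (1 + norm z) ^ k * norm (fourier2_fun (F i) z) \<le> C"
      using Suc.IH[OF Suc.prems] by blast
    have "\<forall>b. b \<in> Basis \<longrightarrow> (\<exists>C. \<forall>i z. (1 + norm z) ^ k * norm (fourier2_fun (dual_mult b (F i)) z) \<le> C)"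
      using Suc.IH[OF schwartz_family_dual_mult[OF Suc.prems]] by blast
    then obtain B where B: "\<And>b i z. b \<in> Basis \<Longrightarrow>
        (1 + norm z) ^ k * norm (fourier2_fun (dual_mult b (F i)) z) \<le> B b" by metis
    have "(1 + norm z) ^ Suc k * norm (fourier2_fun (F i) z) \<le> C + sum B Basis" for i z
    proof -
      define G where "G = fourier2_fun (F i)"
      have G: "(1 + norm z) ^ k * (\<bar>z \<bullet> b\<bar> * norm (G z)) \<le> B b" if "b \<in> Basis" for b
        using B[OF that, of z i] fourier2_fun_dual_mult[OF schwartz_familyD[OF Suc.prems] that]
        by (simp add: G_def norm_mult)
      have "(1 + norm z) ^ Suc k * norm (G z) \<le> (1 + norm z) ^ k * ((1 + (\<Sum>b\<in>Basis. \<bar>z \<bullet> b\<bar>)) * norm (G z))"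
        unfolding power_Suc2 mult.assoc using norm_le_l1[of z] by (intro mult_left_mono mult_right_mono) auto
      also have "\<dots> = (1 + norm z) ^ k * norm (G z) + (\<Sum>b\<in>Basis. (1 + norm z) ^ k * (\<bar>z \<bullet> b\<bar> * norm (G z)))"
        by (simp add: distrib_left distrib_right sum_distrib_left sum_distrib_right)
      also have "\<dots> \<le> C + sum B Basis"
        using C G by (intro add_mono sum_mono) (auto simp: G_def)
      finally show ?thesis by (simp add: G_def)
    qed
    then show ?case by blast
  qed
qed

text \<open>Differentiation under the integral by an integrable quadratic bound on the remainder of
  the integrand. Both variables move at once: the increment \<open>p\<close> shifts
  \<open>F\<close>, the increment \<open>k\<close> multiplies by a character.\<close>

lemma has_derivative_fourier2_fun:
  fixes F :: "'a::euclidean_space \<times> 'a \<Rightarrow> complex"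
  assumes F: "schwartz F"
  shows "(fourier2_fun F has_derivative (\<lambda>h. fourier2_fun (dual_deriv h F) z)) (at z)"
proof (cases z)
  case (Pair x w)
  have F': "schwartz_family (\<lambda>_::unit. F)" using F schwartz_family_single by blast
  note diff = smooth_familyD(1)[OF F']
  \<comment> \<open>\<open>N\<close> is the exponent of \<open>decay_weight\<close>. The bounds
    \<open>C1\<close> on \<open>F\<close> and \<open>C2\<close> on its derivatives carry two and one
    further powers, to absorb the powers of \<open>norm t\<close> coming from the phase.\<close>
  define N where "N = DIM('a) + 2"
  have D: "fourier2_fun (dual_deriv h F) z = (\<Sum>b\<in>Basis. (h \<bullet> b) *\<^sub>R fourier2_fun (dual_deriv b F) z)" for h
    using fourier2_fun_sum[of Basis "\<lambda>b _::unit. dual_deriv b F" "\<lambda>b. h \<bullet> b" "()" z]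
      schwartz_family_dual_deriv[OF F']
    by (simp add: dual_deriv_expand[OF diff, of h, abs_def])
  have "linear (\<lambda>h. \<Sum>b\<in>Basis. (h \<bullet> b) *\<^sub>R fourier2_fun (dual_deriv b F) z)"
    by (rule linearI) (simp_all only: inner_add_left scaleR_add_left sum.distrib
      inner_scaleR_left scaleR_sum_right scaleR_scaleR)
  moreover have "(\<lambda>h. fourier2_fun (dual_deriv h F) z) =
      (\<lambda>h. \<Sum>b\<in>Basis. (h \<bullet> b) *\<^sub>R fourier2_fun (dual_deriv b F) z)"
    by (rule ext) (rule D)
  ultimately have lin: "linear (\<lambda>h. fourier2_fun (dual_deriv h F) z)" by (simp only:)
  obtain C0 where C0: "\<And>y h. norm h \<le> 1 \<Longrightarrow>
      (1 + norm y) ^ N * norm (F (y + h) - F y - dir_deriv h F y) \<le> C0 * (norm h)^2"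
    using schwartz_family_taylor[OF F'] by blast
  obtain C1 where C1: "\<And>y. (1 + norm y) ^ (N + 2) * norm (F y) \<le> C1"
    using smooth_familyD(2)[OF F'] unfolding rapid_def by blast
  have "\<forall>b. b \<in> Basis \<longrightarrow> (\<exists>C. \<forall>y. (1 + norm y) ^ (N + 1) * norm (dir_deriv b F y) \<le> C)"
    using smooth_familyD(2)[OF smooth_familyD(3)[OF F']] unfolding rapid_def by blast
  then obtain B where B: "\<And>b y. b \<in> Basis \<Longrightarrow> (1 + norm y) ^ (N + 1) * norm (dir_deriv b F y) \<le> B b"
    by metis
  define C2 where "C2 = sum B Basis"
  have C2: "(1 + norm y) ^ (N + 1) * norm (dir_deriv h F y) \<le> C2 * norm h" for y h
  proof -
    have "(1 + norm y) ^ (N + 1) * norm (dir_deriv h F y)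
        \<le> (1 + norm y) ^ (N + 1) * (\<Sum>b\<in>Basis. norm h * norm (dir_deriv b F y))"
      unfolding dir_deriv_expand[OF diff, of h]
      by (intro mult_left_mono order_trans[OF norm_sum] sum_mono) (auto intro!: mult_right_mono Basis_le_norm)
    also have "\<dots> = (\<Sum>b\<in>Basis. norm h * ((1 + norm y) ^ (N + 1) * norm (dir_deriv b F y)))"
      by (simp only: sum_distrib_left mult.left_commute)
    also have "\<dots> \<le> (\<Sum>b\<in>Basis. norm h * B b)"
      by (intro sum_mono mult_left_mono B) auto
    finally show ?thesis by (simp add: C2_def sum_distrib_left mult.commute)
  qed
  define K where "K = C0 + (2 * pi)^2 * C1 + 2 * pi * C2"
  have main: "norm (fourier2_fun F (z + h) - fourier2_fun F z - fourier2_fun (dual_deriv h F) z)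
      \<le> (K * (\<integral>t. decay_weight (t::'a) \<partial>lborel)) * (norm h)^2" if h: "norm h \<le> 1" for h
  proof -
    obtain p k where hp: "h = (p, k)" by (cases h)
    have pk: "norm p \<le> norm h" "norm k \<le> norm h"
      unfolding hp by (rule norm_fst_le norm_snd_le)+
    define R where "R t = F (x + p, t) * character k t - F (x, t) - dual_deriv h F (x, t)" for t
    have i: "integrable lborel (\<lambda>t. F (y, t) * character v t)" for y v
      using slice_integrable[OF F'] .
    have "integrable lborel (\<lambda>t. \<Sum>b\<in>Basis. (h \<bullet> b) *\<^sub>R (dual_deriv b F (x, t) * character w t))"
      using slice_integrable[OF schwartz_family_dual_deriv[OF F']]
      by (intro Bochner_Integration.integrable_sum integrable_scaleR_right) auto
    then have id: "integrable lborel (\<lambda>t. dual_deriv h F (x, t) * character w t)"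
      by (simp add: dual_deriv_expand[OF diff, of h] sum_distrib_right)
    have ik: "integrable lborel (\<lambda>t. F (x + p, t) * (character w t * character k t))"
      using i[of "x + p" "w + k"] by (simp add: character_add)
    have iR: "integrable lborel (\<lambda>t. R t * character w t)"
      using Bochner_Integration.integrable_diff[OF Bochner_Integration.integrable_diff[OF ik i] id]
      by (simp add: R_def algebra_simps)
    have "fourier2_fun F (z + h) - fourier2_fun F z - fourier2_fun (dual_deriv h F) z
        = (\<integral>t. R t * character w t \<partial>lborel)"
    proof -
      have "(\<integral>t. R t * character w t \<partial>lborel) = (\<integral>t. (F (x + p, t) * (character w t * character k t)
          - F (x, t) * character w t) - dual_deriv h F (x, t) * character w t \<partial>lborel)"
        by (simp add: R_def algebra_simps)
      also have "\<dots> = (\<integral>t. F (x + p, t) * (character w t * character k t) \<partial>lborel)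
          - (\<integral>t. F (x, t) * character w t \<partial>lborel) - (\<integral>t. dual_deriv h F (x, t) * character w t \<partial>lborel)"
        by (simp only: Bochner_Integration.integral_diff[OF Bochner_Integration.integrable_diff[OF ik i] id]
            Bochner_Integration.integral_diff[OF ik i])
      finally show ?thesis
        by (simp add: Pair hp fourier2_fun_character character_add)
    qed
    also have "norm \<dots> \<le> (K * (norm h)^2) * (\<integral>t. decay_weight (t::'a) \<partial>lborel)"
    proof (rule decay_integral(2))
      show "(\<lambda>t. R t * character w t) \<in> borel_measurable borel"
        using borel_measurable_integrable[OF iR] by simp
      fix t :: 'a
      let ?W = "(1 + norm t) ^ N"
      define r where "r = - (2 * pi * (k \<bullet> t))"
      have r: "\<bar>r\<bar> \<le> 2 * pi * norm h * norm t"
        using Cauchy_Schwarz_ineq2[of k t] mult_right_mono[OF pk(2), of "norm t"]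
        by (simp add: r_def abs_mult)
      have t: "1 + norm t \<le> 1 + norm (x, t)" by (simp add: norm_snd_le)
      have W: "?W \<le> (1 + norm (x, t)) ^ N" using t by (intro power_mono) auto
      \<comment> \<open>With the phase \<open>r\<close>, the remainder splits into the Taylor
        remainder of \<open>F\<close> in the direction \<open>p\<close>, that of the character, and
        a product of two first-order terms. Each is quadratic in \<open>h\<close>, and they account
        for the three summands of \<open>K\<close>.\<close>
      have R: "R t = (F ((x, t) + (p, 0)) - F (x, t) - dir_deriv (p, 0) F (x, t)) * cis r
          + F (x, t) * (cis r - 1 - \<i> * r) + dir_deriv (p, 0) F (x, t) * (cis r - 1)"
        by (simp add: R_def dual_deriv_def hp character_def r_def algebra_simps)
      have "?W * norm (F ((x, t) + (p, 0)) - F (x, t) - dir_deriv (p, 0) F (x, t)) \<le> C0 * (norm p)^2"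
      proof -
        have "norm (p, 0::'a) \<le> 1" using pk h by simp
        note order_trans[OF mult_right_mono[OF W norm_ge_zero] C0[OF this]]
        then show ?thesis by simp
      qed
      moreover have "C0 * (norm p)^2 \<le> C0 * (norm h)^2"
      proof -
        have "0 \<le> C0"
          using order_trans[OF mult_nonneg_nonneg C0[of "(SOME b. b \<in> Basis) :: 'a \<times> 'a" 0]] norm_some_Basis by auto
        then show ?thesis using pk by (intro mult_left_mono power_mono) auto
      qed
      ultimately have 1: "?W * norm ((F ((x, t) + (p, 0)) - F (x, t) - dir_deriv (p, 0) F (x, t)) * cis r)
          \<le> C0 * (norm h)^2"
        by (simp add: norm_mult)
      have "?W * norm (F (x, t) * (cis r - 1 - \<i> * r)) \<le> ?W * (norm (F (x, t)) * (2 * pi * norm h * (1 + norm t))^2)"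
        unfolding norm_mult
      proof (intro mult_left_mono order_trans[OF norm_cis_taylor_le])
        have "\<bar>r\<bar> \<le> 2 * pi * norm h * (1 + norm t)"
          using r by (rule order_trans) (auto intro!: mult_left_mono)
        then show "r^2 \<le> (2 * pi * norm h * (1 + norm t))^2"
          by (simp add: abs_le_square_iff[symmetric])
      qed auto
      also have "\<dots> = ((2 * pi)^2 * (norm h)^2) * ((1 + norm t) ^ (N + 2) * norm (F (x, t)))"
        by (simp only: power_add power_mult_distrib mult_ac)
      also have "\<dots> \<le> ((2 * pi)^2 * (norm h)^2) * C1"
        using t by (intro mult_left_mono order_trans[OF _ C1[of "(x, t)"]] mult_right_mono power_mono) auto
      finally have 2: "?W * norm (F (x, t) * (cis r - 1 - \<i> * r)) \<le> (2 * pi)^2 * (norm h)^2 * C1" .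
      have "?W * norm (dir_deriv (p, 0) F (x, t) * (cis r - 1))
          \<le> ?W * (norm (dir_deriv (p, 0) F (x, t)) * (2 * pi * norm h * (1 + norm t)))"
        unfolding norm_mult
      proof (intro mult_left_mono order_trans[OF norm_cis_minus_1_le])
        show "\<bar>r\<bar> \<le> 2 * pi * norm h * (1 + norm t)"
          using r by (rule order_trans) (auto intro!: mult_left_mono)
      qed auto
      also have "\<dots> = (2 * pi * norm h) * ((1 + norm t) ^ (N + 1) * norm (dir_deriv (p, 0) F (x, t)))"
        by (simp add: mult_ac)
      also have "\<dots> \<le> (2 * pi * norm h) * (C2 * norm h)"
      proof (intro mult_left_mono)
        have "(1 + norm t) ^ (N + 1) * norm (dir_deriv (p, 0) F (x, t))
            \<le> (1 + norm (x, t)) ^ (N + 1) * norm (dir_deriv (p, 0) F (x, t))"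
          using t by (intro mult_right_mono power_mono) auto
        also have "\<dots> \<le> C2 * norm (p, 0::'a)" by (rule C2)
        also have "\<dots> \<le> C2 * norm h"
        proof -
          have "0 \<le> C2"
            using order_trans[OF mult_nonneg_nonneg C2[of 0 "SOME b. b \<in> Basis"]] norm_some_Basis by auto
          then show ?thesis using pk by (intro mult_left_mono) auto
        qed
        finally show "(1 + norm t) ^ (N + 1) * norm (dir_deriv (p, 0) F (x, t)) \<le> C2 * norm h" .
      qed auto
      finally have 3: "?W * norm (dir_deriv (p, 0) F (x, t) * (cis r - 1)) \<le> 2 * pi * C2 * (norm h)^2"
        by (simp add: power2_eq_square mult_ac)
      have "?W * norm (R t) \<le> ?W * norm ((F ((x, t) + (p, 0)) - F (x, t) - dir_deriv (p, 0) F (x, t)) * cis r)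
          + ?W * norm (F (x, t) * (cis r - 1 - \<i> * r)) + ?W * norm (dir_deriv (p, 0) F (x, t) * (cis r - 1))"
        unfolding R distrib_left[symmetric]
        by (intro mult_left_mono order_trans[OF norm_triangle_ineq] add_right_mono norm_triangle_ineq) auto
      also have "\<dots> \<le> C0 * (norm h)^2 + (2 * pi)^2 * (norm h)^2 * C1 + 2 * pi * C2 * (norm h)^2"
        by (intro add_mono 1 2 3)
      also have "\<dots> = K * (norm h)^2" by (simp add: K_def algebra_simps)
      finally have "(1 + norm t) ^ (DIM('a) + 2) * norm (R t * character w t) \<le> K * (norm h)^2"
        by (simp add: N_def norm_mult)
      then show "norm (R t * character w t) \<le> K * (norm h)^2 * decay_weight t"
        by (rule decay_weight_bound)
    qed
    finally show ?thesis by (simp add: mult_ac)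
  qed
  show ?thesis by (rule has_derivative_quadraticI[OF lin main])
qed

lemma schwartz_family_fourier2_fun:
  fixes F :: "'i \<Rightarrow> 'a::euclidean_space \<times> 'a \<Rightarrow> complex"
  assumes "schwartz_family F"
  shows "schwartz_family (\<lambda>i. fourier2_fun (F i))"
proof (rule smooth_family_coinduct[where Q = "\<lambda>G. \<exists>F. schwartz_family F \<and> G = (\<lambda>i. fourier2_fun (F i))"])
  fix G :: "'i \<Rightarrow> 'a \<times> 'a \<Rightarrow> complex"
  assume "\<exists>F. schwartz_family F \<and> G = (\<lambda>i. fourier2_fun (F i))"
  then obtain F where F: "schwartz_family F" and G: "G = (\<lambda>i. fourier2_fun (F i))" by blast
  note d = has_derivative_fourier2_fun[OF schwartz_familyD[OF F]]
  show "G i differentiable (at z)" for i z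
    using d unfolding G differentiable_def by blast
  show "rapid G" unfolding G by (rule rapid_fourier2_fun[OF F])
  fix b :: "'a \<times> 'a" assume "b \<in> Basis"
  have "(\<lambda>i. dir_deriv b (G i)) = (\<lambda>i. fourier2_fun (dual_deriv b (F i)))"
    unfolding G by (intro ext dir_deriv_eqI[OF d])
  then show "\<exists>F. schwartz_family F \<and> (\<lambda>i. dir_deriv b (G i)) = (\<lambda>i. fourier2_fun (F i))"
    using schwartz_family_dual_deriv[OF F \<open>b \<in> Basis\<close>] by blast
qed (use assms in blast)

section \<open>Bump functions\<close>

abbreviation smooth_fun :: "('a::euclidean_space \<Rightarrow> 'b::real_normed_vector) \<Rightarrow> bool" where
  "smooth_fun f \<equiv> smooth_family (\<lambda>_. True) (\<lambda>_::unit. f)"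

text \<open>The polynomial makes this class of flat functions stable under differentiation: with
  \<open>y = 1 / s\<close>, the derivative replaces \<open>p\<close> by
  \<open>y\<^sup>2 (p - p')\<close>.\<close>

definition flat_poly :: "real poly \<Rightarrow> real \<Rightarrow> real" where
  "flat_poly p s = (if s > 0 then poly p (1 / s) * exp (- (1 / s)) else 0)"

lemma poly_exp_tendsto_0: "((\<lambda>y. poly p y * exp (- y)) \<longlongrightarrow> (0::real)) at_top"
proof -
  have "((\<lambda>y. \<Sum>i\<le>degree p. coeff p i * (y ^ i / exp y)) \<longlongrightarrow> 0) at_top"
    by (intro tendsto_null_sum tendsto_mult_right_zero tendsto_power_div_exp_0)
  then show ?thesis
    by (simp add: poly_altdef sum_distrib_right exp_minus divide_inverse mult.assoc)
qed

lemma flat_poly_tendsto_0: "(flat_poly p \<longlongrightarrow> 0) (at_right 0)"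
proof -
  have "((\<lambda>s. poly p (inverse s) * exp (- inverse s)) \<longlongrightarrow> 0) (at_right 0)"
    using filterlim_compose[OF poly_exp_tendsto_0 filterlim_inverse_at_top_right] .
  then show ?thesis
  proof (rule Lim_transform_eventually)
    show "\<forall>\<^sub>F s in at_right 0. poly p (inverse s) * exp (- inverse s) = flat_poly p s"
      by (auto simp: eventually_at_right_field flat_poly_def divide_inverse intro!: exI[of _ 1])
  qed
qed

lemma DERIV_flat_poly: "(flat_poly p has_field_derivative flat_poly ([:0, 0, 1:] * (p - pderiv p)) s) (at s)"
proof -
  consider "s > 0" | "s < 0" | "s = 0" by linarith
  then show ?thesis
  proof cases
    case 1
    have "((\<lambda>s. poly p (1 / s) * exp (- (1 / s))) has_field_derivative
        flat_poly ([:0, 0, 1:] * (p - pderiv p)) s) (at s)"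
      using 1 by (auto intro!: derivative_eq_intros simp: flat_poly_def field_simps power2_eq_square)
    then show ?thesis
      by (rule has_field_derivative_transform_within_open[of _ _ _ "{0<..}"])
        (use 1 in \<open>auto simp: flat_poly_def\<close>)
  next
    case 2
    have "((\<lambda>s. 0) has_field_derivative flat_poly ([:0, 0, 1:] * (p - pderiv p)) s) (at s)"
      using 2 by (simp add: flat_poly_def)
    then show ?thesis
      by (rule has_field_derivative_transform_within_open[of _ _ _ "{..<0}"])
        (use 2 in \<open>auto simp: flat_poly_def\<close>)
  next
    case 3
    \<comment> \<open>The difference quotient at 0 is again of this type, with the polynomial
      \<open>y * p\<close>, so its limit is already known to be 0.\<close>
    have "(flat_poly ([:0, 1:] * p) \<longlongrightarrow> 0) (at_left 0)"
      by (rule tendsto_eventually) (auto simp: eventually_at_left_field flat_poly_def intro!: exI[of _ "-1"])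
    then have "(flat_poly ([:0, 1:] * p) \<longlongrightarrow> 0) (at 0)"
      using flat_poly_tendsto_0 by (rule filterlim_split_at)
    moreover have "flat_poly ([:0, 1:] * p) = (\<lambda>h. (flat_poly p (0 + h) - flat_poly p 0) / h)"
      by (rule ext) (simp add: flat_poly_def)
    moreover have "flat_poly ([:0, 0, 1:] * (p - pderiv p)) 0 = 0"
      by (simp add: flat_poly_def)
    ultimately show ?thesis
      unfolding 3 DERIV_def by (simp only:)
  qed
qed

lemma smooth_fun_flat_poly: "smooth_fun (flat_poly p)"
proof (rule smooth_family_coinduct[where Q = "\<lambda>F. \<exists>p. F = (\<lambda>_. flat_poly p)"])
  fix F :: "unit \<Rightarrow> real \<Rightarrow> real" assume "\<exists>p. F = (\<lambda>_. flat_poly p)"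
  then obtain p where F: "F = (\<lambda>_. flat_poly p)" by blast
  note d = DERIV_flat_poly[of p, unfolded has_field_derivative_def]
  show "F i differentiable (at s)" for i s
    using d unfolding F differentiable_def by blast
  fix b :: real assume "b \<in> Basis"
  then have "(\<lambda>i. dir_deriv b (F i)) = (\<lambda>_. flat_poly ([:0, 0, 1:] * (p - pderiv p)))"
    unfolding F by (intro ext) (subst dir_deriv_eqI[OF d], simp)
  then show "\<exists>p. (\<lambda>i. dir_deriv b (F i)) = (\<lambda>_. flat_poly p)" by blast
qed auto

lemma smooth_upto_compose_real:
  fixes F :: "'i \<Rightarrow> 'a::euclidean_space \<Rightarrow> real" and G :: "'i \<Rightarrow> real \<Rightarrow> real"
  assumes "smooth_upto (\<lambda>_. True) n G" "smooth_upto (\<lambda>_. True) n F"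
  shows "smooth_upto (\<lambda>_. True) n (\<lambda>i x. G i (F i x))"
  using assms
proof (induction n arbitrary: G)
  case 0
  then show ?case by (auto intro: differentiable_compose_at)
next
  case (Suc n)
  have d: "G i differentiable (at y)" "F i differentiable (at x)" for i x y
    using Suc.prems by auto
  have "dir_deriv b (\<lambda>x. G i (F i x)) x = dir_deriv 1 (G i) (F i x) * dir_deriv b (F i) x" for i b x
    using linear_scale[OF linear_dir_deriv[OF d(1)], of "dir_deriv b (F i) x" 1]
    by (simp add: dir_deriv_compose d mult.commute)
  then have eq: "(\<lambda>i. dir_deriv b (\<lambda>x. G i (F i x))) = (\<lambda>i x. dir_deriv 1 (G i) (F i x) * dir_deriv b (F i) x)" for b
    by (intro ext)
  have "smooth_upto (\<lambda>_. True) n (\<lambda>i x. dir_deriv 1 (G i) (F i x) * dir_deriv b (F i) x)" if "b \<in> Basis" for b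
    by (rule smooth_upto_mult[where P = "\<lambda>_. True" and Q = "\<lambda>_. True", OF Suc.IH])
      (use Suc.prems that smooth_upto_mono[OF Suc.prems(2), of n] in auto)
  then show ?case
    using d by (simp add: eq differentiable_compose_at)
qed

lemma smooth_fun_compose_real:
  fixes g :: "real \<Rightarrow> real" and f :: "'a::euclidean_space \<Rightarrow> real"
  shows "smooth_fun g \<Longrightarrow> smooth_fun f \<Longrightarrow> smooth_fun (\<lambda>x. g (f x))"
  unfolding smooth_family_def by (intro allI smooth_upto_compose_real[where G = "\<lambda>_. g" and F = "\<lambda>_. f"]) auto

lemma smooth_fun_add: "smooth_fun f \<Longrightarrow> smooth_fun g \<Longrightarrow> smooth_fun (\<lambda>x. f x + g x)"
  by (rule smooth_family_add) auto

lemma smooth_fun_mult: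
  fixes f g :: "'a::euclidean_space \<Rightarrow> real"
  shows "smooth_fun f \<Longrightarrow> smooth_fun g \<Longrightarrow> smooth_fun (\<lambda>x. f x * g x)"
  by (rule smooth_family_mult[where P = "\<lambda>_. True" and Q = "\<lambda>_. True"]) auto

lemma smooth_fun_const: "smooth_fun (\<lambda>x. c)"
  unfolding smooth_family_def by (intro allI smooth_upto_const) simp

lemma smooth_fun_linear: "bounded_linear l \<Longrightarrow> smooth_fun l"
  by (rule smooth_family_mono[OF slow_family_linear]) auto

lemma smooth_fun_diff:
  fixes f g :: "'a::euclidean_space \<Rightarrow> real"
  assumes "smooth_fun f" "smooth_fun g"
  shows "smooth_fun (\<lambda>x. f x - g x)"
  using smooth_fun_add[OF assms(1) smooth_fun_mult[OF smooth_fun_const assms(2)], of "-1"] by simp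

lemma smooth_fun_sq_dist: "smooth_fun (\<lambda>x. (norm (x - p :: 'a::euclidean_space))^2)"
proof -
  have "smooth_fun (\<lambda>x. x \<bullet> b - p \<bullet> b)" for b :: 'a
    by (intro smooth_fun_diff smooth_fun_const smooth_fun_linear bounded_linear_inner_left)
  then have "smooth_fun (\<lambda>x. (x \<bullet> b - p \<bullet> b) * (x \<bullet> b - p \<bullet> b))" for b :: 'a
    by (intro smooth_fun_mult)
  then have "smooth_fun (\<lambda>x. \<Sum>b\<in>Basis. (x \<bullet> b - p \<bullet> b) * (x \<bullet> b - p \<bullet> b))"
    unfolding smooth_family_def by (intro allI smooth_upto_sum) auto
  moreover have "(norm (x - p))^2 = (\<Sum>b\<in>Basis. (x \<bullet> b - p \<bullet> b) * (x \<bullet> b - p \<bullet> b))" for x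
    unfolding power2_norm_eq_inner by (subst euclidean_inner) (simp only: inner_diff_left)
  ultimately show ?thesis by presburger
qed

text \<open>Write \<open>\<phi>\<close> for \<open>flat_poly 1\<close>, that is,
  \<open>exp (- (1 / s))\<close> for positive \<open>s\<close> and 0 elsewhere, and let
  \<open>r > 0\<close>. The inner quotient \<open>q\<close> is at least 1 up to distance
  \<open>r\<close> from \<open>p\<close>, where the argument is at least
  \<open>4 r\<^sup>2 - r\<^sup>2 = 3 r\<^sup>2\<close>, and 0 from distance \<open>2 r\<close> on.
  The outer \<open>1 - e \<phi> (1 - q)\<close> sends every \<open>q \<ge> 1\<close> to 1 and
  \<open>q = 0\<close> to 0, as \<open>\<phi> 1 = 1 / e\<close>.\<close>

definition bump :: "'a::euclidean_space \<Rightarrow> real \<Rightarrow> 'a \<Rightarrow> real" where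
  "bump p r x = 1 - exp 1 * flat_poly 1 (1 - flat_poly 1 (4 * r^2 - (norm (x - p))^2) / flat_poly 1 (3 * r^2))"

lemma smooth_fun_bump: "smooth_fun (bump p r)"
proof -
  have "smooth_fun (\<lambda>x. flat_poly 1 (4 * r^2 - (norm (x - p))^2))"
    by (intro smooth_fun_compose_real[OF smooth_fun_flat_poly] smooth_fun_diff smooth_fun_const smooth_fun_sq_dist)
  from smooth_fun_mult[OF this smooth_fun_const, of "1 / flat_poly 1 (3 * r^2)"]
  have "smooth_fun (\<lambda>x. flat_poly 1 (4 * r^2 - (norm (x - p))^2) / flat_poly 1 (3 * r^2))" by simp
  then show ?thesis
    unfolding bump_def[abs_def]
    by (intro smooth_fun_diff smooth_fun_mult smooth_fun_const smooth_fun_compose_real[OF smooth_fun_flat_poly])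
qed

lemma flat_poly_1: "flat_poly 1 s = (if s > 0 then exp (- (1 / s)) else 0)"
  by (simp add: flat_poly_def)

lemma bump_inner:
  assumes "r > 0" "dist p x \<le> r"
  shows "bump p r x = 1"
proof -
  have "(norm (x - p))^2 \<le> r^2"
    using assms by (intro power_mono) (auto simp: dist_norm norm_minus_commute)
  then have le: "3 * r^2 \<le> 4 * r^2 - (norm (x - p))^2" by simp
  have pos: "3 * r^2 > 0" using assms by simp
  then have "flat_poly 1 (3 * r^2) \<le> flat_poly 1 (4 * r^2 - (norm (x - p))^2)"
    using le less_le_trans[OF pos le]
    by (simp add: flat_poly_1 divide_left_mono[of "3 * r^2" "4 * r^2 - (norm (x - p))^2" 1])
  moreover have "flat_poly 1 (3 * r^2) > 0" using pos by (simp add: flat_poly_1)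
  ultimately have "1 \<le> flat_poly 1 (4 * r^2 - (norm (x - p))^2) / flat_poly 1 (3 * r^2)" by simp
  then show ?thesis by (simp add: bump_def flat_poly_1[of "1 - _"])
qed

lemma bump_outer:
  assumes "r > 0" "2 * r \<le> dist p x"
  shows "bump p r x = 0"
proof -
  have "(2 * r)^2 \<le> (norm (x - p))^2"
    using assms by (intro power_mono) (auto simp: dist_norm norm_minus_commute)
  then show ?thesis by (simp add: bump_def flat_poly_1 exp_minus)
qed

lemma bump_nonneg: "0 \<le> bump p r x"
proof -
  have "flat_poly 1 y \<ge> 0" for y by (simp add: flat_poly_1)
  then have "1 - flat_poly 1 (4 * r^2 - (norm (x - p))^2) / flat_poly 1 (3 * r^2) \<le> 1" by simp
  moreover have "exp 1 * flat_poly 1 s \<le> 1" if "s \<le> 1" for s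
  proof (cases "s > 0")
    case True
    then have "1 \<le> 1 / s" using that by simp
    then show ?thesis using True by (simp add: flat_poly_1 flip: exp_add)
  qed (simp add: flat_poly_1)
  ultimately show ?thesis by (simp add: bump_def)
qed

text \<open>On the open complement of \<open>K\<close> the function is locally 0, hence so are its
  derivatives; on the compact \<open>K\<close> every weighted value is bounded by
  continuity.\<close>

lemma schwartz_compact_support:
  fixes f :: "'a::euclidean_space \<Rightarrow> real"
  assumes "smooth_fun f" "compact K" "\<And>x. x \<notin> K \<Longrightarrow> f x = 0"
  shows "schwartz (\<lambda>x. complex_of_real (f x))"
proof -
  have "schwartz_family (\<lambda>_::unit. (\<lambda>x. complex_of_real (f x)))"
  proof (rule smooth_family_coinduct[where Q = "\<lambda>F. \<exists>f. smooth_fun f \<and> (\<forall>x. x \<notin> K \<longrightarrow> f x = 0) \<and>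
      F = (\<lambda>_ x. complex_of_real (f x))"])
    fix F :: "unit \<Rightarrow> 'a \<Rightarrow> complex"
    assume "\<exists>f. smooth_fun f \<and> (\<forall>x. x \<notin> K \<longrightarrow> f x = 0) \<and> F = (\<lambda>_ x. complex_of_real (f x))"
    then obtain f where f: "smooth_fun f" "\<And>x. x \<notin> K \<Longrightarrow> f x = 0" and F: "F = (\<lambda>_ x. complex_of_real (f x))"
      by blast
    have df: "f differentiable (at x)" for x
      by (rule smooth_familyD(1)[OF f(1)])
    have d: "(F i has_derivative (\<lambda>h. complex_of_real (dir_deriv h f x))) (at x)" for i x
      unfolding F by (rule has_derivative_of_real[OF has_derivative_dir_deriv[OF df]])
    show "F i differentiable (at x)" for i x
      using d unfolding differentiable_def by blast
    show "rapid F" unfolding rapid_def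
    proof
      fix k
      have "continuous_on K f"
        using df by (intro continuous_at_imp_continuous_on ballI differentiable_imp_continuous_within)
      then have "continuous_on K (\<lambda>x. (1 + norm x) ^ k * \<bar>f x\<bar>)" by (intro continuous_intros)
      then have "bounded ((\<lambda>x. (1 + norm x) ^ k * \<bar>f x\<bar>) ` K)"
        using assms(2) compact_continuous_image compact_imp_bounded by blast
      then obtain C where C: "\<And>x. x \<in> K \<Longrightarrow> (1 + norm x) ^ k * \<bar>f x\<bar> \<le> C"
        unfolding bounded_iff by (auto simp: abs_mult)
      have "(1 + norm x) ^ k * norm (F i x) \<le> max C 0" for i x
        using C[of x] f(2)[of x] by (cases "x \<in> K") (auto simp: F)
      then show "\<exists>C. \<forall>i x. (1 + norm x) ^ k * norm (F i x) \<le> C" by blast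
    qed
    fix b :: 'a assume b: "b \<in> Basis"
    have "dir_deriv b f x = 0" if "x \<notin> K" for x
    proof -
      have "((\<lambda>x. 0) has_derivative (\<lambda>h. 0)) (at x)" by simp
      then have "(f has_derivative (\<lambda>h. 0)) (at x)"
        by (rule has_derivative_transform_within_open[where s = "- K"])
          (use that f(2) compact_imp_closed[OF assms(2)] in auto)
      then show ?thesis by (rule dir_deriv_eqI)
    qed
    moreover have "(\<lambda>i. dir_deriv b (F i)) = (\<lambda>_ x. complex_of_real (dir_deriv b f x))"
      by (intro ext dir_deriv_eqI[OF d])
    ultimately show "\<exists>f. smooth_fun f \<and> (\<forall>x. x \<notin> K \<longrightarrow> f x = 0) \<and>
        (\<lambda>i. dir_deriv b (F i)) = (\<lambda>_ x. complex_of_real (f x))"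
      using smooth_familyD(3)[OF f(1) b] by blast
  qed (use assms(1,3) in blast)
  then show ?thesis using schwartz_family_single by blast
qed

lemma schwartz_bump:
  assumes "r > 0"
  shows "schwartz (\<lambda>x. complex_of_real (bump p r x))"
proof (rule schwartz_compact_support[OF smooth_fun_bump])
  show "bump p r x = 0" if "x \<notin> cball p (2 * r)" for x
    using that assms by (intro bump_outer) auto
qed auto

section \<open>Positive integrals; tensor products, translates and conjugates of Schwartz
  functions\<close>

lemma integral_pos_continuous:
  fixes f :: "'a::euclidean_space \<Rightarrow> real"
  assumes f: "integrable lborel f" "continuous_on UNIV f" "\<And>x. 0 \<le> f x" "0 < f a"
  shows "0 < (\<integral>x. f x \<partial>lborel)"
proof -
  have "f a / 2 < f a" using f(4) by simp
  moreover have "isCont f a" using f(2) by (simp add: continuous_on_eq_continuous_at)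
  ultimately have "\<forall>\<^sub>F x in nhds a. f a / 2 < f x"
    by (intro order_tendstoD(1)) (auto simp: continuous_within tendsto_at_within_iff_tendsto_nhds)
  then obtain e where e: "e > 0" "\<And>x. dist x a < e \<Longrightarrow> f a / 2 < f x"
    by (auto simp: eventually_nhds_metric)
  have "0 < f a / 2 * measure lborel (ball a e)"
    using f(4) content_ball_pos[OF e(1), of a] by simp
  also have "\<dots> = (\<integral>x. f a / 2 * indicat_real (ball a e) x \<partial>lborel)"
    by simp
  also have "\<dots> \<le> (\<integral>x. f x \<partial>lborel)"
  proof (rule integral_mono)
    show "integrable lborel (\<lambda>x. f a / 2 * indicat_real (ball a e) x)"
      by (intro integrable_mult_right integrable_real_indicator emeasure_bounded_finite) auto
    show "f a / 2 * indicat_real (ball a e) x \<le> f x" for x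
      using e(2)[of x] f(3)[of x] by (auto simp: indicator_def dist_commute)
  qed (rule f(1))
  finally show ?thesis .
qed

text \<open>A basis vector of the product space differentiates one factor only, so pure tensors are
  stable under basis derivatives and coinduction applies.\<close>

lemma schwartz_family_tensor:
  fixes f :: "'i \<Rightarrow> 'a::euclidean_space \<Rightarrow> complex" and g :: "'i \<Rightarrow> 'b::euclidean_space \<Rightarrow> complex"
  assumes "schwartz_family f" "schwartz_family g"
  shows "schwartz_family (\<lambda>i (x, t). f i x * g i t)"
proof (rule smooth_family_coinduct[where Q = "\<lambda>F. \<exists>f g. schwartz_family f \<and>
    schwartz_family g \<and> F = (\<lambda>i (x, t). f i x * g i t)"])
  fix F :: "'i \<Rightarrow> 'a \<times> 'b \<Rightarrow> complex"
  assume "\<exists>f g. schwartz_family f \<and> schwartz_family g \<and> F = (\<lambda>i (x, t). f i x * g i t)"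
  then obtain f g where f: "schwartz_family f" and g: "schwartz_family g"
    and F: "F = (\<lambda>i (x, t). f i x * g i t)" by blast
  have d: "(F i has_derivative (\<lambda>h. f i (fst z) * dir_deriv (snd h) (g i) (snd z) + dir_deriv (fst h) (f i) (fst z) * g i (snd z))) (at z)"
    for i z
  proof -
    have 1: "((\<lambda>z. f i (fst z)) has_derivative (\<lambda>h. dir_deriv (fst h) (f i) (fst z))) (at z)"
      by (rule has_derivative_compose[OF bounded_linear_imp_has_derivative[OF bounded_linear_fst]
          has_derivative_dir_deriv[OF smooth_familyD(1)[OF f]]])
    have 2: "((\<lambda>z. g i (snd z)) has_derivative (\<lambda>h. dir_deriv (snd h) (g i) (snd z))) (at z)"
      by (rule has_derivative_compose[OF bounded_linear_imp_has_derivative[OF bounded_linear_snd]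
          has_derivative_dir_deriv[OF smooth_familyD(1)[OF g]]])
    show ?thesis using has_derivative_mult[OF 1 2] by (simp add: F case_prod_beta')
  qed
  show "F i differentiable (at z)" for i z
    using d unfolding differentiable_def by blast
  show "rapid F" unfolding rapid_def
  proof
    fix k
    obtain C where C: "\<And>i x. (1 + norm x) ^ k * norm (f i x) \<le> C"
      using smooth_familyD(2)[OF f] unfolding rapid_def by blast
    obtain D where D: "\<And>i x. (1 + norm x) ^ k * norm (g i x) \<le> D"
      using smooth_familyD(2)[OF g] unfolding rapid_def by blast
    have "(1 + norm z) ^ k * norm (F i z) \<le> C * D" for i z
    proof (cases z)
      case (Pair x t)
      have "1 + norm z \<le> (1 + norm x) * (1 + norm t)"
        using norm_Pair_le[of x t] by (simp add: Pair algebra_simps) (smt (verit) mult_nonneg_nonneg norm_ge_zero)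
      then have "(1 + norm z) ^ k * norm (F i z) \<le> ((1 + norm x) * (1 + norm t)) ^ k * norm (F i z)"
        by (intro mult_right_mono power_mono) auto
      also have "\<dots> = ((1 + norm x) ^ k * norm (f i x)) * ((1 + norm t) ^ k * norm (g i t))"
        by (simp add: F Pair norm_mult power_mult_distrib mult_ac)
      also have "\<dots> \<le> C * D"
        by (intro mult_mono C D order_trans[OF _ C]) auto
      finally show ?thesis .
    qed
    then show "\<exists>C. \<forall>i z. (1 + norm z) ^ k * norm (F i z) \<le> C" by blast
  qed
  fix b :: "'a \<times> 'b" assume "b \<in> Basis"
  then show "\<exists>f g. schwartz_family f \<and> schwartz_family g \<and>
      (\<lambda>i. dir_deriv b (F i)) = (\<lambda>i (x, t). f i x * g i t)"
  proof (cases b rule: Basis_prod_cases)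
    case (1 c)
    have "(\<lambda>i. dir_deriv b (F i)) = (\<lambda>i (x, t). dir_deriv c (f i) x * g i t)"
      using dir_deriv_0[OF smooth_familyD(1)[OF g]]
      by (intro ext) (simp add: dir_deriv_eqI[OF d] 1 split: prod.split)
    then show ?thesis using smooth_familyD(3)[OF f 1(1)] g by blast
  next
    case (2 c)
    have "(\<lambda>i. dir_deriv b (F i)) = (\<lambda>i (x, t). f i x * dir_deriv c (g i) t)"
      using dir_deriv_0[OF smooth_familyD(1)[OF f]]
      by (intro ext) (simp add: dir_deriv_eqI[OF d] 2 split: prod.split)
    then show ?thesis using smooth_familyD(3)[OF g 2(1)] f by blast
  qed
next
  show "\<exists>f' g'. schwartz_family f' \<and> schwartz_family g' \<and>
      (\<lambda>i (x, t). f i x * g i t) = (\<lambda>i (x, t). f' i x * g' i t)"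
    using assms by (intro exI[of _ f] exI[of _ g]) simp
qed

lemma schwartz_tensor:
  fixes f :: "'a::euclidean_space \<Rightarrow> complex" and g :: "'b::euclidean_space \<Rightarrow> complex"
  shows "schwartz f \<Longrightarrow> schwartz g \<Longrightarrow> schwartz (\<lambda>(x, t). f x * g t)"
  using schwartz_family_tensor[of "\<lambda>_::unit. f" "\<lambda>_::unit. g"] by (simp add: schwartz_family_single)

lemma schwartz_translate:
  fixes f :: "'a::euclidean_space \<Rightarrow> complex"
  assumes "schwartz f"
  shows "schwartz (\<lambda>x. f (x + c))"
proof -
  have "schwartz_family (\<lambda>_::unit. (\<lambda>x. f (x + c)))"
  proof (rule smooth_family_coinduct[where Q = "\<lambda>F. \<exists>f. schwartz_family (\<lambda>_::unit. f) \<and> F = (\<lambda>_ x. f (x + c))"])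
    fix F :: "unit \<Rightarrow> 'a \<Rightarrow> complex"
    assume "\<exists>f. schwartz_family (\<lambda>_::unit. f) \<and> F = (\<lambda>_ x. f (x + c))"
    then obtain f where f: "schwartz_family (\<lambda>_::unit. f)" and F: "F = (\<lambda>_ x. f (x + c))" by blast
    have d: "(F i has_derivative (\<lambda>h. dir_deriv h f (x + c))) (at x)" for i x
    proof -
      have "((\<lambda>x. x + c) has_derivative (\<lambda>h. h)) (at x)" by (auto intro!: derivative_eq_intros)
      from has_derivative_compose[OF this has_derivative_dir_deriv[OF smooth_familyD(1)[OF f]]]
      show ?thesis by (simp add: F)
    qed
    show "F i differentiable (at x)" for i x
      using d unfolding differentiable_def by blast
    show "rapid F" unfolding rapid_def
    proof
      fix k
      obtain C where C: "\<And>x. (1 + norm x) ^ k * norm (f x) \<le> C"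
        using smooth_familyD(2)[OF f] unfolding rapid_def by blast
      have "(1 + norm x) ^ k * norm (F i x) \<le> (1 + norm c) ^ k * C" for i x
      proof -
        have "norm x \<le> norm (x + c) + norm c" using norm_triangle_ineq4[of "x + c" c] by simp
        then have "1 + norm x \<le> (1 + norm c) * (1 + norm (x + c))"
          by (simp add: algebra_simps) (smt (verit) mult_nonneg_nonneg norm_ge_zero)
        then have "(1 + norm x) ^ k * norm (F i x) \<le> ((1 + norm c) * (1 + norm (x + c))) ^ k * norm (F i x)"
          by (intro mult_right_mono power_mono) auto
        also have "\<dots> = (1 + norm c) ^ k * ((1 + norm (x + c)) ^ k * norm (f (x + c)))"
          by (simp add: F power_mult_distrib)
        also have "\<dots> \<le> (1 + norm c) ^ k * C"
          by (intro mult_left_mono C) auto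
        finally show ?thesis .
      qed
      then show "\<exists>C. \<forall>i x. (1 + norm x) ^ k * norm (F i x) \<le> C" by blast
    qed
    fix b :: 'a assume b: "b \<in> Basis"
    have "(\<lambda>i. dir_deriv b (F i)) = (\<lambda>_ x. dir_deriv b f (x + c))"
      by (intro ext dir_deriv_eqI[OF d])
    then show "\<exists>f. schwartz_family (\<lambda>_::unit. f) \<and> (\<lambda>i. dir_deriv b (F i)) = (\<lambda>_ x. f (x + c))"
      using smooth_familyD(3)[OF f b] by blast
  qed (intro exI[of _ f], use assms in \<open>simp add: schwartz_family_single\<close>)
  then show ?thesis using schwartz_family_single by blast
qed

lemma schwartz_family_cnj:
  fixes F :: "'i \<Rightarrow> 'a::euclidean_space \<Rightarrow> complex"
  assumes "schwartz_family F"
  shows "schwartz_family (\<lambda>i x. cnj (F i x))"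
proof (rule smooth_family_coinduct[where Q = "\<lambda>G. \<exists>F. schwartz_family F \<and> G = (\<lambda>i x. cnj (F i x))"])
  fix G :: "'i \<Rightarrow> 'a \<Rightarrow> complex"
  assume "\<exists>F. schwartz_family F \<and> G = (\<lambda>i x. cnj (F i x))"
  then obtain F where F: "schwartz_family F" and G: "G = (\<lambda>i x. cnj (F i x))" by blast
  have d: "(G i has_derivative (\<lambda>h. cnj (dir_deriv h (F i) x))) (at x)" for i x
    unfolding G
    by (rule bounded_linear.has_derivative[OF bounded_linear_cnj has_derivative_dir_deriv[OF smooth_familyD(1)[OF F]]])
  show "G i differentiable (at x)" for i x
    using d unfolding differentiable_def by blast
  show "rapid G" using smooth_familyD(2)[OF F] by (simp add: G rapid_def)
  fix b :: 'a assume b: "b \<in> Basis"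
  have "(\<lambda>i. dir_deriv b (G i)) = (\<lambda>i x. cnj (dir_deriv b (F i) x))"
    by (intro ext dir_deriv_eqI[OF d])
  then show "\<exists>F. schwartz_family F \<and> (\<lambda>i. dir_deriv b (G i)) = (\<lambda>i x. cnj (F i x))"
    using smooth_familyD(3)[OF F b] by blast
qed (use assms in blast)

section \<open>Fourier inversion up to a constant\<close>

lemma schwartz_single_integrable:
  fixes f :: "'a::euclidean_space \<Rightarrow> complex"
  assumes "schwartz f"
  shows "integrable lborel f" "f \<in> borel_measurable borel" "continuous_on S f"
    "\<exists>C. \<forall>x. norm (f x) \<le> C"
proof -
  have F: "schwartz_family (\<lambda>_::unit. f)" using assms schwartz_family_single by blast
  show "integrable lborel f" "f \<in> borel_measurable borel" "continuous_on S f"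
    using schwartz_family_integrable[OF F] schwartz_measurable[OF F] schwartz_continuous[OF F] by auto
  obtain C where "\<forall>i x. (1 + norm x) ^ 0 * norm (f x) \<le> C"
    using smooth_familyD(2)[OF F] unfolding rapid_def by blast
  then show "\<exists>C. \<forall>x. norm (f x) \<le> C" by auto
qed

lemma schwartz_fourier2_fun: "schwartz F \<Longrightarrow> schwartz (fourier2_fun F)"
  using schwartz_family_fourier2_fun[of "\<lambda>_::unit. F"] by (simp add: schwartz_family_single)

text \<open>The full transform is recovered from the partial one: tensor with a bump equal to 1 at 0
  and take the slice at \<open>x = 0\<close>.\<close>

lemma schwartz_family_fourier_fun:
  fixes F :: "'i \<Rightarrow> 'a::euclidean_space \<Rightarrow> complex"
  assumes "schwartz_family F"
  shows "schwartz_family (\<lambda>i. fourier_fun (F i))"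
proof -
  define g where "g x = complex_of_real (bump (0::'a) 1 x)" for x
  have "schwartz g" unfolding g_def by (rule schwartz_bump) simp
  then have "schwartz_family (\<lambda>_::'i. g)" by (simp add: schwartz_family_single)
  from schwartz_family_slice[OF schwartz_family_fourier2_fun[OF schwartz_family_tensor[OF this assms]]]
  have "schwartz_family (\<lambda>j w. case j of (i, x) \<Rightarrow> fourier2_fun (\<lambda>(x, t). g x * F i t) (x, w))"
    by (simp add: case_prod_beta')
  from schwartz_family_reindex[OF this, of "\<lambda>i. (i, 0)"]
  show ?thesis by (simp add: fourier2_fun_def g_def bump_inner)
qed

lemma schwartz_fourier_fun:
  fixes f :: "'a::euclidean_space \<Rightarrow> complex"
  shows "schwartz f \<Longrightarrow> schwartz (fourier_fun f)"
  using schwartz_family_fourier_fun[of "\<lambda>_::unit. f"] by (simp add: schwartz_family_single)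

section \<open>Multiplication formula and inversion\<close>

lemma continuous_character2: "continuous_on S (\<lambda>z. character (fst z) (snd z))"
  unfolding character_def cis_conv_exp by (intro continuous_intros)

lemma tensor_character_integrable:
  fixes f g :: "'a::euclidean_space \<Rightarrow> complex"
  assumes "schwartz f" "schwartz g"
  shows "integrable (lborel \<Otimes>\<^sub>M lborel) (\<lambda>(w, t). g w * f t * character w t)"
proof -
  have "integrable lborel (\<lambda>(w, t). g w * f t)"
    by (intro schwartz_single_integrable schwartz_tensor assms)
  then have "integrable lborel (\<lambda>z. (case z of (w, t) \<Rightarrow> g w * f t) * character (fst z) (snd z))"
  proof (rule Bochner_Integration.integrable_bound)
    show "(\<lambda>z. (case z of (w, t) \<Rightarrow> g w * f t) * character (fst z) (snd z)) \<in> borel_measurable lborel"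
      using schwartz_single_integrable(2)[OF schwartz_tensor[OF assms(2,1)]]
        borel_measurable_continuous_onI[OF continuous_character2]
      by (intro borel_measurable_times) auto
  qed (auto simp: norm_mult)
  then show ?thesis by (simp add: lborel_prod case_prod_beta')
qed

text \<open>Fubini, with a kernel symmetric in \<open>w\<close> and \<open>t\<close>.\<close>

lemma fourier_fun_exchange:
  fixes f g :: "'a::euclidean_space \<Rightarrow> complex"
  assumes "schwartz f" "schwartz g"
  shows "(\<integral>w. fourier_fun f w * g w \<partial>lborel) = (\<integral>t. f t * fourier_fun g t \<partial>lborel)"
proof -
  have "(\<integral>w. fourier_fun f w * g w \<partial>lborel) = (\<integral>w. (\<integral>t. g w * f t * character w t \<partial>lborel) \<partial>lborel)"
    unfolding fourier_fun_character
    by (subst integral_mult_left_zero[symmetric]) (simp add: mult_ac)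
  also have "\<dots> = (\<integral>t. (\<integral>w. g w * f t * character w t \<partial>lborel) \<partial>lborel)"
    using lborel_pair.Fubini_integral[OF tensor_character_integrable[OF assms]] by simp
  also have "\<dots> = (\<integral>t. f t * fourier_fun g t \<partial>lborel)"
    unfolding fourier_fun_character
    by (subst integral_mult_right_zero[symmetric]) (simp add: mult_ac character_commute)
  finally show ?thesis .
qed

lemma schwartz_compose_linear:
  fixes f :: "'b::euclidean_space \<Rightarrow> complex" and L :: "'a::euclidean_space \<Rightarrow> 'b"
  assumes "schwartz f" "linear L" "inj L"
  shows "schwartz (\<lambda>x. f (L x))"
  using schwartz_family_compose_linear[of "\<lambda>_::unit. f" L] assms by (simp add: schwartz_family_single)

lemma schwartz_scale:
  fixes f :: "'a::euclidean_space \<Rightarrow> complex"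
  assumes "schwartz f" "c \<noteq> 0"
  shows "schwartz (\<lambda>x. f (c *\<^sub>R x))"
  using assms(2)
  by (intro schwartz_compose_linear[where L = "(*\<^sub>R) c"] assms(1)
      bounded_linear.linear[OF bounded_linear_scaleR_right]) (simp add: inj_on_def)

text \<open>The dilation moves from \<open>g\<close> to \<open>f\<close>: the Jacobian of the
  substitution \<open>t = e s\<close> is exactly what turns the transform of the dilated
  \<open>g\<close> back into that of \<open>g\<close>.\<close>

lemma fourier_fun_scaled_exchange:
  fixes f g :: "'a::euclidean_space \<Rightarrow> complex"
  assumes f: "schwartz f" and g: "schwartz g" and e: "e > 0"
  shows "(\<integral>w. fourier_fun f w * g (e *\<^sub>R w) \<partial>lborel) = (\<integral>s. f (e *\<^sub>R s) * fourier_fun g s \<partial>lborel)"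
proof -
  have scaled: "e ^ DIM('a) *\<^sub>R fourier_fun (\<lambda>w. g (e *\<^sub>R w)) (e *\<^sub>R s) = fourier_fun g s" for s
  proof -
    have "(\<lambda>w. g w * character s w) \<in> borel_measurable borel"
      using schwartz_single_integrable(2)[OF g] by (intro borel_measurable_times) auto
    from integral_lborel_scale[OF this, of e]
    have "fourier_fun g s = e ^ DIM('a) *\<^sub>R (\<integral>w. g (e *\<^sub>R w) * character s (e *\<^sub>R w) \<partial>lborel)"
      using e by (simp add: fourier_fun_character)
    then show ?thesis by (simp add: fourier_fun_character character_def)
  qed
  have "(\<integral>w. fourier_fun f w * g (e *\<^sub>R w) \<partial>lborel) = (\<integral>t. f t * fourier_fun (\<lambda>w. g (e *\<^sub>R w)) t \<partial>lborel)"
    using e by (intro fourier_fun_exchange f schwartz_scale g) auto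
  also have "\<dots> = e ^ DIM('a) *\<^sub>R (\<integral>s. f (e *\<^sub>R s) * fourier_fun (\<lambda>w. g (e *\<^sub>R w)) (e *\<^sub>R s) \<partial>lborel)"
    using e integral_lborel_scale[of "\<lambda>t. f t * fourier_fun (\<lambda>w. g (e *\<^sub>R w)) t" e]
      schwartz_single_integrable(2)[OF f]
      schwartz_single_integrable(2)[OF schwartz_fourier_fun[OF schwartz_scale[OF g, of e]]]
    by (simp add: borel_measurable_times)
  also have "\<dots> = (\<integral>s. f (e *\<^sub>R s) * (e ^ DIM('a) *\<^sub>R fourier_fun (\<lambda>w. g (e *\<^sub>R w)) (e *\<^sub>R s)) \<partial>lborel)"
    by (simp add: mult_scaleR_right)
  also have "\<dots> = (\<integral>s. f (e *\<^sub>R s) * fourier_fun g s \<partial>lborel)"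
    by (simp only: scaled)
  finally show ?thesis .
qed

text \<open>Let the dilation parameter tend to 0: by dominated convergence the dilated factors may
  be replaced by their values at 0. This is inversion at the origin relative to a reference function
  \<open>g\<close>, without any explicitly computed transform.\<close>

lemma fourier_fun_integral_exchange:
  fixes f g :: "'a::euclidean_space \<Rightarrow> complex"
  assumes f: "schwartz f" and g: "schwartz g"
  shows "(\<integral>w. fourier_fun f w \<partial>lborel) * g 0 = f 0 * (\<integral>s. fourier_fun g s \<partial>lborel)"
proof -
  define e where "e n = inverse (real (Suc n))" for n
  have e: "e n > 0" "e \<longlonglongrightarrow> 0" for n
    using LIMSEQ_inverse_real_of_nat by (auto simp: e_def[abs_def] simp del: of_nat_Suc)
  have lim: "(\<lambda>n. \<integral>x. u x * v (e n *\<^sub>R x) \<partial>lborel) \<longlonglongrightarrow> (\<integral>x. u x * v 0 \<partial>lborel)"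
    if u: "schwartz u" and v: "schwartz v" for u v :: "'a \<Rightarrow> complex"
  proof -
    obtain C where C: "\<And>x. norm (v x) \<le> C" using schwartz_single_integrable(4)[OF v] by blast
    show ?thesis
    proof (rule integral_dominated_convergence[where w = "\<lambda>x. C * norm (u x)"])
      show "integrable lborel (\<lambda>x. C * norm (u x))"
        using schwartz_single_integrable(1)[OF u] by auto
      show "AE x in lborel. (\<lambda>n. u x * v (e n *\<^sub>R x)) \<longlonglongrightarrow> u x * v 0"
      proof (rule AE_I2)
        fix x :: 'a
        have "isCont v 0"
          using schwartz_single_integrable(3)[OF v, of UNIV] by (simp add: continuous_on_eq_continuous_at)
        moreover have "(\<lambda>n. e n *\<^sub>R x) \<longlonglongrightarrow> 0" using tendsto_scaleR[OF e(2) tendsto_const, of x] by simp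
        ultimately have "(\<lambda>n. v (e n *\<^sub>R x)) \<longlonglongrightarrow> v 0" by (rule isCont_tendsto_compose)
        then show "(\<lambda>n. u x * v (e n *\<^sub>R x)) \<longlonglongrightarrow> u x * v 0" by (intro tendsto_intros)
      qed
      show "AE x in lborel. norm (u x * v (e n *\<^sub>R x)) \<le> C * norm (u x)" for n
        unfolding norm_mult mult.commute[of C] by (intro AE_I2 mult_left_mono C) simp
      show "(\<lambda>x. u x * v (e n *\<^sub>R x)) \<in> borel_measurable lborel" for n
        using schwartz_single_integrable(2)[OF u]
          schwartz_single_integrable(2)[OF schwartz_scale[OF v, of "e n"]] e(1)[of n]
        by (simp add: borel_measurable_times)
      show "(\<lambda>x. u x * v 0) \<in> borel_measurable lborel"
        using schwartz_single_integrable(2)[OF u] by simp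
    qed
  qed
  have "(\<lambda>n. \<integral>w. fourier_fun f w * g (e n *\<^sub>R w) \<partial>lborel) = (\<lambda>n. \<integral>s. fourier_fun g s * f (e n *\<^sub>R s) \<partial>lborel)"
    using fourier_fun_scaled_exchange[OF f g e(1)] by (simp add: mult.commute)
  then have "(\<integral>w. fourier_fun f w * g 0 \<partial>lborel) = (\<integral>s. fourier_fun g s * f 0 \<partial>lborel)"
    using lim[OF schwartz_fourier_fun[OF f] g] lim[OF schwartz_fourier_fun[OF g] f]
    by (simp add: LIMSEQ_unique)
  then show ?thesis by (simp add: mult.commute)
qed

text \<open>
  The constant is \<open>1\<close>, but only \<open>c \<noteq> 0\<close> is ever used. It holds because \<open>c = 0\<close> would force
  \<open>\<integral> (F f)\<^sup>2 = \<integral> f F (F f) = 0\<close>, whereas \<open>F f\<close> is real and nonzero for an even bump \<open>f\<close>.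
\<close>

lemma fourier_fun_fourier_fun:
  shows "\<exists>c. c \<noteq> 0 \<and> (\<forall>(f::'a::euclidean_space \<Rightarrow> complex) x. schwartz f \<longrightarrow> fourier_fun (fourier_fun f) x = c * f (- x))"
proof -
  define g where "g x = complex_of_real (bump (0::'a) 1 x)" for x
  have g: "schwartz g" unfolding g_def by (rule schwartz_bump) simp
  have g0: "g 0 = 1" by (simp add: g_def bump_inner)
  define c where "c = (\<integral>s. fourier_fun g s \<partial>lborel)"
  have inv: "fourier_fun (fourier_fun f) x = c * f (- x)" if f: "schwartz f" for f :: "'a \<Rightarrow> complex" and x
  proof -
    \<comment> \<open>The translate takes the value \<open>f (- x)\<close> at 0, and its transform
      is that of \<open>f\<close> times \<open>character x\<close>; this reduces inversion at
      \<open>x\<close> to the origin.\<close>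
    have "fourier_fun (\<lambda>t. f (t + - x)) w = fourier_fun f w * character x w" for w
    proof -
      have "(\<lambda>t. f t * character w (t + x)) \<in> borel_measurable borel"
        using schwartz_single_integrable(2)[OF f] by (simp add: character_add_right)
      from integral_lborel_translate[OF this, of "- x"]
      have "fourier_fun (\<lambda>t. f (t + - x)) w = (\<integral>t. f t * character w (t + x) \<partial>lborel)"
        by (simp add: fourier_fun_character)
      then show ?thesis
        by (simp add: fourier_fun_character character_add_right character_commute[of w x] flip: mult.assoc)
    qed
    then have "fourier_fun (fourier_fun f) x = (\<integral>w. fourier_fun (\<lambda>t. f (t + - x)) w \<partial>lborel)"
      by (simp add: fourier_fun_character[of "fourier_fun f"])
    also have "\<dots> = c * f (- x)"
      using fourier_fun_integral_exchange[OF schwartz_translate[OF f, of "- x"] g] by (simp add: g0 c_def)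
    finally show ?thesis .
  qed
  have "c \<noteq> 0"
  proof
    assume "c = 0"
    note G = schwartz_fourier_fun[OF g]
    have even: "g (- t) = g t" for t by (simp add: g_def bump_def norm_minus_commute)
    have real: "cnj (fourier_fun g w) = fourier_fun g w" for w
    proof -
      have "(\<lambda>t. g t * character w t) \<in> borel_measurable borel"
        using schwartz_single_integrable(2)[OF g] by simp
      from integral_lborel_scale[OF this, of "-1"]
      have "fourier_fun g w = (\<integral>t. g t * character w (- t) \<partial>lborel)"
        by (simp add: fourier_fun_character even)
      also have "\<dots> = (\<integral>t. cnj (g t * character w t) \<partial>lborel)"
        by (simp add: g_def character_def cis_cnj)
      also have "\<dots> = cnj (fourier_fun g w)"
        by (simp only: fourier_fun_character Bochner_Integration.integral_cnj)
      finally show ?thesis by simp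
    qed
    have sq: "fourier_fun g w * fourier_fun g w = complex_of_real ((norm (fourier_fun g w))^2)" for w
      using complex_norm_square[of "fourier_fun g w"] by (simp add: real)
    have "(\<integral>w. fourier_fun g w * fourier_fun g w \<partial>lborel) = 0"
      using fourier_fun_exchange[OF g G] inv[OF g] \<open>c = 0\<close> by simp
    then have "(\<integral>w. (norm (fourier_fun g w))^2 \<partial>lborel) = 0"
      unfolding sq by (simp only: integral_complex_of_real of_real_eq_0_iff)
    moreover have "0 < (\<integral>w. (norm (fourier_fun g w))^2 \<partial>lborel)"
    proof (rule integral_pos_continuous)
      have "integrable lborel (\<lambda>w. fourier_fun g w * fourier_fun g w)"
      proof (rule schwartz_single_integrable(1))
        have "schwartz_family (\<lambda>_::unit. fourier_fun g)" using G schwartz_family_single by blast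
        from schwartz_family_slow_mult[OF schwartz_family_imp_slow_family[OF this] this]
        show "schwartz (\<lambda>w. fourier_fun g w * fourier_fun g w)" by (simp add: schwartz_family_single)
      qed
      from integrable_norm[OF this] show "integrable lborel (\<lambda>w. (norm (fourier_fun g w))^2)"
        by (simp add: norm_mult power2_eq_square)
      show "continuous_on UNIV (\<lambda>w. (norm (fourier_fun g w))^2)"
        by (intro continuous_intros schwartz_single_integrable(3) G)
      have "integrable lborel (\<lambda>t. bump (0::'a) 1 t)"
        using integrable_Re[OF schwartz_single_integrable(1)[OF g]] by (simp add: g_def)
      moreover have "continuous_on UNIV (\<lambda>t. bump (0::'a) 1 t)"
        using continuous_on_Re[OF schwartz_single_integrable(3)[OF g, of UNIV]] by (simp add: g_def)
      ultimately have "0 < (\<integral>t. bump (0::'a) 1 t \<partial>lborel)"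
        by (rule integral_pos_continuous[where a = 0]) (simp_all add: bump_nonneg bump_inner)
      moreover have "fourier_fun g 0 = complex_of_real (\<integral>t. bump (0::'a) 1 t \<partial>lborel)"
        unfolding fourier_fun_character g_def by simp
      ultimately show "0 < (norm (fourier_fun g 0))^2" by simp
    qed auto
    ultimately show False by simp
  qed
  with inv show ?thesis by blast
qed

lemma fourier_fun_inject:
  fixes f g :: "'a::euclidean_space \<Rightarrow> complex"
  assumes "schwartz f" "schwartz g" "fourier_fun f = fourier_fun g"
  shows "f = g"
proof
  fix x
  obtain c where c: "c \<noteq> 0"
    "\<And>(f::'a \<Rightarrow> complex) x. schwartz f \<Longrightarrow> fourier_fun (fourier_fun f) x = c * f (- x)"
    using fourier_fun_fourier_fun by blast
  show "f x = g x"
    using c(2)[OF assms(1), of "- x"] c(2)[OF assms(2), of "- x"] assms(3) c(1) by simp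
qed

lemma fourier2_fun_fourier2_fun:
  "\<exists>c. c \<noteq> 0 \<and> (\<forall>(F::'a::euclidean_space \<times> 'a \<Rightarrow> complex) x w.
     schwartz F \<longrightarrow> fourier2_fun (fourier2_fun F) (x, w) = c * F (x, - w))"
proof -
  obtain c where "c \<noteq> 0"
    "\<And>(f::'a \<Rightarrow> complex) x. schwartz f \<Longrightarrow> fourier_fun (fourier_fun f) x = c * f (- x)"
    using fourier_fun_fourier_fun by blast
  then show ?thesis
    by (intro exI[of _ c]) (simp add: fourier2_fun_def schwartz_slice)
qed

section \<open>Symmetry of second derivatives\<close>

lemma schwartz_dir_deriv: "schwartz f \<Longrightarrow> b \<in> Basis \<Longrightarrow> schwartz (dir_deriv b f)"
  using smooth_familyD(3)[of rapid "\<lambda>_::unit. f" b] by (simp add: schwartz_family_single)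

text \<open>Both sides have the same Fourier transform, with the factors
  \<open>w \<bullet> b\<close> and \<open>w \<bullet> c\<close> in either order, and the transform
  is injective. The symmetry lets \<open>taylor_quotient\<close> commute with derivatives.\<close>

lemma dir_deriv_commute:
  fixes f :: "'a::euclidean_space \<Rightarrow> complex"
  assumes "schwartz f" "b \<in> Basis" "c \<in> Basis"
  shows "dir_deriv b (dir_deriv c f) = dir_deriv c (dir_deriv b f)"
proof (rule fourier_fun_inject)
  show "fourier_fun (dir_deriv b (dir_deriv c f)) = fourier_fun (dir_deriv c (dir_deriv b f))"
    using assms by (intro ext) (simp add: fourier_fun_dir_deriv schwartz_dir_deriv)
qed (use assms in \<open>simp_all add: schwartz_dir_deriv\<close>)

section \<open>Bounded functionals\<close>

text \<open>
  Since the Schwartz space is metrizable, this is the same as being a tempered distribution.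
\<close>

definition bounded_functional :: "'a::euclidean_space functional \<Rightarrow> bool" where
  "bounded_functional u \<longleftrightarrow>
     (\<forall>f g. schwartz f \<longrightarrow> schwartz g \<longrightarrow> u (\<lambda>x. f x + g x) = u f + u g) \<and>
     (\<forall>c f. schwartz f \<longrightarrow> u (\<lambda>x. c * f x) = c * u f) \<and>
     (\<forall>F::nat \<Rightarrow> 'a \<Rightarrow> complex. schwartz_family F \<longrightarrow> (\<exists>C. \<forall>n. norm (u (F n)) \<le> C))"

lemma bounded_functional_add:
  "bounded_functional u \<Longrightarrow> schwartz f \<Longrightarrow> schwartz g \<Longrightarrow> u (\<lambda>x. f x + g x) = u f + u g"
  by (simp add: bounded_functional_def)

lemma bounded_functional_cmult:
  "bounded_functional u \<Longrightarrow> schwartz f \<Longrightarrow> u (\<lambda>x. c * f x) = c * u f"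
  by (simp add: bounded_functional_def)

text \<open>The definition speaks of sequences because it cannot quantify over index types. From a
  family with unbounded values, a sequence whose \<open>n\<close>-th value exceeds \<open>n\<close>
  could be drawn.\<close>

lemma bounded_functional_bound:
  fixes F :: "'i \<Rightarrow> 'a::euclidean_space \<Rightarrow> complex"
  assumes "bounded_functional u" "schwartz_family F"
  shows "\<exists>C. \<forall>i. norm (u (F i)) \<le> C"
proof (rule ccontr)
  assume "\<nexists>C. \<forall>i. norm (u (F i)) \<le> C"
  then have "\<exists>i. real n < norm (u (F i))" for n by (meson not_le)
  then obtain j where j: "\<And>n. real n < norm (u (F (j n)))" by metis
  have "schwartz_family (\<lambda>n. F (j n))" by (rule schwartz_family_reindex[OF assms(2)])
  then obtain C where "\<And>n. norm (u (F (j n))) \<le> C"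
    using assms(1) unfolding bounded_functional_def by blast
  then show False using j reals_Archimedean2[of C] by (meson less_le_not_le order.strict_trans2)
qed

lemma schwartz_0: "schwartz (\<lambda>x. 0)"
proof -
  have "smooth_upto rapid n (\<lambda>_::unit. \<lambda>x::'a. 0::complex)" for n
    by (induction n) (auto simp: dir_deriv_def[abs_def])
  then have "schwartz_family (\<lambda>_::unit. \<lambda>x::'a. 0::complex)" by (simp add: smooth_family_def)
  then show ?thesis by (simp add: schwartz_family_single)
qed

lemma schwartz_add: "schwartz f \<Longrightarrow> schwartz g \<Longrightarrow> schwartz (\<lambda>x. f x + g x)"
  using schwartz_family_add[of "\<lambda>_::unit. f" "\<lambda>_. g"] by (simp add: schwartz_family_single)

lemma schwartz_cmult: "schwartz f \<Longrightarrow> schwartz (\<lambda>x. c * f x)"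
  using schwartz_family_cmult[of "\<lambda>_::unit. f" "\<lambda>_. c" "norm c"] by (simp add: schwartz_family_single)

lemma schwartz_diff: "schwartz f \<Longrightarrow> schwartz g \<Longrightarrow> schwartz (\<lambda>x. f x - g x)"
  using schwartz_add[of f "\<lambda>x. -1 * g x"] schwartz_cmult[of g "-1"] by simp

lemma schwartz_mult: "schwartz f \<Longrightarrow> schwartz g \<Longrightarrow> schwartz (\<lambda>x. f x * g x)"
  using schwartz_family_slow_mult[OF schwartz_family_imp_slow_family, of "\<lambda>_::unit. f" "\<lambda>_. g"]
  by (simp add: schwartz_family_single)

lemma schwartz_cnj: "schwartz f \<Longrightarrow> schwartz (\<lambda>x. cnj (f x))"
  using schwartz_family_cnj[of "\<lambda>_::unit. f"] by (simp add: schwartz_family_single)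

lemma bounded_functional_0: "bounded_functional u \<Longrightarrow> u (\<lambda>x. 0) = 0"
  using bounded_functional_cmult[OF _ schwartz_0, of u 0] by simp

lemma bounded_functional_diff:
  assumes "bounded_functional u" "schwartz f" "schwartz g"
  shows "u (\<lambda>x. f x - g x) = u f - u g"
  using bounded_functional_add[OF assms(1,2) schwartz_cmult[OF assms(3)], of "-1"]
    bounded_functional_cmult[OF assms(1,3), of "-1"] by simp

lemma bounded_functional_sum:
  assumes "bounded_functional u" "finite A" "\<And>a. a \<in> A \<Longrightarrow> schwartz (f a)"
  shows "u (\<lambda>x. \<Sum>a\<in>A. c a * f a x) = (\<Sum>a\<in>A. c a * u (f a)) \<and> schwartz (\<lambda>x. \<Sum>a\<in>A. c a * f a x)"
  using assms(2,3)
proof (induction A)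
  case empty
  then show ?case using bounded_functional_0[OF assms(1)] schwartz_0 by simp
next
  case (insert a A)
  then show ?case
    using bounded_functional_add[OF assms(1) schwartz_cmult, of "f a" "\<lambda>x. \<Sum>a\<in>A. c a * f a x" "c a"]
      bounded_functional_cmult[OF assms(1), of "f a" "c a"]
      schwartz_add[OF schwartz_cmult, of "f a" "\<lambda>x. \<Sum>a\<in>A. c a * f a x" "c a"]
    by auto
qed

lemma bounded_functional_tempered:
  fixes u :: "'a::euclidean_space functional"
  assumes "tempered_distribution u"
  shows "bounded_functional u"
  unfolding bounded_functional_def
proof (intro conjI allI impI)
  fix F :: "nat \<Rightarrow> 'a \<Rightarrow> complex" assume F: "schwartz_family F"
  obtain C N where C: "\<And>f. schwartz f \<Longrightarrow>
      norm (u f) \<le> C * (\<Sum>vs | set vs \<subseteq> Basis \<and> length vs \<le> N. schwartz_seminorm N vs f)"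
    using assms unfolding tempered_distribution_def by blast
  define A where "A = {vs::'a list. set vs \<subseteq> Basis \<and> length vs \<le> N}"
  have "\<exists>B. \<forall>n x. (1 + norm x) ^ N * norm (iter_deriv vs (F n) x) \<le> B" if "vs \<in> A" for vs
  proof -
    have "smooth_upto rapid N F" using F by (simp add: smooth_family_def)
    then have "rapid (\<lambda>n. iter_deriv vs (F n))"
      using that unfolding smooth_upto_iter_deriv A_def by simp
    then show ?thesis unfolding rapid_def by blast
  qed
  then obtain B where B: "\<And>vs n x. vs \<in> A \<Longrightarrow> (1 + norm x) ^ N * norm (iter_deriv vs (F n) x) \<le> B vs"
    by metis
  have s: "0 \<le> schwartz_seminorm N vs (F n)" "schwartz_seminorm N vs (F n) \<le> B vs" if "vs \<in> A" for vs n
  proof -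
    \<comment> \<open>Boundedness above is what makes the supremum in
      \<open>schwartz_seminorm\<close> a genuine upper bound.\<close>
    have bdd: "bdd_above (range (\<lambda>x. (1 + norm x) ^ N * norm (iter_deriv vs (F n) x)))"
      using B[OF that] by (auto simp: bdd_above_def)
    have "0 \<le> (1 + norm (0::'a)) ^ N * norm (iter_deriv vs (F n) 0)" by simp
    also have "\<dots> \<le> schwartz_seminorm N vs (F n)"
      unfolding schwartz_seminorm_def by (rule cSUP_upper[OF UNIV_I bdd])
    finally show "0 \<le> schwartz_seminorm N vs (F n)" .
    show "schwartz_seminorm N vs (F n) \<le> B vs"
      unfolding schwartz_seminorm_def using B[OF that] by (intro cSUP_least) auto
  qed
  have "norm (u (F n)) \<le> \<bar>C\<bar> * sum B A" for n
  proof -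
    have "norm (u (F n)) \<le> C * (\<Sum>vs\<in>A. schwartz_seminorm N vs (F n))"
      using C[OF schwartz_familyD[OF F]] by (simp add: A_def)
    also have "\<dots> \<le> \<bar>C\<bar> * (\<Sum>vs\<in>A. schwartz_seminorm N vs (F n))"
      using s(1) by (intro mult_right_mono sum_nonneg) auto
    also have "\<dots> \<le> \<bar>C\<bar> * sum B A"
      using s(2) by (intro mult_left_mono sum_mono) auto
    finally show ?thesis .
  qed
  then show "\<exists>C. \<forall>n. norm (u (F n)) \<le> C" by blast
qed (use assms in \<open>auto simp: tempered_distribution_def\<close>)

section \<open>Operations that preserve bounded functionals\<close>

lemma bounded_functional_transpose:
  fixes u :: "'b::euclidean_space functional" and L :: "('a::euclidean_space \<Rightarrow> complex) \<Rightarrow> 'b \<Rightarrow> complex"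
  assumes "bounded_functional u"
    and "\<And>F::nat \<Rightarrow> 'a \<Rightarrow> complex. schwartz_family F \<Longrightarrow> schwartz_family (\<lambda>n. L (F n))"
    and "\<And>f g. schwartz f \<Longrightarrow> schwartz g \<Longrightarrow> L (\<lambda>x. f x + g x) = (\<lambda>x. L f x + L g x)"
    and "\<And>c f. schwartz f \<Longrightarrow> L (\<lambda>x. c * f x) = (\<lambda>x. c * L f x)"
  shows "bounded_functional (\<lambda>f. u (L f))"
proof -
  have L: "schwartz (L f)" if "schwartz f" for f
    using assms(2)[of "\<lambda>_. f"] that by (simp add: schwartz_family_single)
  show ?thesis
    unfolding bounded_functional_def
    using bounded_functional_add[OF assms(1)] bounded_functional_cmult[OF assms(1)]
      bounded_functional_bound[OF assms(1) assms(2)] L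
    by (auto simp: assms(3,4))
qed

lemma bounded_functional_cnj_dist:
  assumes "bounded_functional u"
  shows "bounded_functional (cnj_dist u)"
  unfolding bounded_functional_def cnj_dist_def
proof (intro conjI allI impI)
  fix F :: "nat \<Rightarrow> 'a \<Rightarrow> complex" assume "schwartz_family F"
  then show "\<exists>C. \<forall>n. norm (cnj (u (\<lambda>x. cnj (F n x)))) \<le> C"
    using bounded_functional_bound[OF assms schwartz_family_cnj] by simp
qed (simp_all add: bounded_functional_add[OF assms] bounded_functional_cmult[OF assms] schwartz_cnj)

lemma fourier_fun_add:
  fixes f g :: "'a::euclidean_space \<Rightarrow> complex"
  assumes "schwartz f" "schwartz g"
  shows "fourier_fun (\<lambda>x. f x + g x) = (\<lambda>w. fourier_fun f w + fourier_fun g w)"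
proof
  fix w :: 'a
  have "integrable lborel (\<lambda>t. f t * character w t)" if "schwartz f" for f
    using schwartz_family_integrable[OF schwartz_family_slow_mult[OF slow_family_character, of "\<lambda>_::unit. f" w]] that
    by (simp add: schwartz_family_single mult.commute)
  then show "fourier_fun (\<lambda>x. f x + g x) w = fourier_fun f w + fourier_fun g w"
    using assms by (simp add: fourier_fun_character distrib_right)
qed

lemma fourier_fun_cmult: "fourier_fun (\<lambda>x. c * f x) = (\<lambda>w. c * fourier_fun f w)"
  by (simp add: fourier_fun_character[abs_def] mult.assoc)

lemma bounded_functional_fourier:
  assumes "bounded_functional u"
  shows "bounded_functional (fourier u)"
  unfolding fourier_def
  by (rule bounded_functional_transpose[OF assms])
    (simp_all add: schwartz_family_fourier_fun fourier_fun_add fourier_fun_cmult)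

lemma bounded_functional_fourier2:
  assumes "bounded_functional u"
  shows "bounded_functional (fourier2 u)"
  unfolding fourier2_def
proof (rule bounded_functional_transpose[OF assms])
  fix f g :: "'a \<times> 'a \<Rightarrow> complex" assume "schwartz f" "schwartz g"
  then show "fourier2_fun (\<lambda>x. f x + g x) = (\<lambda>x. fourier2_fun f x + fourier2_fun g x)"
    by (intro ext) (simp add: fourier2_fun_def fourier_fun_add schwartz_slice split: prod.split)
next
  fix c and f :: "'a \<times> 'a \<Rightarrow> complex"
  show "fourier2_fun (\<lambda>x. c * f x) = (\<lambda>x. c * fourier2_fun f x)"
    by (intro ext) (simp add: fourier2_fun_def fourier_fun_cmult split: prod.split)
qed (rule schwartz_family_fourier2_fun)

text \<open>The cutoff at norm 1 lets all increments \<open>h\<close> serve as indices of one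
  bounded family. At \<open>h = 0\<close> division by zero gives the value 0.\<close>

definition taylor_quotient ::
  "'a::euclidean_space \<Rightarrow> ('a \<Rightarrow> complex) \<Rightarrow> 'a \<Rightarrow> complex" where
  "taylor_quotient h f x = (if norm h \<le> 1 then (f (x + h) - f x - dir_deriv h f x) / of_real ((norm h)^2) else 0)"

text \<open>A functional applied to this family yields a quadratic remainder with a constant
  independent of \<open>h\<close>. The class is stable because \<open>taylor_quotient h\<close>
  commutes with basis derivatives, by the symmetry of second derivatives.\<close>

lemma schwartz_family_taylor_quotient:
  fixes F :: "'i \<Rightarrow> 'a::euclidean_space \<Rightarrow> complex"
  assumes "schwartz_family F"
  shows "schwartz_family (\<lambda>(i, h). taylor_quotient h (F i))"
proof (rule smooth_family_coinduct[where Q = "\<lambda>G. \<exists>F. schwartz_family F \<and> G = (\<lambda>(i, h). taylor_quotient h (F i))"])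
  fix G :: "'i \<times> 'a \<Rightarrow> 'a \<Rightarrow> complex"
  assume "\<exists>F. schwartz_family F \<and> G = (\<lambda>(i, h). taylor_quotient h (F i))"
  then obtain F where F: "schwartz_family F" and G: "G = (\<lambda>(i, h). taylor_quotient h (F i))" by blast
  have d: "(G (i, h) has_derivative (\<lambda>v. if norm h \<le> 1 then
      (dir_deriv v (F i) (x + h) - dir_deriv v (F i) x - (\<Sum>c\<in>Basis. (h \<bullet> c) *\<^sub>R dir_deriv v (dir_deriv c (F i)) x))
        / of_real ((norm h)^2) else 0)) (at x)" for i h x
  proof (cases "norm h \<le> 1")
    case True
    have "((\<lambda>x. x + h) has_derivative (\<lambda>v. v)) (at x)" by (auto intro!: derivative_eq_intros)
    from has_derivative_compose[OF this has_derivative_dir_deriv[OF smooth_familyD(1)[OF F]]]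
    have 1: "((\<lambda>x. F i (x + h)) has_derivative (\<lambda>v. dir_deriv v (F i) (x + h))) (at x)" .
    have "((\<lambda>x. \<Sum>c\<in>Basis. (h \<bullet> c) *\<^sub>R dir_deriv c (F i) x) has_derivative
        (\<lambda>v. \<Sum>c\<in>Basis. (h \<bullet> c) *\<^sub>R dir_deriv v (dir_deriv c (F i)) x)) (at x)"
      by (intro has_derivative_sum has_derivative_scaleR_right has_derivative_dir_deriv)
        (rule smooth_familyD(1)[OF smooth_familyD(3)[OF F]])
    then have 2: "((\<lambda>x. dir_deriv h (F i) x) has_derivative
        (\<lambda>v. \<Sum>c\<in>Basis. (h \<bullet> c) *\<^sub>R dir_deriv v (dir_deriv c (F i)) x)) (at x)"
      by (simp only: dir_deriv_expand[OF smooth_familyD(1)[OF F], of h])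
    note has_derivative_diff[OF has_derivative_diff[OF 1 has_derivative_dir_deriv[OF smooth_familyD(1)[OF F]]] 2]
    from has_derivative_mult_right[OF this, of "inverse (of_real ((norm h)^2))"]
    show ?thesis
      using True by (simp add: G taylor_quotient_def[abs_def] divide_inverse mult.commute)
  next
    case False
    then show ?thesis by (simp add: G taylor_quotient_def[abs_def])
  qed
  show "G j differentiable (at x)" for j x
  proof (cases j)
    case (Pair i h)
    then show ?thesis using d[of i h x] unfolding differentiable_def by blast
  qed
  show "rapid G" unfolding rapid_def
  proof
    fix k
    obtain C where C: "\<And>i x h. norm h \<le> 1 \<Longrightarrow>
        (1 + norm x) ^ k * norm (F i (x + h) - F i x - dir_deriv h (F i) x) \<le> C * (norm h)^2"
      using schwartz_family_taylor[OF F] by meson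
    have "(1 + norm x) ^ k * norm (G (i, h) x) \<le> \<bar>C\<bar>" for i h x
    proof (cases "norm h \<le> 1 \<and> h \<noteq> 0")
      case True
      have "(1 + norm x) ^ k * norm (G (i, h) x) =
          ((1 + norm x) ^ k * norm (F i (x + h) - F i x - dir_deriv h (F i) x)) / (norm h)^2"
        using True by (simp add: G taylor_quotient_def norm_divide norm_power)
      also have "\<dots> \<le> \<bar>C\<bar>"
        using True order_trans[OF C mult_right_mono[OF abs_ge_self]] by (simp add: divide_le_eq)
      finally show ?thesis .
    qed (auto simp: G taylor_quotient_def)
    then show "\<exists>C. \<forall>j x. (1 + norm x) ^ k * norm (G j x) \<le> C" by (metis surj_pair)
  qed
  fix b :: 'a assume b: "b \<in> Basis"
  have "(\<lambda>j. dir_deriv b (G j)) = (\<lambda>(i, h). taylor_quotient h (dir_deriv b (F i)))"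
  proof (intro ext, clarify)
    fix i h x
    have "(\<Sum>c\<in>Basis. (h \<bullet> c) *\<^sub>R dir_deriv b (dir_deriv c (F i)) x) =
        (\<Sum>c\<in>Basis. (h \<bullet> c) *\<^sub>R dir_deriv c (dir_deriv b (F i)) x)"
      by (intro sum.cong) (simp_all add: dir_deriv_commute[OF schwartz_familyD[OF F] b])
    also have "\<dots> = dir_deriv h (dir_deriv b (F i)) x"
      using smooth_familyD(1)[OF smooth_familyD(3)[OF F b]] by (rule dir_deriv_expand[symmetric])
    finally show "dir_deriv b (G (i, h)) x = taylor_quotient h (dir_deriv b (F i)) x"
      by (simp add: dir_deriv_eqI[OF d] taylor_quotient_def)
  qed
  then show "\<exists>F. schwartz_family F \<and> (\<lambda>j. dir_deriv b (G j)) = (\<lambda>(i, h). taylor_quotient h (F i))"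
    using smooth_familyD(3)[OF F b] by blast
qed (use assms in blast)

text \<open>Differentiation under \<open>v\<close>: the remainders in the directions
  \<open>(h, 0)\<close> are multiples of slices of \<open>taylor_quotient\<close>, on which
  \<open>v\<close> is bounded, so the derivative in \<open>x\<close> passes inside. Rapid decay in
  \<open>x\<close> follows by moving the weight \<open>(1 + norm x) ^ k\<close> into the argument of
  \<open>v\<close>.\<close>

lemma schwartz_family_partial_apply:
  fixes F :: "'i \<Rightarrow> 'a::euclidean_space \<times> 'b::euclidean_space \<Rightarrow> complex"
  assumes v: "bounded_functional v" and "schwartz_family F"
  shows "schwartz_family (\<lambda>i x. v (\<lambda>t. F i (x, t)))"
proof (rule smooth_family_coinduct[where Q = "\<lambda>G. \<exists>F. schwartz_family F \<and> G = (\<lambda>i x. v (\<lambda>t. F i (x, t)))"])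
  fix G :: "'i \<Rightarrow> 'a \<Rightarrow> complex"
  assume "\<exists>F. schwartz_family F \<and> G = (\<lambda>i x. v (\<lambda>t. F i (x, t)))"
  then obtain F where F: "schwartz_family F" and G: "G = (\<lambda>i x. v (\<lambda>t. F i (x, t)))" by blast
  have sl: "schwartz (\<lambda>t. H i (x, t))" if "schwartz_family H"
    for H :: "'i \<Rightarrow> 'a \<times> 'b \<Rightarrow> complex" and i x
    by (rule schwartz_slice[OF schwartz_familyD[OF that]])
  have diff: "F i differentiable (at z)" for i z by (rule smooth_familyD(1)[OF F])
  have dF: "schwartz_family (\<lambda>i. dir_deriv b (F i))" if "b \<in> Basis" for b
    by (rule smooth_familyD(3)[OF F that])
  define D where "D i x h = v (\<lambda>t. dir_deriv (h, 0) (F i) (x, t))" for i x h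
  have D: "D i x h = (\<Sum>b\<in>Basis. ((h, 0) \<bullet> b) *\<^sub>R v (\<lambda>t. dir_deriv b (F i) (x, t))) \<and>
      schwartz (\<lambda>t. dir_deriv (h, 0) (F i) (x, t))" for i x h
    using bounded_functional_sum[OF v, of "Basis :: ('a \<times> 'b) set" "\<lambda>b t. dir_deriv b (F i) (x, t)"
        "\<lambda>b. of_real ((h, 0) \<bullet> b)"] sl[OF dF]
    by (simp add: D_def dir_deriv_expand[OF diff, of "(h, 0)"] scaleR_conv_of_real)
  have lin: "linear (D i x)" for i x
  proof (rule linearI)
    fix h k :: 'a and c :: real
    have "((h + k, 0) :: 'a \<times> 'b) = (h, 0) + (k, 0)" "((c *\<^sub>R h, 0) :: 'a \<times> 'b) = c *\<^sub>R (h, 0)" by simp_all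
    then show "D i x (h + k) = D i x h + D i x k" "D i x (c *\<^sub>R h) = c *\<^sub>R D i x h"
      by (simp_all only: D inner_add_left inner_scaleR_left scaleR_add_left sum.distrib scaleR_sum_right scaleR_scaleR)
  qed
  have d: "(G i has_derivative D i x) (at x)" for i x
  proof -
    \<comment> \<open>One constant serves all indices, increments and points \<open>x\<close>, as
      the slices of all quotients form a single Schwartz family.\<close>
    obtain C where C: "\<And>j. norm (v ((\<lambda>(k, x) t. (\<lambda>(i, h). taylor_quotient h (F i)) k (x, t)) j)) \<le> C"
      using bounded_functional_bound[OF v schwartz_family_slice[OF schwartz_family_taylor_quotient[OF F]]]
      by blast
    show ?thesis
    proof (rule has_derivative_quadraticI[OF lin])
      fix h :: 'a assume h: "norm h \<le> 1"
      have q: "schwartz (\<lambda>t. taylor_quotient (h, 0) (F i) (x, t))"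
        using schwartz_slice[OF schwartz_familyD[OF schwartz_family_taylor_quotient[OF F]], of "(i, (h, 0))" x] by simp
      have "F i (x + h, t) - F i (x, t) - dir_deriv (h, 0) (F i) (x, t) =
          of_real ((norm h)^2) * taylor_quotient (h, 0) (F i) (x, t)" for t
        using h dir_deriv_0[OF diff] by (cases "h = 0") (simp_all add: taylor_quotient_def flip: zero_prod_def)
      then have "v (\<lambda>t. F i (x + h, t) - F i (x, t) - dir_deriv (h, 0) (F i) (x, t)) =
          of_real ((norm h)^2) * v (\<lambda>t. taylor_quotient (h, 0) (F i) (x, t))"
        using bounded_functional_cmult[OF v q] by simp
      moreover have "v (\<lambda>t. F i (x + h, t) - F i (x, t) - dir_deriv (h, 0) (F i) (x, t)) = G i (x + h) - G i x - D i x h"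
        using bounded_functional_diff[OF v schwartz_diff[OF sl[OF F] sl[OF F]] D[THEN conjunct2]]
          bounded_functional_diff[OF v sl[OF F] sl[OF F]]
        by (simp add: G D_def)
      ultimately show "norm (G i (x + h) - G i x - D i x h) \<le> C * (norm h)^2"
        using C[of "((i, (h, 0)), x)"] by (simp add: norm_mult norm_power mult.commute[of C] mult_left_mono)
    qed
  qed
  show "G i differentiable (at x)" for i x
    using d unfolding differentiable_def by blast
  show "rapid G" unfolding rapid_def
  proof
    fix k
    obtain C where C: "\<And>j. norm (v (case j of (i, x) \<Rightarrow> \<lambda>t. (1 + norm x) ^ k *\<^sub>R F i (x, t))) \<le> C"
      using bounded_functional_bound[OF v schwartz_family_weighted_slice[OF F, of k]] by blast
    have "(1 + norm x) ^ k * norm (G i x) \<le> C" for i x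
      using C[of "(i, x)"] bounded_functional_cmult[OF v sl[OF F], of "of_real ((1 + norm x) ^ k)"]
      by (simp add: G scaleR_conv_of_real norm_mult norm_power flip: of_real_add of_real_power)
    then show "\<exists>C. \<forall>i x. (1 + norm x) ^ k * norm (G i x) \<le> C" by blast
  qed
  fix b :: 'a assume "b \<in> Basis"
  then have "(b, 0) \<in> (Basis :: ('a \<times> 'b) set)" by (simp add: Basis_prod_def)
  moreover have "(\<lambda>i. dir_deriv b (G i)) = (\<lambda>i x. v (\<lambda>t. dir_deriv (b, 0) (F i) (x, t)))"
    by (intro ext) (simp add: dir_deriv_eqI[OF d] D_def)
  ultimately show "\<exists>F. schwartz_family F \<and> (\<lambda>i. dir_deriv b (G i)) = (\<lambda>i x. v (\<lambda>t. F i (x, t)))"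
    using dF by blast
qed (use assms in blast)

lemma bounded_functional_tensor_dist:
  assumes "bounded_functional u" "bounded_functional v"
  shows "bounded_functional (tensor_dist u v)"
  unfolding tensor_dist_def
  by (rule bounded_functional_transpose[OF assms(1)])
    (simp_all add: schwartz_family_partial_apply[OF assms(2)] bounded_functional_add[OF assms(2)]
      bounded_functional_cmult[OF assms(2)] schwartz_slice)

section \<open>Supports\<close>

lemma vanishes_on_mono: "vanishes_on u V \<Longrightarrow> U \<subseteq> V \<Longrightarrow> vanishes_on u U"
  unfolding vanishes_on_def by (meson subset_trans)

lemma vanishes_near_complement_support:
  assumes "p \<notin> dist_support u"
  obtains r where "r > 0" "vanishes_on u (cball p (2 * r))"
proof -
  obtain U where U: "open U" "vanishes_on u U" "p \<in> U"
    using assms unfolding dist_support_def by auto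
  then obtain e where "e > 0" "cball p e \<subseteq> U" using open_contains_cball by metis
  then show thesis
    using that[of "e / 2"] vanishes_on_mono[OF U(2)] by simp
qed

lemma in_dist_supportD:
  assumes "p \<in> dist_support u" "open U" "p \<in> U"
  obtains f where "schwartz f" "u f \<noteq> 0" "\<And>x. f x \<noteq> 0 \<Longrightarrow> x \<in> U"
proof -
  have "\<not> vanishes_on u U" using assms unfolding dist_support_def by blast
  then obtain f where f: "schwartz f" "closure {x. f x \<noteq> 0} \<subseteq> U" "u f \<noteq> 0"
    unfolding vanishes_on_def by blast
  have "x \<in> U" if "f x \<noteq> 0" for x
    using f(2) closure_subset[of "{x. f x \<noteq> 0}"] that by blast
  with f show thesis using that by blast
qed

text \<open>
  Instead of a partition of unity: \<open>u f = u (f \<Prod>\<^sub>p (1 - h\<^sub>p))\<close>, where the bumps \<open>h\<^sub>p\<close> are supported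
  where \<open>u\<close> vanishes, and some \<open>1 - h\<^sub>p\<close> vanishes at each point of the support of \<open>f\<close>.
\<close>

lemma bounded_functional_eq_0_compact:
  fixes u :: "'a::euclidean_space functional"
  assumes u: "bounded_functional u" and f: "schwartz f" and K: "compact K"
    and supp: "\<And>x. f x \<noteq> 0 \<Longrightarrow> x \<in> K" and disj: "K \<inter> dist_support u = {}"
  shows "u f = 0"
proof -
  have "\<forall>p\<in>K. \<exists>r>0. vanishes_on u (cball p (2 * r))"
    using disj vanishes_near_complement_support by (metis disjoint_iff)
  then obtain r where r: "\<And>p. p \<in> K \<Longrightarrow> r p > 0 \<and> vanishes_on u (cball p (2 * r p))" by metis
  have "K \<subseteq> (\<Union>p\<in>K. ball p (r p))" using r by fastforce
  then obtain P where P: "P \<subseteq> K" "finite P" "K \<subseteq> (\<Union>p\<in>P. ball p (r p))"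
    using compactE_image[OF K, of K "\<lambda>p. ball p (r p)"] by (metis open_ball)
  define h where "h p x = complex_of_real (bump p (r p) x)" for p x
  have h: "schwartz (h p)" if "p \<in> K" for p
    using r[OF that] unfolding h_def by (intro schwartz_bump) simp
  have step: "u (\<lambda>x. g x * (1 - h p x)) = u g \<and> schwartz (\<lambda>x. g x * (1 - h p x))"
    if g: "schwartz g" and p: "p \<in> K" for g p
  proof -
    have gh: "schwartz (\<lambda>x. g x * h p x)" by (rule schwartz_mult[OF g h[OF p]])
    have sub: "{x. g x * h p x \<noteq> 0} \<subseteq> cball p (2 * r p)"
      using r[OF p] bump_outer[of "r p" p] by (force simp: h_def)
    then have "closure {x. g x * h p x \<noteq> 0} \<subseteq> cball p (2 * r p)"
      by (rule closure_minimal) simp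
    moreover have "compact (closure {x. g x * h p x \<noteq> 0})"
      using bounded_subset[OF bounded_cball sub] by (simp add: compact_closure)
    ultimately have "u (\<lambda>x. g x * h p x) = 0"
      using r[OF p] gh unfolding vanishes_on_def by blast
    then show ?thesis
      using bounded_functional_diff[OF u g gh] schwartz_diff[OF g gh] by (simp add: right_diff_distrib)
  qed
  have "u (\<lambda>x. f x * (\<Prod>p\<in>Q. 1 - h p x)) = u f \<and> schwartz (\<lambda>x. f x * (\<Prod>p\<in>Q. 1 - h p x))"
    if "finite Q" "Q \<subseteq> K" for Q
    using that
  proof (induction Q)
    case (insert p Q)
    have eq: "f x * (\<Prod>p\<in>insert p Q. 1 - h p x) = (f x * (\<Prod>p\<in>Q. 1 - h p x)) * (1 - h p x)" for x
      using insert by (simp add: mult_ac)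
    show ?case
      unfolding eq using insert step[of "\<lambda>x. f x * (\<Prod>p\<in>Q. 1 - h p x)" p] by simp
  qed (simp add: f)
  then have "u f = u (\<lambda>x. f x * (\<Prod>p\<in>P. 1 - h p x))" using P by simp
  also have "(\<lambda>x. f x * (\<Prod>p\<in>P. 1 - h p x)) = (\<lambda>x. 0)"
  proof
    fix x
    show "f x * (\<Prod>p\<in>P. 1 - h p x) = 0"
    proof (cases "f x = 0")
      case False
      then obtain p where "p \<in> P" "dist p x < r p" using supp P(3) by fastforce
      then have "1 - h p x = 0" using r P(1) by (auto simp: h_def bump_inner)
      then show ?thesis using \<open>p \<in> P\<close> P(2) by auto
    qed simp
  qed
  finally show ?thesis by (simp add: bounded_functional_0[OF u])
qed

section \<open>From compactly supported to arbitrary Schwartz functions\<close>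

lemma bump_le_1: "bump p r x \<le> 1"
  by (simp add: bump_def flat_poly_1)

text \<open>The complement of a cutoff at radius \<open>n + 1\<close> vanishes for
  \<open>norm x \<le> n + 1\<close>, so after magnification by \<open>n + 1\<close> it still grows
  at most linearly in \<open>x\<close>, uniformly in \<open>n\<close>. The first derivative brings a
  factor \<open>1 / (n + 1)\<close> that cancels the magnification; what remains are dilated
  Schwartz functions with bounded coefficients, a stable class.\<close>

lemma slow_family_cutoff:
  "slow_family (\<lambda>n (x::'a::euclidean_space). of_nat (Suc n) * (1 - complex_of_real (bump 0 1 (x /\<^sub>R Suc n))))"
  (is "slow_family ?m")
proof (rule smooth_family_coinduct[where Q = "\<lambda>F. F = ?m \<or> (\<exists>c C f. (\<forall>n. norm (c n) \<le> C) \<and>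
    schwartz f \<and> F = (\<lambda>n x. c n * f (x /\<^sub>R Suc n)))"])
  fix F :: "nat \<Rightarrow> 'a \<Rightarrow> complex"
  assume F: "F = ?m \<or> (\<exists>c C f. (\<forall>n. norm (c n) \<le> C) \<and> schwartz f \<and> F = (\<lambda>n x. c n * f (x /\<^sub>R Suc n)))"
  define g where "g x = complex_of_real (bump (0::'a) 1 x)" for x
  have g: "schwartz g" unfolding g_def by (rule schwartz_bump) simp
  have diff: "f differentiable (at x)" if "schwartz f" for f :: "'a \<Rightarrow> complex" and x
    using that smooth_familyD(1)[of rapid "\<lambda>_::unit. f"] by (simp add: schwartz_family_single)
  have sc: "((\<lambda>x. f (x /\<^sub>R Suc n)) has_derivative (\<lambda>h. dir_deriv h f (x /\<^sub>R Suc n) /\<^sub>R Suc n)) (at x)"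
    if f: "schwartz f" for f :: "'a \<Rightarrow> complex" and n x
  proof -
    have "((\<lambda>x. f (x /\<^sub>R Suc n)) has_derivative (\<lambda>h. dir_deriv (h /\<^sub>R Suc n) f (x /\<^sub>R Suc n))) (at x)"
      by (rule has_derivative_compose[OF _ has_derivative_dir_deriv[OF diff[OF f]]])
        (intro has_derivative_scaleR_right has_derivative_ident)
    then show ?thesis by (simp only: linear_scale[OF linear_dir_deriv[OF diff[OF f]]])
  qed
  have *: "(\<forall>n x. F n differentiable (at x)) \<and> slow F \<and>
      (\<forall>b. \<exists>c C f. (\<forall>n. norm (c n) \<le> C) \<and> schwartz (f::'a \<Rightarrow> complex) \<and>
        (b \<in> Basis \<longrightarrow> (\<lambda>n. dir_deriv b (F n)) = (\<lambda>n x. c n * f (x /\<^sub>R Suc n))))"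
    using F
  proof (elim disjE exE conjE)
    assume F: "F = ?m"
    have d: "(F n has_derivative (\<lambda>h. - dir_deriv h g (x /\<^sub>R Suc n))) (at x)" for n x
    proof -
      have "((\<lambda>x. of_nat (Suc n) * (1 - g (x /\<^sub>R Suc n))) has_derivative
          (\<lambda>h. of_nat (Suc n) * (0 - dir_deriv h g (x /\<^sub>R Suc n) /\<^sub>R Suc n))) (at x)"
        by (intro has_derivative_mult_right has_derivative_diff has_derivative_const sc g)
      moreover have "complex_of_nat (Suc n) * (0 - z /\<^sub>R Suc n) = - z" for z
        by (simp add: scaleR_conv_of_real del: of_nat_Suc)
      ultimately show ?thesis by (simp add: F g_def del: of_nat_Suc)
    qed
    have "norm (F n x) \<le> 1 * (1 + norm x) ^ 1" for n x
    proof (cases "norm x \<le> Suc n")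
      case True
      then have "bump 0 1 (x /\<^sub>R Suc n) = 1"
        by (intro bump_inner) (simp_all add: field_simps del: of_nat_Suc)
      then show ?thesis by (simp add: F)
    next
      case False
      have "F n x = of_nat (Suc n) * complex_of_real (1 - bump 0 1 (x /\<^sub>R Suc n))"
        by (simp add: F)
      then have "norm (F n x) = real (Suc n) * \<bar>1 - bump 0 1 (x /\<^sub>R Suc n)\<bar>"
        by (simp only: norm_mult norm_of_nat norm_of_real)
      also have "\<dots> \<le> real (Suc n) * 1"
        using bump_nonneg[of "0::'a" 1 "x /\<^sub>R Suc n"] bump_le_1[of "0::'a" 1 "x /\<^sub>R Suc n"]
        by (intro mult_left_mono) auto
      finally show ?thesis using False by simp
    qed
    then have "slow F" unfolding slow_def by blast
    moreover have "F n differentiable (at x)" for n x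
      using d unfolding differentiable_def by blast
    moreover have eq: "(\<lambda>n. dir_deriv b (F n)) = (\<lambda>n x. (-1) * dir_deriv b g (x /\<^sub>R Suc n))" for b
      by (intro ext) (simp add: dir_deriv_eqI[OF d])
    have "\<exists>c C f. (\<forall>n. norm (c n) \<le> C) \<and> schwartz f \<and>
        (b \<in> Basis \<longrightarrow> (\<lambda>n. dir_deriv b (F n)) = (\<lambda>n x. c n * f (x /\<^sub>R Suc n)))" for b
    proof (cases "b \<in> Basis")
      case True
      then show ?thesis
        by (intro exI[of _ "\<lambda>_. -1"] exI[of _ 1] exI[of _ "dir_deriv b g"]) (simp add: eq schwartz_dir_deriv[OF g])
    next
      case False
      then show ?thesis
        by (intro exI[of _ "\<lambda>_. 0"] exI[of _ 0] exI[of _ g]) (simp add: g)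
    qed
    ultimately show ?thesis by (intro conjI allI)
  next
    fix c C f assume c: "\<forall>n. norm (c n) \<le> C" and f: "schwartz f" and F: "F = (\<lambda>n x. c n * f (x /\<^sub>R Suc n))"
    have d: "(F n has_derivative (\<lambda>h. (c n / Suc n) * dir_deriv h f (x /\<^sub>R Suc n))) (at x)" for n x
      unfolding F using has_derivative_mult_right[OF sc[OF f], of "c n" n x]
      by (simp add: scaleR_conv_of_real field_simps del: of_nat_Suc)
    have C: "0 \<le> C" using c norm_ge_zero order_trans by blast
    obtain B where B: "\<And>x. norm (f x) \<le> B" using schwartz_single_integrable(4)[OF f] by blast
    have "norm (F n x) \<le> C * B" for n x
      unfolding F norm_mult using c C B by (intro mult_mono) auto
    then have "slow F" by (rule slow_bounded)
    moreover have "F n differentiable (at x)" for n x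
      using d unfolding differentiable_def by blast
    moreover have "\<exists>c C f. (\<forall>n. norm (c n) \<le> C) \<and> schwartz f \<and>
        (b \<in> Basis \<longrightarrow> (\<lambda>n. dir_deriv b (F n)) = (\<lambda>n x. c n * f (x /\<^sub>R Suc n)))" for b
    proof (cases "b \<in> Basis")
      case True
      have "norm (c n / complex_of_nat (Suc n)) \<le> C" for n
      proof -
        have "norm (c n / complex_of_nat (Suc n)) = norm (c n) / real (Suc n)"
          by (simp only: norm_divide norm_of_nat)
        also have "\<dots> \<le> norm (c n)" by (simp add: field_simps)
        finally show ?thesis using c order_trans by blast
      qed
      moreover have "(\<lambda>n. dir_deriv b (F n)) = (\<lambda>n x. (c n / complex_of_nat (Suc n)) * dir_deriv b f (x /\<^sub>R Suc n))"
        by (intro ext) (simp add: dir_deriv_eqI[OF d])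
      ultimately show ?thesis
        using schwartz_dir_deriv[OF f True]
        by (intro exI[of _ "\<lambda>n. c n / complex_of_nat (Suc n)"] exI[of _ C] exI[of _ "dir_deriv b f"]) auto
    qed (use c f in blast)
    ultimately show ?thesis by (intro conjI allI)
  qed
  show "F n differentiable (at x)" for n x using * by blast
  show "slow F" using * by blast
  fix b :: 'a assume "b \<in> Basis"
  then show "(\<lambda>n. dir_deriv b (F n)) = ?m \<or> (\<exists>c C f. (\<forall>n. norm (c n) \<le> C) \<and>
      schwartz f \<and> (\<lambda>n. dir_deriv b (F n)) = (\<lambda>n x. c n * f (x /\<^sub>R Suc n)))"
    using * by metis
qed simp

text \<open>Cut \<open>f\<close> off at radius \<open>n + 1\<close>: the compactly supported part is
  annihilated by \<open>u\<close>, and the rest, magnified by \<open>n + 1\<close>, runs through a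
  Schwartz family, so \<open>u\<close> takes a value of order \<open>1 / (n + 1)\<close> on it. The
  test functions built later are partial Fourier transforms and call for this generality.\<close>

lemma bounded_functional_eq_0_closed:
  fixes u :: "'a::euclidean_space functional"
  assumes u: "bounded_functional u" and f: "schwartz f" and K: "closed K"
    and supp: "\<And>x. f x \<noteq> 0 \<Longrightarrow> x \<in> K" and disj: "K \<inter> dist_support u = {}"
  shows "u f = 0"
proof -
  define m where "m n x = of_nat (Suc n) * (1 - complex_of_real (bump (0::'a) 1 (x /\<^sub>R Suc n)))" for n x
  have F: "schwartz_family (\<lambda>n x. m n x * f x)"
    unfolding m_def using f by (intro schwartz_family_slow_mult slow_family_cutoff) (simp add: schwartz_family_single)
  note Fn = schwartz_familyD[OF F]
  obtain C where C: "\<And>n. norm (u (\<lambda>x. m n x * f x)) \<le> C"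
    using bounded_functional_bound[OF u F] by blast
  have eq: "u f = u (\<lambda>x. m n x * f x) / of_nat (Suc n)" for n
  proof -
    \<comment> \<open>\<open>g\<close> is the truncated \<open>f\<close>, written as a difference so
      that linearity of \<open>u\<close> relates the two values.\<close>
    define g where "g x = f x - inverse (of_nat (Suc n)) * (m n x * f x)" for x
    have 1: "schwartz (\<lambda>x. inverse (of_nat (Suc n)) * (m n x * f x))" by (rule schwartz_cmult[OF Fn])
    have g: "schwartz g" unfolding g_def by (rule schwartz_diff[OF f 1])
    have gx: "g x = complex_of_real (bump 0 1 (x /\<^sub>R Suc n)) * f x" for x
    proof -
      have "inverse (complex_of_nat (Suc n)) * complex_of_nat (Suc n) = 1"
        by (intro left_inverse of_nat_neq_0)
      then show ?thesis
        unfolding g_def m_def mult.assoc[symmetric] by (simp only: mult_1_left) (simp add: algebra_simps)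
    qed
    have "u g = 0"
    proof (rule bounded_functional_eq_0_compact[OF u g])
      show "compact (K \<inter> cball 0 (2 * real (Suc n)))" using K by (intro closed_Int_compact) auto
      show "K \<inter> cball 0 (2 * real (Suc n)) \<inter> dist_support u = {}" using disj by blast
      fix x assume "g x \<noteq> 0"
      then have "f x \<noteq> 0" "bump 0 1 (x /\<^sub>R Suc n) \<noteq> 0" by (auto simp: gx)
      then have "x \<in> K" "\<not> 2 * 1 \<le> dist 0 (x /\<^sub>R Suc n)" using supp bump_outer[of 1] by (blast, fastforce)
      then show "x \<in> K \<inter> cball 0 (2 * real (Suc n))" by (simp add: field_simps del: of_nat_Suc)
    qed
    moreover have "u g = u f - inverse (of_nat (Suc n)) * u (\<lambda>x. m n x * f x)"
      unfolding g_def bounded_functional_diff[OF u f 1] bounded_functional_cmult[OF u Fn] ..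
    ultimately show ?thesis by (simp add: divide_inverse mult.commute del: of_nat_Suc)
  qed
  have "norm (u f) \<le> C / real (Suc n)" for n
    unfolding eq[of n] norm_divide norm_of_nat by (intro divide_right_mono C) simp
  moreover have "(\<lambda>n. C / real (Suc n)) \<longlonglongrightarrow> 0"
    using tendsto_mult[OF tendsto_const LIMSEQ_inverse_real_of_nat, of C]
    by (simp add: divide_inverse del: of_nat_Suc)
  ultimately have "norm (u f) \<le> 0" by (meson LIMSEQ_le_const)
  then show ?thesis by simp
qed

lemma dist_support_nonempty:
  assumes "bounded_functional u" "nonzero_distribution u"
  shows "dist_support u \<noteq> {}"
proof
  assume "dist_support u = {}"
  then have "u f = 0" if "schwartz f" for f
    using bounded_functional_eq_0_closed[OF assms(1) that closed_UNIV] by simp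
  then show False using assms(2) unfolding nonzero_distribution_def by blast
qed

text \<open>Up to a nonzero constant, every Schwartz function is the double Fourier transform of its
  reflection.\<close>

lemma nonzero_distribution_fourier:
  fixes u :: "'a::euclidean_space functional"
  assumes "bounded_functional u" "nonzero_distribution u"
  shows "nonzero_distribution (fourier u)"
proof -
  obtain f where f: "schwartz f" "u f \<noteq> 0" using assms(2) unfolding nonzero_distribution_def by blast
  obtain c where c: "c \<noteq> 0"
    "\<And>(f::'a \<Rightarrow> complex) x. schwartz f \<Longrightarrow> fourier_fun (fourier_fun f) x = c * f (- x)"
    using fourier_fun_fourier_fun by blast
  define g where "g x = f (- x)" for x
  have g: "schwartz g" using schwartz_scale[OF f(1), of "-1"] by (simp add: g_def[abs_def])
  have "fourier_fun (fourier_fun g) = (\<lambda>x. c * f x)"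
    using c(2)[OF g] by (simp add: fun_eq_iff g_def)
  then have "fourier u (fourier_fun g) = c * u f"
    by (simp add: fourier_def bounded_functional_cmult[OF assms(1) f(1)])
  then show ?thesis
    using f(2) c(1) schwartz_fourier_fun[OF g] unfolding nonzero_distribution_def by force
qed

section \<open>Linear changes of variables\<close>

text \<open>Integrate \<open>f (L x - y) * g y\<close> over \<open>x\<close> and \<open>y\<close>:
  integrating in \<open>x\<close> first gives the left side, and the symmetry of convolution in
  \<open>f\<close> and \<open>g\<close> gives the right side. So composition with \<open>L\<close>
  multiplies all integrals by one common factor, a substitute for the determinant formula.\<close>

lemma integral_linear_bijection_exchange:
  fixes f g :: "'a::euclidean_space \<Rightarrow> complex" and L :: "'a \<Rightarrow> 'a"
  assumes f: "schwartz f" and g: "schwartz g" and L: "linear L" "inj L"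
    and M: "linear M" "\<And>x. L (M x) = x"
  shows "(\<integral>x. f (L x) \<partial>lborel) * (\<integral>x. g x \<partial>lborel) = (\<integral>x. f x \<partial>lborel) * (\<integral>x. g (L x) \<partial>lborel)"
proof -
  have fL: "schwartz (\<lambda>x. f (L x))" and gL: "schwartz (\<lambda>x. g (L x))"
    using schwartz_compose_linear f g L by blast+
  note meas = schwartz_single_integrable(2)
  \<comment> \<open>As \<open>y = L (M y)\<close>, shifting the value of \<open>L x\<close> is a
    shift of the variable \<open>x\<close>.\<close>
  have tr: "(\<integral>x. q (L x - y) \<partial>lborel) = (\<integral>x. q (L x) \<partial>lborel)" if q: "schwartz (\<lambda>x. q (L x))"
    for q :: "'a \<Rightarrow> complex" and y
    using integral_lborel_translate[OF meas[OF q], of "- M y"]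
    by (simp add: linear_diff[OF L(1)] M(2))
  \<comment> \<open>The substitution of \<open>L x - u\<close> for \<open>y\<close> is carried out
    as a translation followed by a reflection.\<close>
  have swap: "(\<integral>y. g y * f (L x - y) \<partial>lborel) = (\<integral>u. g (L x - u) * f u \<partial>lborel)" for x
  proof -
    have m: "(\<lambda>y. g y * f (L x - y)) \<in> borel_measurable borel"
      using meas[OF g] measurable_compose[OF _ meas[OF f], of "\<lambda>y. L x - y" borel] by simp
    then have "(\<integral>y. g y * f (L x - y) \<partial>lborel) = (\<integral>y. g (y + L x) * f (L x - (y + L x)) \<partial>lborel)"
      by (rule integral_lborel_translate[symmetric])
    also have "\<dots> = (\<integral>y. g (- y + L x) * f (L x - (- y + L x)) \<partial>lborel)"
      using measurable_compose[OF _ m, of "\<lambda>y. y + L x" borel]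
      by (subst integral_lborel_scale[where c = "-1"]) auto
    finally show ?thesis by simp
  qed
  have int: "integrable (lborel \<Otimes>\<^sub>M lborel) (\<lambda>(x, y). p (L x - y) * q y)"
    if "schwartz p" "schwartz q" for p q :: "'a \<Rightarrow> complex"
  proof -
    have lin: "linear (\<lambda>z::'a \<times> 'a. (L (fst z) - snd z, snd z))"
      by (rule linearI) (simp_all add: linear_add[OF L(1)] linear_scale[OF L(1)] algebra_simps)
    have "inj (\<lambda>z::'a \<times> 'a. (L (fst z) - snd z, snd z))"
    proof (rule injI)
      fix y z assume "(L (fst y) - snd y, snd y) = (L (fst z) - snd z, snd z)"
      then have "snd y = snd z" "L (fst y) = L (fst z)" by auto
      with injD[OF L(2)] show "y = z" by (intro prod_eqI) simp_all
    qed
    from schwartz_single_integrable(1)[OF schwartz_compose_linear[OF schwartz_tensor[OF that] lin this]]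
    show ?thesis by (simp add: lborel_prod case_prod_beta')
  qed
  have "(\<integral>x. f (L x) \<partial>lborel) * (\<integral>y. g y \<partial>lborel) = (\<integral>y. (\<integral>x. f (L x - y) * g y \<partial>lborel) \<partial>lborel)"
    by (simp add: tr[OF fL])
  also have "\<dots> = (\<integral>x. (\<integral>y. f (L x - y) * g y \<partial>lborel) \<partial>lborel)"
    using lborel_pair.Fubini_integral[OF int[OF f g]] by simp
  also have "\<dots> = (\<integral>x. (\<integral>u. g (L x - u) * f u \<partial>lborel) \<partial>lborel)"
    using swap by (simp add: mult.commute)
  also have "\<dots> = (\<integral>u. (\<integral>x. g (L x - u) * f u \<partial>lborel) \<partial>lborel)"
    using lborel_pair.Fubini_integral[OF int[OF g f]] by simp
  also have "\<dots> = (\<integral>x. f x \<partial>lborel) * (\<integral>x. g (L x) \<partial>lborel)"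
    by (simp add: tr[OF gL] mult.commute)
  finally show ?thesis .
qed

text \<open>A reference function for the exchange formula: its integrals before and after the
  substitution are both positive, so the common factor is well defined and nonzero.\<close>

lemma integral_bump_linear_pos:
  fixes L :: "'a::euclidean_space \<Rightarrow> 'a"
  assumes "linear L" "inj L"
  shows "\<exists>r>0. (\<integral>x. complex_of_real (bump 0 1 (L x)) \<partial>lborel) = complex_of_real r"
proof -
  have s: "schwartz (\<lambda>x. complex_of_real (bump 0 1 (L x)))"
    by (rule schwartz_compose_linear[OF schwartz_bump assms]) simp
  have "0 < (\<integral>x. bump 0 1 (L x) \<partial>lborel)"
  proof (rule integral_pos_continuous[where a = 0])
    show "integrable lborel (\<lambda>x. bump 0 1 (L x))"
      using integrable_Re[OF schwartz_single_integrable(1)[OF s]] by simp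
    show "continuous_on UNIV (\<lambda>x. bump 0 1 (L x))"
      using continuous_on_Re[OF schwartz_single_integrable(3)[OF s, of UNIV]] by simp
  qed (simp_all add: bump_nonneg bump_inner linear_0[OF assms(1)])
  then show ?thesis by auto
qed

lemma integral_linear_bijection:
  fixes L :: "'a::euclidean_space \<Rightarrow> 'a"
  assumes L: "linear L" "inj L" and M: "linear M" "\<And>x. L (M x) = x"
  shows "\<exists>c. c \<noteq> 0 \<and> (\<forall>f::'a \<Rightarrow> complex. schwartz f \<longrightarrow> (\<integral>x. f (L x) \<partial>lborel) = c * (\<integral>x. f x \<partial>lborel))"
proof -
  obtain r where r: "r > 0" "(\<integral>x. complex_of_real (bump (0::'a) 1 (L x)) \<partial>lborel) = complex_of_real r"
    using integral_bump_linear_pos[OF L] by blast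
  obtain q where q: "q > 0" "(\<integral>x. complex_of_real (bump (0::'a) 1 x) \<partial>lborel) = complex_of_real q"
    using integral_bump_linear_pos[OF linear_id inj_on_id] by auto
  have "(\<integral>x. f (L x) \<partial>lborel) = (r / q) * (\<integral>x. f x \<partial>lborel)" if "schwartz f" for f :: "'a \<Rightarrow> complex"
    using integral_linear_bijection_exchange[OF that schwartz_bump[of 1 0] L M] r q
    by (simp add: field_simps)
  then show ?thesis
    using r(1) q(1) by (intro exI[of _ "complex_of_real (r / q)"]) simp
qed

text \<open>\<open>N\<close> is the inverse transpose of \<open>L\<close>: the hypothesis rewrites
  the phase \<open>z \<bullet> x\<close> as a function of \<open>L x\<close>, and the linear
  substitution does the rest.\<close>

lemma fourier_fun_compose_linear:
  fixes L :: "'a::euclidean_space \<Rightarrow> 'a"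
  assumes L: "linear L" "inj L" and M: "linear M" "\<And>x. L (M x) = x"
    and N: "\<And>z x. N z \<bullet> L x = z \<bullet> x"
  shows "\<exists>c. c \<noteq> 0 \<and> (\<forall>(f::'a \<Rightarrow> complex) z. schwartz f \<longrightarrow>
    fourier_fun (\<lambda>x. f (L x)) z = c * fourier_fun f (N z))"
proof -
  obtain c where c: "c \<noteq> 0"
    "\<And>f::'a \<Rightarrow> complex. schwartz f \<Longrightarrow> (\<integral>x. f (L x) \<partial>lborel) = c * (\<integral>x. f x \<partial>lborel)"
    using integral_linear_bijection[OF L M] by blast
  have "fourier_fun (\<lambda>x. f (L x)) z = c * fourier_fun f (N z)" if f: "schwartz f" for f :: "'a \<Rightarrow> complex" and z
  proof -
    have "schwartz (\<lambda>x. character (N z) x * f x)"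
      using schwartz_family_slow_mult[OF slow_family_character, of "\<lambda>_::unit. f" "N z"] f
      by (simp add: schwartz_family_single)
    from c(2)[OF this] show ?thesis
      by (simp add: fourier_fun_character character_def N mult.commute)
  qed
  with c(1) show ?thesis by blast
qed

section \<open>Partial transform in the first variable; tensor products\<close>

definition fourier1_fun ::
  "('a::euclidean_space \<times> 'a \<Rightarrow> complex) \<Rightarrow> 'a \<times> 'a \<Rightarrow> complex" where
  "fourier1_fun F = (\<lambda>(x, w). fourier_fun (\<lambda>y. F (y, w)) x)"

lemma schwartz_swap:
  fixes F :: "'a::euclidean_space \<times> 'a \<Rightarrow> complex"
  assumes "schwartz F"
  shows "schwartz (\<lambda>z. F (snd z, fst z))"
  using assms by (rule schwartz_compose_linear) (auto intro!: linearI injI simp: prod_eq_iff)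

lemma schwartz_fourier1_fun:
  assumes "schwartz F"
  shows "schwartz (fourier1_fun F)"
proof -
  have "fourier1_fun F = (\<lambda>z. fourier2_fun (\<lambda>z. F (snd z, fst z)) (snd z, fst z))"
    by (auto simp: fourier1_fun_def fourier2_fun_def)
  then show ?thesis
    using schwartz_swap[OF schwartz_fourier2_fun[OF schwartz_swap[OF assms]]] by simp
qed

text \<open>Fubini on the product space. The frequency argument tests the Wigner transform with
  \<open>fourier1_fun H\<close>, so that its \<open>fourier2_fun\<close> completes the full
  transform.\<close>

lemma fourier2_fun_fourier1_fun:
  fixes F :: "'a::euclidean_space \<times> 'a \<Rightarrow> complex"
  assumes "schwartz F"
  shows "fourier2_fun (fourier1_fun F) = fourier_fun F"
proof
  fix z :: "'a \<times> 'a"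
  obtain x w where z: "z = (x, w)" by (cases z)
  have "schwartz (\<lambda>y. character z y * F y)"
    using schwartz_family_slow_mult[OF slow_family_character, of "\<lambda>_::unit. F" z] assms
    by (simp add: schwartz_family_single)
  from schwartz_single_integrable(1)[OF this]
  have "integrable (lborel \<Otimes>\<^sub>M lborel) (\<lambda>(y, t). F (y, t) * character z (y, t))"
    by (simp add: lborel_prod case_prod_beta' mult.commute)
  from lborel_pair.integral_snd[OF this]
  have "fourier_fun F z = (\<integral>t. (\<integral>y. F (y, t) * character z (y, t) \<partial>lborel) \<partial>lborel)"
    by (simp add: fourier_fun_character lborel_prod case_prod_beta')
  also have "\<dots> = (\<integral>t. (\<integral>y. F (y, t) * character x y \<partial>lborel) * character w t \<partial>lborel)"
  proof -
    have "character z (y, t) = character x y * character w t" for y t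
      by (simp add: z character_def cis_mult algebra_simps)
    then show ?thesis by (simp only: mult.assoc[symmetric] integral_mult_left_zero)
  qed
  finally show "fourier2_fun (fourier1_fun F) z = fourier_fun F z"
    by (simp add: z fourier2_fun_def fourier1_fun_def fourier_fun_character)
qed

lemma fourier_fun_tensor:
  fixes f g :: "'a::euclidean_space \<Rightarrow> complex"
  assumes "schwartz f" "schwartz g"
  shows "fourier_fun (\<lambda>(x, t). f x * g t) (x, w) = fourier_fun f x * fourier_fun g w"
proof -
  have "fourier1_fun (\<lambda>(x, t). f x * g t) = (\<lambda>(x, t). fourier_fun f x * g t)"
    using fourier_fun_cmult[of "g _" f] by (intro ext) (auto simp: fourier1_fun_def mult.commute)
  then have "fourier_fun (\<lambda>(x, t). f x * g t) (x, w) = fourier2_fun (\<lambda>(x, t). fourier_fun f x * g t) (x, w)"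
    by (simp flip: fourier2_fun_fourier1_fun[OF schwartz_tensor[OF assms]])
  then show ?thesis by (simp add: fourier2_fun_def fourier_fun_cmult)
qed

lemma tensor_dist_tensor:
  assumes "bounded_functional u" "bounded_functional v" "schwartz f" "schwartz g"
  shows "tensor_dist u v (\<lambda>z. c * (case z of (x, t) \<Rightarrow> f x * g t)) = c * (u f * v g)"
proof -
  have "v (\<lambda>t. c * (f x * g t)) = (c * v g) * f x" for x
    using bounded_functional_cmult[OF assms(2,4), of "c * f x"] by (simp add: mult_ac)
  then show ?thesis
    using bounded_functional_cmult[OF assms(1,3), of "c * v g"] by (simp add: tensor_dist_def mult_ac)
qed

section \<open>Phase space in block coordinates\<close>

lemma sum_UNIV_Plus:
  fixes f :: "'m::finite + 'n::finite \<Rightarrow> 'a::comm_monoid_add"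
  shows "sum f UNIV = (\<Sum>k\<in>UNIV. f (Inl k)) + (\<Sum>k\<in>UNIV. f (Inr k))"
  unfolding UNIV_Plus_UNIV[symmetric] by (subst sum.Plus) simp_all

lemma split_vec_join_vec [simp]: "split_vec (join_vec z) = z"
  by (simp add: split_vec_def join_vec_def vec_lambda_eta)

lemma join_vec_split_vec [simp]: "join_vec (split_vec v) = v"
  by (simp add: split_vec_def join_vec_def vec_eq_iff split: sum.split)

lemma inner_join_vec: "join_vec y \<bullet> join_vec z = y \<bullet> (z :: (real ^ 'n::finite) \<times> (real ^ 'n))"
  by (simp add: inner_vec_def sum_UNIV_Plus join_vec_def inner_prod_def)

lemma linear_join_vec: "linear (join_vec :: (real ^ 'n::finite) \<times> (real ^ 'n) \<Rightarrow> real ^ ('n + 'n))"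
  by (rule linearI) (auto simp: join_vec_def vec_eq_iff split: sum.split)

lemma linear_split_vec: "linear (split_vec :: real ^ ('n::finite + 'n) \<Rightarrow> (real ^ 'n) \<times> (real ^ 'n))"
  by (rule linearI) (auto simp: split_vec_def vec_eq_iff)

lemma linear_phase_map: "linear (phase_map M)"
  unfolding phase_map_def[abs_def]
  using linear_compose[OF linear_compose[OF linear_join_vec matrix_vector_mul_linear[of M]] linear_split_vec]
  by (simp add: o_def)

lemma phase_map_mult: "phase_map M (phase_map N z) = phase_map (M ** N) z"
  by (simp add: phase_map_def matrix_vector_mul_assoc)

lemma phase_map_mat_1 [simp]: "phase_map (mat 1) z = z"
  by (simp add: phase_map_def)

lemma phase_map_adjoint: "phase_map M y \<bullet> z = y \<bullet> phase_map (transpose M) z"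
proof -
  have "phase_map M y \<bullet> z = join_vec (phase_map M y) \<bullet> join_vec z" by (rule inner_join_vec[symmetric])
  also have "\<dots> = join_vec y \<bullet> join_vec (phase_map (transpose M) z)"
    by (simp add: phase_map_def dot_lmul_matrix[symmetric] inner_commute)
  finally show ?thesis by (simp add: inner_join_vec)
qed

lemma phase_map_block_matrix: "phase_map (block_matrix A B C D) (s, t) = (A *v s + B *v t, C *v s + D *v t)"
  by (simp add: phase_map_def split_vec_def join_vec_def block_matrix_def matrix_vector_mult_def
      sum_UNIV_Plus vec_eq_iff)

section \<open>Supports of matrix-Wigner transforms\<close>

lemma matrix_inv_mult:
  assumes "invertible T"
  shows "T ** matrix_inv T = mat 1" "matrix_inv T ** T = mat 1"
  using someI_ex[OF assms[unfolded invertible_def]] by (simp_all add: matrix_inv_def)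

lemma bounded_functional_divide:
  assumes "bounded_functional u"
  shows "bounded_functional (\<lambda>f. u f / c)"
  unfolding bounded_functional_def
proof (intro conjI allI impI)
  fix F :: "nat \<Rightarrow> 'a \<Rightarrow> complex" assume "schwartz_family F"
  then obtain C where "\<And>n. norm (u (F n)) \<le> C" using bounded_functional_bound[OF assms] by blast
  then have "norm (u (F n) / c) \<le> C / norm c" for n
    unfolding norm_divide by (intro divide_right_mono) auto
  then show "\<exists>C. \<forall>n. norm (u (F n) / c) \<le> C" by blast
qed (simp_all add: bounded_functional_add[OF assms] bounded_functional_cmult[OF assms] add_divide_distrib)

lemma bounded_functional_pullback:
  fixes T :: "real ^ ('n + 'n) ^ ('n::finite + 'n)"
  assumes "invertible T" "bounded_functional u"
  shows "bounded_functional (pullback T u)"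
proof -
  let ?L = "phase_map (matrix_inv T)"
  have inv: "T ** matrix_inv T = mat 1"
    using assms(1) by (simp add: matrix_inv_mult)
  have "inj ?L"
    by (rule inj_on_inverseI[where g = "phase_map T"]) (simp add: phase_map_mult inv)
  then have "bounded_functional (\<lambda>F. u (F \<circ> ?L))"
    by (intro bounded_functional_transpose[OF assms(2)])
      (simp_all add: o_def schwartz_family_compose_linear[OF _ linear_phase_map])
  then show ?thesis
    unfolding pullback_def by (rule bounded_functional_divide)
qed

context
  fixes T :: "real ^ ('n + 'n) ^ ('n::finite + 'n)" and \<mu> \<nu> :: "(real ^ 'n) functional"
  assumes T: "invertible T"
    and \<mu>: "bounded_functional \<mu>" and \<nu>: "bounded_functional \<nu>"
begin

lemma phase_map_inverse:
  "phase_map T (phase_map (matrix_inv T) z) = z"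
  "phase_map (matrix_inv T) (phase_map T z) = z"
  "phase_map (transpose T) (phase_map (transpose (matrix_inv T)) z) = z"
  "phase_map (transpose (matrix_inv T)) (phase_map (transpose T) z) = z"
  using T by (simp_all add: phase_map_mult matrix_inv_mult transpose_mat
      flip: matrix_transpose_mul)

lemma bounded_functional_matrix_wigner: "bounded_functional (matrix_wigner T \<mu> \<nu>)"
  unfolding matrix_wigner_def
  by (intro bounded_functional_fourier2 bounded_functional_pullback bounded_functional_tensor_dist
      bounded_functional_cnj_dist T \<mu> \<nu>)

text \<open>The pull-back cancels \<open>T\<close> and leaves
  \<open>c * \<mu> f * cnj (\<nu> g)\<close> divided by \<open>\<bar>det T\<bar>\<close>. The
  conjugate on \<open>g\<close> undoes the one that \<open>cnj_dist \<nu>\<close> applies to its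
  argument.\<close>

lemma matrix_wigner_nonzeroI:
  assumes "schwartz f" "schwartz g" "\<mu> f \<noteq> 0" "\<nu> g \<noteq> 0" "c \<noteq> 0"
    and F: "\<And>z. fourier2_fun F z = c * (case phase_map T z of (x, t) \<Rightarrow> f x * cnj (g t))"
  shows "matrix_wigner T \<mu> \<nu> F \<noteq> 0"
proof -
  have "fourier2_fun F \<circ> phase_map (matrix_inv T) = (\<lambda>z. c * (case z of (x, t) \<Rightarrow> f x * cnj (g t)))"
    by (simp add: fun_eq_iff F phase_map_inverse)
  then have "matrix_wigner T \<mu> \<nu> F = c * (\<mu> f * cnj_dist \<nu> (\<lambda>t. cnj (g t))) / of_real \<bar>det T\<bar>"
    using tensor_dist_tensor[OF \<mu> bounded_functional_cnj_dist[OF \<nu>] assms(1) schwartz_cnj[OF assms(2)]]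
    by (simp add: matrix_wigner_def fourier2_def pullback_def)
  then show ?thesis
    using assms T by (simp add: cnj_dist_def invertible_det_nz)
qed

text \<open>\<open>fourier2_fun\<close> leaves the first variable alone, so the test function
  \<open>fourier2_fun H\<close> lies over the same ball around \<open>p\<close> as \<open>H\<close>,
  while its own partial transform is the tensor product of \<open>f\<close> and \<open>cnj g\<close>
  seen through \<open>T\<close>.\<close>

lemma dist_support_matrix_wigner_fst:
  assumes s: "s \<in> dist_support \<mu>" and t: "t \<in> dist_support \<nu>"
    and X: "closed (fst ` dist_support (matrix_wigner T \<mu> \<nu>))"
  shows "fst (phase_map (matrix_inv T) (s, t)) \<in> fst ` dist_support (matrix_wigner T \<mu> \<nu>)"
proof (rule ccontr)
  let ?W = "matrix_wigner T \<mu> \<nu>" and ?L = "phase_map (matrix_inv T)"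
  define p where "p = fst (?L (s, t))"
  assume "fst (?L (s, t)) \<notin> fst ` dist_support ?W"
  then have "p \<in> - fst ` dist_support ?W" by (simp add: p_def)
  with X obtain r where r: "r > 0" "cball p r \<subseteq> - fst ` dist_support ?W"
    by (metis open_Compl open_contains_cball)
  \<comment> \<open>The points whose image under \<open>T\<^sup>-\<^sup>1\<close> has its first
    component in the ball; a product neighbourhood \<open>U \<times> V\<close> inside this set
    localises \<open>f\<close> and \<open>g\<close>.\<close>
  define O' where "O' = {z. dist (fst (?L z)) p < r}"
  have "continuous_on UNIV (\<lambda>z. dist (fst (?L z)) p)"
    by (intro continuous_intros linear_continuous_on linear_conv_bounded_linear[THEN iffD1] linear_phase_map)
  then have "open O'" unfolding O'_def by (intro open_Collect_less continuous_on_const)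
  moreover have "(s, t) \<in> O'" using r(1) by (simp add: O'_def p_def)
  ultimately obtain U V where UV: "open U" "open V" "s \<in> U" "t \<in> V" "U \<times> V \<subseteq> O'"
    by (auto elim: open_prod_elim)
  obtain f where f: "schwartz f" "\<mu> f \<noteq> 0" "\<And>x. f x \<noteq> 0 \<Longrightarrow> x \<in> U"
    using in_dist_supportD[OF s UV(1,3)] by blast
  obtain g where g: "schwartz g" "\<nu> g \<noteq> 0" "\<And>x. g x \<noteq> 0 \<Longrightarrow> x \<in> V"
    using in_dist_supportD[OF t UV(2,4)] by blast
  define \<Phi> where "\<Phi> = (\<lambda>(x, t). f x * cnj (g t))"
  have \<Phi>: "schwartz \<Phi>" unfolding \<Phi>_def by (rule schwartz_tensor[OF f(1) schwartz_cnj[OF g(1)]])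
  \<comment> \<open>The sign in the second variable cancels the reflection produced by applying
    \<open>fourier2_fun\<close> twice.\<close>
  define H where "H z = \<Phi> (phase_map T (fst z, - snd z))" for z
  have lin: "linear (\<lambda>z::(real ^ 'n) \<times> (real ^ 'n). phase_map T (fst z, - snd z))"
  proof -
    have "linear (\<lambda>z::(real ^ 'n) \<times> (real ^ 'n). (fst z, - snd z))" by (rule linearI) auto
    from linear_compose[OF this linear_phase_map] show ?thesis by (simp add: o_def)
  qed
  have inj: "inj (\<lambda>z::(real ^ 'n) \<times> (real ^ 'n). phase_map T (fst z, - snd z))"
    by (rule inj_on_inverseI[where g = "\<lambda>z. (fst (?L z), - snd (?L z))"]) (simp add: phase_map_inverse)
  have H: "schwartz H" unfolding H_def[abs_def] by (rule schwartz_compose_linear[OF \<Phi> lin inj])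
  define F where "F = fourier2_fun H"
  have F: "schwartz F" unfolding F_def by (rule schwartz_fourier2_fun[OF H])
  obtain c where c: "c \<noteq> 0" "\<And>(F::(real ^ 'n) \<times> (real ^ 'n) \<Rightarrow> complex) x w. schwartz F \<Longrightarrow>
      fourier2_fun (fourier2_fun F) (x, w) = c * F (x, - w)"
    using fourier2_fun_fourier2_fun by blast
  have "?W F \<noteq> 0"
  proof (rule matrix_wigner_nonzeroI[OF f(1) g(1) f(2) g(2) c(1)])
    fix z
    show "fourier2_fun F z = c * (case phase_map T z of (x, t) \<Rightarrow> f x * cnj (g t))"
      using c(2)[OF H, of "fst z" "snd z"] by (simp add: F_def H_def \<Phi>_def)
  qed
  moreover have "?W F = 0"
  proof (rule bounded_functional_eq_0_closed[OF bounded_functional_matrix_wigner F])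
    show "closed (cball p r \<times> UNIV)" by (intro closed_Times) auto
    show "cball p r \<times> UNIV \<inter> dist_support ?W = {}" using r(2) by force
    fix z assume "F z \<noteq> 0"
    \<comment> \<open>\<open>F z\<close> is an integral over the slice of \<open>H\<close> at
      \<open>fst z\<close>. If it is nonzero, \<open>H\<close> is nonzero somewhere on the slice,
      and the supports of \<open>f\<close> and \<open>g\<close> then confine \<open>fst z\<close> to
      the ball.\<close>
    have "\<exists>w. H (fst z, w) \<noteq> 0"
    proof (rule ccontr)
      assume "\<nexists>w. H (fst z, w) \<noteq> 0"
      then have "F (fst z, snd z) = 0" by (simp add: F_def fourier2_fun_character del: prod.collapse)
      with \<open>F z \<noteq> 0\<close> show False by simp
    qed
    then obtain w where "\<Phi> (phase_map T (fst z, - w)) \<noteq> 0" by (auto simp: H_def)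
    then have "phase_map T (fst z, - w) \<in> U \<times> V"
      using f(3) g(3) by (auto simp: \<Phi>_def split: prod.splits)
    with UV(5) have "phase_map T (fst z, - w) \<in> O'" by (rule subsetD)
    then have "dist (fst z) p < r" by (simp add: O'_def phase_map_inverse)
    then show "z \<in> cball p r \<times> UNIV" by (cases z) (simp add: dist_commute)
  qed
  ultimately show False by simp
qed

text \<open>Dually, \<open>fourier1_fun\<close> leaves the second variable alone and combines with
  \<open>fourier2_fun\<close> to the full transform, which turns composition with the inverse
  transpose of \<open>T\<close> into composition with \<open>T\<close>, up to a constant. The sign
  at \<open>t\<close> comes from the conjugation of \<open>\<nu>\<close>, which reflects
  frequencies.\<close>

lemma dist_support_matrix_wigner_snd:
  assumes s: "s \<in> dist_support (fourier \<mu>)" and t: "t \<in> dist_support (fourier \<nu>)"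
    and X: "closed (snd ` dist_support (matrix_wigner T \<mu> \<nu>))"
  shows "snd (phase_map (transpose T) (s, - t)) \<in> snd ` dist_support (matrix_wigner T \<mu> \<nu>)"
proof (rule ccontr)
  let ?W = "matrix_wigner T \<mu> \<nu>" and ?N = "phase_map (transpose T)"
    and ?M = "phase_map (transpose (matrix_inv T))"
  define p where "p = snd (?N (s, - t))"
  assume "snd (?N (s, - t)) \<notin> snd ` dist_support ?W"
  then have "p \<in> - snd ` dist_support ?W" by (simp add: p_def)
  with X obtain r where r: "r > 0" "cball p r \<subseteq> - snd ` dist_support ?W"
    by (metis open_Compl open_contains_cball)
  define O' where "O' = {z. dist (snd (?N z)) p < r}"
  have "continuous_on UNIV (\<lambda>z. dist (snd (?N z)) p)"
    by (intro continuous_intros linear_continuous_on linear_conv_bounded_linear[THEN iffD1] linear_phase_map)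
  then have "open O'" unfolding O'_def by (intro open_Collect_less continuous_on_const)
  moreover have "(s, - t) \<in> O'" using r(1) by (simp add: O'_def p_def)
  ultimately obtain U V where UV: "open U" "open V" "s \<in> U" "- t \<in> V" "U \<times> V \<subseteq> O'"
    by (auto elim: open_prod_elim)
  have V: "open (uminus -` V)" "t \<in> uminus -` V"
    using UV(4) by (simp_all add: open_vimage[OF UV(2)] continuous_on_minus)
  obtain f where f: "schwartz f" "fourier \<mu> f \<noteq> 0" "\<And>x. f x \<noteq> 0 \<Longrightarrow> x \<in> U"
    using in_dist_supportD[OF s UV(1,3)] by blast
  obtain g where g: "schwartz g" "fourier \<nu> g \<noteq> 0" "\<And>x. g x \<noteq> 0 \<Longrightarrow> x \<in> uminus -` V"
    using in_dist_supportD[OF t V] by blast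
  \<comment> \<open>Conjugation combined with reflection makes the transform of \<open>h\<close> the
    conjugate of that of \<open>g\<close>; it also moves the support from near \<open>t\<close> to
    near \<open>- t\<close>.\<close>
  define h where "h x = cnj (g (- x))" for x
  have h: "schwartz h"
    using schwartz_cnj[OF schwartz_scale[OF g(1), of "-1"]] by (simp add: h_def[abs_def])
  have hV: "x \<in> V" if "h x \<noteq> 0" for x
    using g(3)[of "- x"] that by (simp add: h_def)
  have fh: "fourier_fun h w = cnj (fourier_fun g w)" for w
  proof -
    have "(\<lambda>x. h x * character w x) \<in> borel_measurable borel"
      using schwartz_single_integrable(2)[OF h] by simp
    from integral_lborel_scale[OF this, of "-1"]
    have "fourier_fun h w = (\<integral>x. h (- x) * character w (- x) \<partial>lborel)"
      by (simp add: fourier_fun_character)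
    also have "\<dots> = (\<integral>x. cnj (g x * character w x) \<partial>lborel)"
      by (simp add: h_def character_def cis_cnj)
    also have "\<dots> = cnj (fourier_fun g w)"
      by (simp only: fourier_fun_character Bochner_Integration.integral_cnj)
    finally show ?thesis .
  qed
  define \<Phi> where "\<Phi> = (\<lambda>(x, t). f x * h t)"
  have \<Phi>: "schwartz \<Phi>" unfolding \<Phi>_def by (rule schwartz_tensor[OF f(1) h])
  have inj: "inj ?M"
    by (rule inj_on_inverseI[where g = ?N]) (simp add: phase_map_inverse)
  define H where "H z = \<Phi> (?M z)" for z
  have H: "schwartz H" unfolding H_def[abs_def] by (rule schwartz_compose_linear[OF \<Phi> linear_phase_map inj])
  define F where "F = fourier1_fun H"
  have F: "schwartz F" unfolding F_def by (rule schwartz_fourier1_fun[OF H])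
  have adj: "phase_map T z \<bullet> ?M x = z \<bullet> x" for z x
    by (simp add: phase_map_adjoint phase_map_inverse)
  obtain c where c: "c \<noteq> 0" "\<And>(f::(real ^ 'n) \<times> (real ^ 'n) \<Rightarrow> complex) z. schwartz f \<Longrightarrow>
      fourier_fun (\<lambda>x. f (?M x)) z = c * fourier_fun f (phase_map T z)"
    using fourier_fun_compose_linear[OF linear_phase_map inj linear_phase_map phase_map_inverse(4) adj] by blast
  have "?W F \<noteq> 0"
  proof (rule matrix_wigner_nonzeroI[OF schwartz_fourier_fun[OF f(1)] schwartz_fourier_fun[OF g(1)] _ _ c(1)])
    show "\<mu> (fourier_fun f) \<noteq> 0" "\<nu> (fourier_fun g) \<noteq> 0" using f(2) g(2) by (simp_all add: fourier_def)
    fix z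
    obtain x y where xy: "phase_map T z = (x, y)" by (cases "phase_map T z")
    have "fourier2_fun F = fourier_fun H"
      unfolding F_def by (rule fourier2_fun_fourier1_fun[OF H])
    then have "fourier2_fun F z = c * fourier_fun \<Phi> (x, y)"
      using c(2)[OF \<Phi>, of z] by (simp add: H_def[abs_def] xy)
    then show "fourier2_fun F z = c * (case phase_map T z of (x, t) \<Rightarrow> fourier_fun f x * cnj (fourier_fun g t))"
      unfolding \<Phi>_def fourier_fun_tensor[OF f(1) h] fh by (simp add: xy)
  qed
  moreover have "?W F = 0"
  proof (rule bounded_functional_eq_0_closed[OF bounded_functional_matrix_wigner F])
    show "closed (UNIV \<times> cball p r)" by (intro closed_Times) auto
    show "UNIV \<times> cball p r \<inter> dist_support ?W = {}" using r(2) by force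
    fix z assume "F z \<noteq> 0"
    have "\<exists>y. H (y, snd z) \<noteq> 0"
    proof (rule ccontr)
      assume "\<nexists>y. H (y, snd z) \<noteq> 0"
      then have "F (fst z, snd z) = 0"
        unfolding F_def fourier1_fun_def by (simp add: fourier_fun_character del: prod.collapse)
      with \<open>F z \<noteq> 0\<close> show False by simp
    qed
    then obtain y where y: "\<Phi> (?M (y, snd z)) \<noteq> 0" by (auto simp: H_def)
    then have "?M (y, snd z) \<in> U \<times> V"
      using f(3) hV by (auto simp: \<Phi>_def split: prod.splits)
    with UV(5) have "?M (y, snd z) \<in> O'" by (rule subsetD)
    then have "dist (snd z) p < r" by (simp add: O'_def phase_map_inverse)
    then show "z \<in> UNIV \<times> cball p r" by (cases z) (simp add: dist_commute)
  qed
  ultimately show False by simp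
qed

end

section \<open>Uniformly discrete preimages and the final deduction\<close>

lemma uniform_discrete_linear_preimage:
  fixes l :: "'a::euclidean_space \<Rightarrow> 'b::real_normed_vector"
  assumes X: "uniform_discrete X" and l: "linear l" "\<And>x. l x = 0 \<Longrightarrow> x = 0"
    and S: "\<And>s. s \<in> S \<Longrightarrow> l s + c \<in> X"
  shows "uniform_discrete S"
proof -
  obtain e where e: "e > 0" "\<And>x y. x \<in> X \<Longrightarrow> y \<in> X \<Longrightarrow> dist x y < e \<Longrightarrow> x = y"
    using X unfolding uniform_discrete_def by blast
  obtain K where K: "K > 0" "\<And>x. norm (l x) \<le> norm x * K"
    using bounded_linear.pos_bounded[of l] l(1) linear_conv_bounded_linear by blast
  \<comment> \<open>\<open>l\<close> stretches distances by at most \<open>K\<close>, so points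
    closer than \<open>e / K\<close> have images closer than \<open>e\<close>, which therefore
    coincide; injectivity concludes.\<close>
  have "s = t" if "s \<in> S" "t \<in> S" "dist s t < e / K" for s t
  proof -
    have "dist (l s + c) (l t + c) = norm (l (s - t))"
      by (simp add: dist_norm linear_diff[OF l(1)])
    also have "\<dots> \<le> norm (s - t) * K" by (rule K(2))
    also have "\<dots> < e" using that(3) K(1) by (simp add: dist_norm pos_less_divide_eq)
    finally have "l s + c = l t + c" using e(2)[OF S[OF that(1)] S[OF that(2)]] by blast
    then have "l (s - t) = 0" by (simp add: linear_diff[OF l(1)])
    then show "s = t" using l(2) by fastforce
  qed
  then show ?thesis using e(1) K(1) unfolding uniform_discrete_def by (intro exI[of _ "e / K"]) auto
qed

lemma det_nonzero_inj:
  fixes A :: "real ^ 'n ^ 'n"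
  assumes "det A \<noteq> 0" "A *v x = 0"
  shows "x = 0"
  using assms by (metis invertible_det_nz matrix_left_invertible_ker invertible_def)

text \<open>\<open>A\<close> is onto, so \<open>p\<close> is orthogonal to itself.\<close>

lemma det_nonzero_orthogonal:
  fixes A :: "real ^ 'n ^ 'n"
  assumes "det A \<noteq> 0" "\<And>x. p \<bullet> (A *v x) = 0"
  shows "p = 0"
proof -
  have "A *v (matrix_inv A *v p) = p"
    using assms(1) by (simp add: matrix_vector_mul_assoc matrix_inv_mult invertible_det_nz)
  then show ?thesis using assms(2)[of "matrix_inv A *v p"] by simp
qed

context
  fixes T :: "real ^ ('n + 'n) ^ ('n::finite + 'n)"
    and A B C D :: "real ^ 'n ^ 'n"
    and \<mu> \<nu> :: "(real ^ 'n) functional"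
  assumes T: "invertible T" and block: "matrix_inv T = block_matrix A B C D"
    and \<mu>: "bounded_functional \<mu>" and \<nu>: "bounded_functional \<nu>"
    and fst_discrete: "uniform_discrete (fst ` dist_support (matrix_wigner T \<mu> \<nu>))"
    and snd_discrete: "uniform_discrete (snd ` dist_support (matrix_wigner T \<mu> \<nu>))"
begin

text \<open>Uniform discreteness of the projection enters here as its closedness.\<close>

lemma wigner_fst_mem:
  assumes "s \<in> dist_support \<mu>" "t \<in> dist_support \<nu>"
  shows "A *v s + B *v t \<in> fst ` dist_support (matrix_wigner T \<mu> \<nu>)"
  using dist_support_matrix_wigner_fst[OF T \<mu> \<nu> assms uniform_discrete_imp_closed[OF fst_discrete]]
  by (simp add: block phase_map_block_matrix)

lemma uniform_discrete_support_left:
  assumes "det A \<noteq> 0" "dist_support \<nu> \<noteq> {}"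
  shows "uniform_discrete (dist_support \<mu>)"
proof -
  obtain t where "t \<in> dist_support \<nu>" using assms(2) by blast
  then show ?thesis
    using wigner_fst_mem det_nonzero_inj[OF assms(1)]
    by (intro uniform_discrete_linear_preimage[OF fst_discrete, of "(*v) A" _ "B *v t"] matrix_vector_mul_linear) auto
qed

lemma uniform_discrete_support_right:
  assumes "det B \<noteq> 0" "dist_support \<mu> \<noteq> {}"
  shows "uniform_discrete (dist_support \<nu>)"
proof -
  obtain s where "s \<in> dist_support \<mu>" using assms(2) by blast
  then show ?thesis
    using wigner_fst_mem[of s] det_nonzero_inj[OF assms(1)]
    by (intro uniform_discrete_linear_preimage[OF fst_discrete, of "(*v) B" _ "A *v s"] matrix_vector_mul_linear)
      (auto simp: add.commute)
qed

text \<open>Applying \<open>T\<^sup>t\<close> to one argument and \<open>T\<^sup>-\<^sup>1\<close>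
  to the other preserves the inner product. When the second component of \<open>T\<^sup>t z\<close>
  vanishes, only first components count, that is, the blocks \<open>A\<close> and \<open>B\<close>
  of the inverse; this is how they control blocks of \<open>T\<close> itself.\<close>

lemma snd_transpose_orthogonal:
  assumes "snd (phase_map (transpose T) z) = 0"
  shows "fst (phase_map (transpose T) z) \<bullet> fst (phase_map (matrix_inv T) y) = z \<bullet> y"
proof -
  have "z \<bullet> y = phase_map (transpose T) z \<bullet> phase_map (matrix_inv T) y"
    by (simp add: phase_map_adjoint phase_map_inverse[OF T \<mu> \<nu>])
  then show ?thesis using assms by (simp add: inner_prod_def)
qed

lemma phase_map_transpose_eq_0: "phase_map (transpose T) z = 0 \<Longrightarrow> z = 0"
  using phase_map_inverse(4)[OF T \<mu> \<nu>, of z] linear_0[OF linear_phase_map] by metis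

text \<open>The map taking \<open>s\<close> to the second component of
  \<open>T\<^sup>t (s, 0)\<close> is injective: if it annihilates \<open>x\<close>, pairing
  \<open>(x, 0)\<close> with \<open>(0, y)\<close> shows the first component to be orthogonal to the
  range of \<open>B\<close>, hence 0. So \<open>B\<close> governs the transform of
  \<open>\<mu>\<close>, whereas \<open>A\<close> governs \<open>\<mu>\<close>.\<close>

lemma uniform_discrete_fourier_support_left:
  assumes "det B \<noteq> 0" "dist_support (fourier \<nu>) \<noteq> {}"
  shows "uniform_discrete (dist_support (fourier \<mu>))"
proof -
  let ?N = "phase_map (transpose T)"
  obtain t where t: "t \<in> dist_support (fourier \<nu>)" using assms(2) by blast
  show ?thesis
  proof (rule uniform_discrete_linear_preimage[OF snd_discrete, of "\<lambda>s. snd (?N (s, 0))" _ "snd (?N (0, - t))"])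
    show "linear (\<lambda>s. snd (?N (s, 0)))"
      using linear_add[OF linear_phase_map[of "transpose T"], symmetric] linear_scale[OF linear_phase_map[of "transpose T"], symmetric]
      by (intro linearI) (simp_all flip: snd_add snd_scaleR)
  next
    fix x assume x: "snd (?N (x, 0)) = 0"
    have "fst (?N (x, 0)) \<bullet> (B *v y) = 0" for y
      using snd_transpose_orthogonal[OF x, of "(0, y)"] by (simp add: block phase_map_block_matrix)
    then have "fst (?N (x, 0)) = 0" by (rule det_nonzero_orthogonal[OF assms(1)])
    with x have "?N (x, 0) = 0" by (simp add: prod_eq_iff)
    then show "x = 0" using phase_map_transpose_eq_0[of "(x, 0)"] by (simp add: zero_prod_def)
  next
    fix s assume "s \<in> dist_support (fourier \<mu>)"
    from dist_support_matrix_wigner_snd[OF T \<mu> \<nu> this t uniform_discrete_imp_closed[OF snd_discrete]]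
    show "snd (?N (s, 0)) + snd (?N (0, - t)) \<in> snd ` dist_support (matrix_wigner T \<mu> \<nu>)"
      by (simp flip: snd_add linear_add[OF linear_phase_map])
  qed
qed

text \<open>Pairing \<open>(0, - x)\<close> with \<open>(y, 0)\<close> brings in \<open>A\<close> in
  place of \<open>B\<close>.\<close>

lemma uniform_discrete_fourier_support_right:
  assumes "det A \<noteq> 0" "dist_support (fourier \<mu>) \<noteq> {}"
  shows "uniform_discrete (dist_support (fourier \<nu>))"
proof -
  let ?N = "phase_map (transpose T)"
  obtain s where s: "s \<in> dist_support (fourier \<mu>)" using assms(2) by blast
  show ?thesis
  proof (rule uniform_discrete_linear_preimage[OF snd_discrete, of "\<lambda>t. snd (?N (0, - t))" _ "snd (?N (s, 0))"])
    show "linear (\<lambda>t. snd (?N (0, - t)))"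
      using linear_add[OF linear_phase_map[of "transpose T"], symmetric] linear_scale[OF linear_phase_map[of "transpose T"], symmetric]
      by (intro linearI) (simp_all flip: snd_add snd_scaleR)
  next
    fix x assume x: "snd (?N (0, - x)) = 0"
    have "fst (?N (0, - x)) \<bullet> (A *v y) = 0" for y
      using snd_transpose_orthogonal[OF x, of "(y, 0)"] by (simp add: block phase_map_block_matrix)
    then have "fst (?N (0, - x)) = 0" by (rule det_nonzero_orthogonal[OF assms(1)])
    with x have "?N (0, - x) = 0" by (simp add: prod_eq_iff)
    then show "x = 0" using phase_map_transpose_eq_0[of "(0, - x)"] by (simp add: zero_prod_def)
  next
    fix t assume "t \<in> dist_support (fourier \<nu>)"
    from dist_support_matrix_wigner_snd[OF T \<mu> \<nu> s this uniform_discrete_imp_closed[OF snd_discrete]]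
    show "snd (?N (0, - t)) + snd (?N (s, 0)) \<in> snd ` dist_support (matrix_wigner T \<mu> \<nu>)"
      by (simp flip: snd_add linear_add[OF linear_phase_map])
  qed
qed

end

text \<open>In the first part, \<open>\<nu> = 0\<close> would give a Wigner transform with empty
  support and leave \<open>\<mu>\<close> arbitrary; \<open>nonzero_distribution\<close> excludes
  this degenerate case. In the second part, a vanishing \<open>\<mu>\<close> has empty support,
  which is uniformly discrete.\<close>

theorem corollary14:
  fixes T :: "real ^ ('n + 'n) ^ ('n::finite + 'n)"
    and A B C D :: "real ^ 'n ^ 'n"
    and \<mu> \<nu> :: "(real ^ 'n) functional"
  assumes "invertible T"
    and "matrix_inv T = block_matrix A B C D"
    and "tempered_distribution \<mu>" and "tempered_distribution \<nu>"
  shows "(det A \<noteq> 0 \<and> det B \<noteq> 0 \<and> nonzero_distribution \<mu> \<and> nonzero_distribution \<nu> \<and>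
          uniform_discrete (fst ` dist_support (matrix_wigner T \<mu> \<nu>)) \<and>
          uniform_discrete (snd ` dist_support (matrix_wigner T \<mu> \<nu>))
          \<longrightarrow> uniform_discrete (dist_support \<mu>) \<and> uniform_discrete (dist_support \<nu>) \<and>
              uniform_discrete (dist_support (fourier \<mu>)) \<and>
              uniform_discrete (dist_support (fourier \<nu>)))
       \<and> ((det A \<noteq> 0 \<or> det B \<noteq> 0) \<and>
          uniform_discrete (fst ` dist_support (matrix_wigner T \<mu> \<mu>)) \<and>
          uniform_discrete (snd ` dist_support (matrix_wigner T \<mu> \<mu>))
          \<longrightarrow> uniform_discrete (dist_support \<mu>) \<and>
              uniform_discrete (dist_support (fourier \<mu>)))"
proof (intro conjI impI; elim conjE)
  note \<mu> = bounded_functional_tempered[OF assms(3)] and \<nu> = bounded_functional_tempered[OF assms(4)]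
  {
    assume det: "det A \<noteq> 0" "det B \<noteq> 0"
      and nz: "nonzero_distribution \<mu>" "nonzero_distribution \<nu>"
      and discrete: "uniform_discrete (fst ` dist_support (matrix_wigner T \<mu> \<nu>))"
        "uniform_discrete (snd ` dist_support (matrix_wigner T \<mu> \<nu>))"
    note * = assms(1,2) \<mu> \<nu> discrete
    note ne = dist_support_nonempty[OF \<mu> nz(1)] dist_support_nonempty[OF \<nu> nz(2)]
      dist_support_nonempty[OF bounded_functional_fourier[OF \<mu>] nonzero_distribution_fourier[OF \<mu> nz(1)]]
      dist_support_nonempty[OF bounded_functional_fourier[OF \<nu>] nonzero_distribution_fourier[OF \<nu> nz(2)]]
    show "uniform_discrete (dist_support \<mu>)" "uniform_discrete (dist_support \<nu>)"
      "uniform_discrete (dist_support (fourier \<mu>))" "uniform_discrete (dist_support (fourier \<nu>))"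
      using uniform_discrete_support_left[OF * det(1) ne(2)] uniform_discrete_support_right[OF * det(2) ne(1)]
        uniform_discrete_fourier_support_left[OF * det(2) ne(4)]
        uniform_discrete_fourier_support_right[OF * det(1) ne(3)] by auto
  next
    assume det: "det A \<noteq> 0 \<or> det B \<noteq> 0"
      and discrete: "uniform_discrete (fst ` dist_support (matrix_wigner T \<mu> \<mu>))"
        "uniform_discrete (snd ` dist_support (matrix_wigner T \<mu> \<mu>))"
    note * = assms(1,2) \<mu> \<mu> discrete
    \<comment> \<open>With \<open>\<nu> = \<mu>\<close> one determinant is enough:
      \<open>det A\<close> treats the support as that of the left argument, \<open>det B\<close> as
      that of the right one. For the Fourier transform the two roles are exchanged.\<close>
    show "uniform_discrete (dist_support \<mu>)"
      using det uniform_discrete_support_left[OF *] uniform_discrete_support_right[OF *]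
      by (cases "dist_support \<mu> = {}") auto
    show "uniform_discrete (dist_support (fourier \<mu>))"
      using det uniform_discrete_fourier_support_left[OF *] uniform_discrete_fourier_support_right[OF *]
      by (cases "dist_support (fourier \<mu>) = {}") auto
  }
qed

end
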